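(* Let $(G,P)$ be a totally-ordered amenable group, and let $E$ be a product system over $P$. If $E_s$ is infinite-dimensional for every $s\in P\setminus\{e\}$, then $C^*(P,E)$ is simple.
   Context: Inner products are linear in the first variable. A totally-ordered amenable group $(G,P)$ is a discrete amenable group $G$ with a subsemigroup $P$ such that $P\cap P^{-1}=\{e\}$ and $P\cup P^{-1}=G$, so that $s\le t\iff s^{-1}t\in P$ is a left-invariant total order on $G$. The semigroup $P$ is assumed countable. A product system over $P$ is a family $p:E\to P$ of nontrivial separable complex Hilbert spaces $E_t:=p^{-1}(t)$ with an associative multiplication $E\times E\to E$ such that $p(xy)=p(x)p(y)$ and for all $s,t\in P$ the map $x\otimes y\in E_s\otimes E_t\mapsto xy\in E_{st}$ extends to a unitary isomorphism; also $\dim E_e=1$, so $E$ has an identity. A representation of $E$ in a unital $C^*$-algebra $B$ is a map $\phi:E\to B$ with (i) $\phi(xy)=\phi(x)\phi(y)$ for all $x,y\in E$, and (ii) $\phi(y)^*\phi(x)=\langle x,y\rangle 1$ if $p(x)=p(y)$. $C^*(P,E)$ is the unital $C^*$-algebra which is universal for representations of $E$: it is generated by the image of a representation $i:E\to C^*(P,E)$, and for every representation $\phi$ of $E$ in a unital $C^*$-algebra $B$ there is a unital $*$-homomorphism $\phi_*:C^*(P,E)\to B$ with $\phi=\phi_*\circ i$. A $C^*$-algebra is simple if it has no nontrivial closed two-sided ideals. *)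

theory Defs
  imports "HOL-Analysis.Analysis" "HOL-Algebra.Ideal" "HOL-Algebra.Module" "HOL-Algebra.Subrings"
begin

section \<open>Totally ordered amenable groups\<close>

text \<open>Amenability of a discrete group: a left-invariant mean on the bounded real functions.
  Positivity is tested on the carrier only, so by linearity \<open>m f\<close> does not depend on the values of
  \<open>f\<close> outside the carrier.\<close>

definition left_invariant_mean :: "('g, 'm) monoid_scheme \<Rightarrow> (('g \<Rightarrow> real) \<Rightarrow> real) \<Rightarrow> bool" where
  "left_invariant_mean G m \<longleftrightarrow>
     (\<forall>f g. bounded (f ` carrier G) \<longrightarrow> bounded (g ` carrier G) \<longrightarrow>
        m (\<lambda>x. f x + g x) = m f + m g) \<and>
     (\<forall>c f. bounded (f ` carrier G) \<longrightarrow> m (\<lambda>x. c * f x) = c * m f) \<and>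
     (\<forall>f. bounded (f ` carrier G) \<longrightarrow> (\<forall>x\<in>carrier G. 0 \<le> f x) \<longrightarrow> 0 \<le> m f) \<and>
     m (\<lambda>_. 1) = 1 \<and>
     (\<forall>f. bounded (f ` carrier G) \<longrightarrow>
        (\<forall>s\<in>carrier G. m (\<lambda>x. f (s \<otimes>\<^bsub>G\<^esub> x)) = m f))"

definition amenable :: "('g, 'm) monoid_scheme \<Rightarrow> bool" where
  "amenable G \<longleftrightarrow> (\<exists>m. left_invariant_mean G m)"

locale totally_ordered_amenable_group = group G for G (structure) +
  fixes P :: "'a set"
  assumes amenable: "amenable G"
    and P_subset: "P \<subseteq> carrier G"
    and P_closed: "\<lbrakk>s \<in> P; t \<in> P\<rbrakk> \<Longrightarrow> s \<otimes> t \<in> P"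
    and P_Int_inverse: "P \<inter> (\<lambda>s. inv s) ` P = {\<one>}"
    and P_Un_inverse: "P \<union> (\<lambda>s. inv s) ` P = carrier G"
    and P_countable: "countable P"

section \<open>Normed structures on carriers\<close>

definition complex_ring :: "complex ring" where
  "complex_ring = \<lparr>carrier = UNIV, mult = (*), one = 1, ring.zero = 0, add = (+)\<rparr>"

text \<open>The distance is cut off outside the carrier, since \<^locale>\<open>Metric_space\<close> asks for
  nonnegativity and symmetry on the whole type.\<close>

definition norm_dist :: "('a, 'm) ring_scheme \<Rightarrow> ('a \<Rightarrow> real) \<Rightarrow> 'a \<Rightarrow> 'a \<Rightarrow> real" where
  "norm_dist M n x y =
     (if x \<in> carrier M \<and> y \<in> carrier M then n (x \<ominus>\<^bsub>M\<^esub> y) else 0)"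

definition norm_topology :: "('a, 'm) ring_scheme \<Rightarrow> ('a \<Rightarrow> real) \<Rightarrow> 'a topology" where
  "norm_topology M n = Metric_space.mtopology (carrier M) (norm_dist M n)"

definition norm_complete :: "('a, 'm) ring_scheme \<Rightarrow> ('a \<Rightarrow> real) \<Rightarrow> bool" where
  "norm_complete M n \<longleftrightarrow> Metric_space.mcomplete (carrier M) (norm_dist M n)"

section \<open>Complex Hilbert spaces\<close>

text \<open>As for modules in \<^theory>\<open>HOL-Algebra.Module\<close>, the ring fields \<open>mult\<close> and \<open>one\<close>
  of the record play no role.  Inner products are linear in the first variable.\<close>

record 'a hilbert = "(complex, 'a) module" +
  cinner :: "'a \<Rightarrow> 'a \<Rightarrow> complex"

definition hnorm :: "'a hilbert \<Rightarrow> 'a \<Rightarrow> real" where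
  "hnorm H x = sqrt (Re (cinner H x x))"

locale hilbert_space = Module.module complex_ring H for H :: "'a hilbert" (structure) +
  assumes cinner_add_left:
      "\<lbrakk>x \<in> carrier H; y \<in> carrier H; z \<in> carrier H\<rbrakk> \<Longrightarrow>
        cinner H (x \<oplus> y) z = cinner H x z + cinner H y z"
    and cinner_smult_left:
      "\<lbrakk>x \<in> carrier H; y \<in> carrier H\<rbrakk> \<Longrightarrow> cinner H (c \<odot> x) y = c * cinner H x y"
    and cinner_commute:
      "\<lbrakk>x \<in> carrier H; y \<in> carrier H\<rbrakk> \<Longrightarrow> cinner H y x = cnj (cinner H x y)"
    and cinner_nonneg: "x \<in> carrier H \<Longrightarrow> 0 \<le> Re (cinner H x x)"
    and cinner_definite: "\<lbrakk>x \<in> carrier H; cinner H x x = 0\<rbrakk> \<Longrightarrow> x = \<zero>"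
    and hilbert_complete: "norm_complete H (hnorm H)"

definition cspan :: "'a hilbert \<Rightarrow> 'a set \<Rightarrow> 'a set" where
  "cspan H S = \<Inter>{V. submodule V complex_ring H \<and> S \<subseteq> V}"

definition finite_dimensional :: "'a hilbert \<Rightarrow> bool" where
  "finite_dimensional H \<longleftrightarrow> (\<exists>S. finite S \<and> S \<subseteq> carrier H \<and> cspan H S = carrier H)"

definition one_dimensional :: "'a hilbert \<Rightarrow> bool" where
  "one_dimensional H \<longleftrightarrow> (\<exists>u\<in>carrier H. u \<noteq> \<zero>\<^bsub>H\<^esub> \<and> cspan H {u} = carrier H)"

definition unitary_iso :: "'a hilbert \<Rightarrow> 'b hilbert \<Rightarrow> ('a \<Rightarrow> 'b) \<Rightarrow> bool" where
  "unitary_iso H K U \<longleftrightarrow>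
     bij_betw U (carrier H) (carrier K) \<and>
     (\<forall>x\<in>carrier H. \<forall>y\<in>carrier H. U (x \<oplus>\<^bsub>H\<^esub> y) = U x \<oplus>\<^bsub>K\<^esub> U y) \<and>
     (\<forall>c. \<forall>x\<in>carrier H. U (c \<odot>\<^bsub>H\<^esub> x) = c \<odot>\<^bsub>K\<^esub> U x) \<and>
     (\<forall>x\<in>carrier H. \<forall>y\<in>carrier H. cinner K (U x) (U y) = cinner H x y)"

text \<open>\<open>T\<close> with the elementary tensors \<open>\<tau> x y\<close> is the Hilbert space tensor product of
  \<open>H\<close> and \<open>K\<close>: the completion of their algebraic tensor product for the inner product determined
  by the last but one condition.  These data are unique up to a unitary respecting \<open>\<tau>\<close>.\<close>

definition hilbert_tensor_product ::
    "'a hilbert \<Rightarrow> 'b hilbert \<Rightarrow> 'c hilbert \<Rightarrow> ('a \<Rightarrow> 'b \<Rightarrow> 'c) \<Rightarrow> bool" where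
  "hilbert_tensor_product H K T \<tau> \<longleftrightarrow>
     hilbert_space T \<and>
     (\<forall>x\<in>carrier H. \<forall>y\<in>carrier K. \<tau> x y \<in> carrier T) \<and>
     (\<forall>x\<in>carrier H. \<forall>x'\<in>carrier H. \<forall>y\<in>carrier K.
        \<tau> (x \<oplus>\<^bsub>H\<^esub> x') y = \<tau> x y \<oplus>\<^bsub>T\<^esub> \<tau> x' y) \<and>
     (\<forall>x\<in>carrier H. \<forall>y\<in>carrier K. \<forall>y'\<in>carrier K.
        \<tau> x (y \<oplus>\<^bsub>K\<^esub> y') = \<tau> x y \<oplus>\<^bsub>T\<^esub> \<tau> x y') \<and>
     (\<forall>c. \<forall>x\<in>carrier H. \<forall>y\<in>carrier K.
        \<tau> (c \<odot>\<^bsub>H\<^esub> x) y = c \<odot>\<^bsub>T\<^esub> \<tau> x y \<and> \<tau> x (c \<odot>\<^bsub>K\<^esub> y) = c \<odot>\<^bsub>T\<^esub> \<tau> x y) \<and>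
     (\<forall>x\<in>carrier H. \<forall>x'\<in>carrier H. \<forall>y\<in>carrier K. \<forall>y'\<in>carrier K.
        cinner T (\<tau> x y) (\<tau> x' y') = cinner H x x' * cinner K y y') \<and>
     Abstract_Topology.closure_of (norm_topology T (hnorm T))
       (cspan T {\<tau> x y | x y. x \<in> carrier H \<and> y \<in> carrier K}) = carrier T"

section \<open>Product systems\<close>

text \<open>\<open>E\<close> is the total space, \<open>F t\<close> is the Hilbert space structure on the fibre over \<open>t\<close>.
  The tensor product of two fibres can be realised on the type \<^typ>\<open>'e \<times> 'e \<Rightarrow> complex\<close>
  (as the Hilbert-Schmidt conjugate-bilinear forms), and it does not matter which
  realisation is used in \<open>pmult_unitary\<close>.\<close>

locale product_system =
  fixes G :: "('g, 'm) monoid_scheme" (structure)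
    and P :: "'g set"
    and E :: "'e set"
    and p :: "'e \<Rightarrow> 'g"
    and F :: "'g \<Rightarrow> 'e hilbert"
    and pmult :: "'e \<Rightarrow> 'e \<Rightarrow> 'e"  (infixl "\<cdot>" 70)
  assumes proj_closed: "x \<in> E \<Longrightarrow> p x \<in> P"
    and carrier_fibre: "t \<in> P \<Longrightarrow> carrier (F t) = {x \<in> E. p x = t}"
    and fibre_hilbert: "t \<in> P \<Longrightarrow> hilbert_space (F t)"
    and fibre_separable: "t \<in> P \<Longrightarrow> separable_space (norm_topology (F t) (hnorm (F t)))"
    and fibre_nontrivial: "t \<in> P \<Longrightarrow> carrier (F t) \<noteq> {\<zero>\<^bsub>F t\<^esub>}"
    and pmult_closed: "\<lbrakk>x \<in> E; y \<in> E\<rbrakk> \<Longrightarrow> x \<cdot> y \<in> E"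
    and pmult_assoc: "\<lbrakk>x \<in> E; y \<in> E; z \<in> E\<rbrakk> \<Longrightarrow> (x \<cdot> y) \<cdot> z = x \<cdot> (y \<cdot> z)"
    and proj_mult: "\<lbrakk>x \<in> E; y \<in> E\<rbrakk> \<Longrightarrow> p (x \<cdot> y) = p x \<otimes> p y"
    and pmult_unitary: "\<lbrakk>s \<in> P; t \<in> P\<rbrakk> \<Longrightarrow>
      \<exists>(T :: ('e \<times> 'e \<Rightarrow> complex) hilbert) \<tau> U.
        hilbert_tensor_product (F s) (F t) T \<tau> \<and>
        unitary_iso T (F (s \<otimes> t)) U \<and>
        (\<forall>x\<in>carrier (F s). \<forall>y\<in>carrier (F t). U (\<tau> x y) = x \<cdot> y)"
    and unit_fibre: "one_dimensional (F \<one>)"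

section \<open>Unital C*-algebras\<close>

record 'a cstar = "(complex, 'a) module" +
  adj :: "'a \<Rightarrow> 'a"
  cnorm :: "'a \<Rightarrow> real"

locale unital_cstar_algebra = ring A + Module.module complex_ring A
  for A :: "'a cstar" (structure) +
  assumes smult_mult_left:
      "\<lbrakk>x \<in> carrier A; y \<in> carrier A\<rbrakk> \<Longrightarrow> (c \<odot> x) \<otimes> y = c \<odot> (x \<otimes> y)"
    and smult_mult_right:
      "\<lbrakk>x \<in> carrier A; y \<in> carrier A\<rbrakk> \<Longrightarrow> x \<otimes> (c \<odot> y) = c \<odot> (x \<otimes> y)"
    and adj_closed: "x \<in> carrier A \<Longrightarrow> adj A x \<in> carrier A"
    and adj_adj: "x \<in> carrier A \<Longrightarrow> adj A (adj A x) = x"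
    and adj_add:
      "\<lbrakk>x \<in> carrier A; y \<in> carrier A\<rbrakk> \<Longrightarrow> adj A (x \<oplus> y) = adj A x \<oplus> adj A y"
    and adj_smult: "x \<in> carrier A \<Longrightarrow> adj A (c \<odot> x) = cnj c \<odot> adj A x"
    and adj_mult:
      "\<lbrakk>x \<in> carrier A; y \<in> carrier A\<rbrakk> \<Longrightarrow> adj A (x \<otimes> y) = adj A y \<otimes> adj A x"
    and cnorm_nonneg: "x \<in> carrier A \<Longrightarrow> 0 \<le> cnorm A x"
    and cnorm_eq_0: "x \<in> carrier A \<Longrightarrow> cnorm A x = 0 \<longleftrightarrow> x = \<zero>"
    and cnorm_triangle:
      "\<lbrakk>x \<in> carrier A; y \<in> carrier A\<rbrakk> \<Longrightarrow> cnorm A (x \<oplus> y) \<le> cnorm A x + cnorm A y"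
    and cnorm_smult: "x \<in> carrier A \<Longrightarrow> cnorm A (c \<odot> x) = cmod c * cnorm A x"
    and cnorm_mult:
      "\<lbrakk>x \<in> carrier A; y \<in> carrier A\<rbrakk> \<Longrightarrow> cnorm A (x \<otimes> y) \<le> cnorm A x * cnorm A y"
    and cstar_identity: "x \<in> carrier A \<Longrightarrow> cnorm A (adj A x \<otimes> x) = (cnorm A x)\<^sup>2"
    and cstar_complete: "norm_complete A (cnorm A)"

definition unital_star_hom :: "'a cstar \<Rightarrow> 'b cstar \<Rightarrow> ('a \<Rightarrow> 'b) \<Rightarrow> bool" where
  "unital_star_hom A B h \<longleftrightarrow>
     h \<in> ring_hom A B \<and>
     (\<forall>c. \<forall>x\<in>carrier A. h (c \<odot>\<^bsub>A\<^esub> x) = c \<odot>\<^bsub>B\<^esub> h x) \<and>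
     (\<forall>x\<in>carrier A. h (adj A x) = adj B (h x))"

definition unital_cstar_subalgebra :: "'a set \<Rightarrow> 'a cstar \<Rightarrow> bool" where
  "unital_cstar_subalgebra S A \<longleftrightarrow>
     subring S A \<and> submodule S complex_ring A \<and> (\<forall>x\<in>S. adj A x \<in> S) \<and>
     closedin (norm_topology A (cnorm A)) S"

definition cstar_generated_by :: "'a cstar \<Rightarrow> 'a set \<Rightarrow> bool" where
  "cstar_generated_by A Z \<longleftrightarrow>
     Z \<subseteq> carrier A \<and> (\<forall>S. unital_cstar_subalgebra S A \<and> Z \<subseteq> S \<longrightarrow> S = carrier A)"

definition cstar_simple :: "'a cstar \<Rightarrow> bool" where
  "cstar_simple A \<longleftrightarrow>
     (\<forall>I. ideal I A \<and> closedin (norm_topology A (cnorm A)) I \<longrightarrow>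
        I = {\<zero>\<^bsub>A\<^esub>} \<or> I = carrier A)"

section \<open>Representations and the universal algebra\<close>

definition ps_representation ::
    "'e set \<Rightarrow> ('e \<Rightarrow> 'g) \<Rightarrow> ('g \<Rightarrow> 'e hilbert) \<Rightarrow> ('e \<Rightarrow> 'e \<Rightarrow> 'e) \<Rightarrow>
     'b cstar \<Rightarrow> ('e \<Rightarrow> 'b) \<Rightarrow> bool" where
  "ps_representation E p F pmult B \<phi> \<longleftrightarrow>
     \<phi> \<in> E \<rightarrow> carrier B \<and>
     (\<forall>x\<in>E. \<forall>y\<in>E. \<phi> (pmult x y) = \<phi> x \<otimes>\<^bsub>B\<^esub> \<phi> y) \<and>
     (\<forall>x\<in>E. \<forall>y\<in>E. p x = p y \<longrightarrow>
        adj B (\<phi> y) \<otimes>\<^bsub>B\<^esub> \<phi> x = cinner (F (p x)) x y \<odot>\<^bsub>B\<^esub> \<one>\<^bsub>B\<^esub>)"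

text \<open>\<open>(A, i)\<close> is the universal C*-algebra of the product system, the target algebras ranging over
  all unital C*-algebras whose carrier is a subset of the type \<^typ>\<open>'b\<close> (HOL cannot quantify over
  types inside a formula).  The fibres are separable and \<open>P\<close> is countable, so the range of a
  representation generates a separable C*-algebra, which has at most continuum many elements.
  Hence for every \<^typ>\<open>'b\<close> with at least continuum many elements this is the
  universal property with respect to all unital C*-algebras.\<close>

definition universal_cstar ::
    "'b itself \<Rightarrow> 'e set \<Rightarrow> ('e \<Rightarrow> 'g) \<Rightarrow> ('g \<Rightarrow> 'e hilbert) \<Rightarrow> ('e \<Rightarrow> 'e \<Rightarrow> 'e) \<Rightarrow>
     'a cstar \<Rightarrow> ('e \<Rightarrow> 'a) \<Rightarrow> bool" where
  "universal_cstar _ E p F pmult A i \<longleftrightarrow>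
     unital_cstar_algebra A \<and>
     ps_representation E p F pmult A i \<and>
     cstar_generated_by A (i ` E) \<and>
     (\<forall>(B :: 'b cstar) \<phi>. unital_cstar_algebra B \<and> ps_representation E p F pmult B \<phi> \<longrightarrow>
        (\<exists>h. unital_star_hom A B h \<and> (\<forall>x\<in>E. \<phi> x = h (i x))))"

end

theory Submission
  imports Defs
begin

text \<open>Let \<open>H s\<close> be the image of the fibre over \<open>s\<close>. The monomials \<open>x y\<^sup>\<star>\<close> with \<open>x \<in> H s\<close>, \<open>y \<in> H t\<close> span a dense
  \<open>*\<close>-subalgebra of \<open>A\<close>, graded by \<open>s t\<^sup>-\<^sup>1 \<in> G\<close>; the monomials of degree \<open>1\<close> span the core. As the fibres
  are infinite-dimensional, there are isometries \<open>v \<in> H t\<close> whose compression \<open>v\<^sup>\<star> b v\<close> kills any given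
  finite set of monomials of degree different from \<open>1\<close> and maps a selfadjoint core element \<open>y\<close> to a
  scalar, with \<open>\<parallel>y v\<parallel> \<ge> \<parallel>y\<parallel> / 2\<close>.

  Amenability enters through Kesten's theorem, in the form of almost invariant finitely supported vectors
  in \<open>\<ell>\<^sup>2(G)\<close>. They show that a selfadjoint \<open>b\<close> in the span of the monomials satisfies
  \<open>(3/4 \<parallel>b\<parallel>)\<^sup>n \<le> C \<parallel>\<Phi>(b\<^sup>n)\<parallel>\<close> whenever \<open>n\<close> is a power of \<open>2\<close>, where \<open>\<Phi>\<close> takes the part of degree \<open>1\<close>. Hence
  \<open>\<parallel>\<Phi>(b\<^sup>2\<^sup>j\<^sup>+\<^sup>2)\<parallel> > \<parallel>b\<parallel>\<^sup>2 \<parallel>\<Phi>(b\<^sup>2\<^sup>j)\<parallel> / 4\<close> for some \<open>j\<close>.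

  Given a nonzero positive \<open>a\<close> in a closed ideal, choose such a \<open>b\<close> near \<open>a\<close>, and then \<open>v\<close> for
  \<open>y = \<Phi>(b\<^sup>2\<^sup>j\<^sup>+\<^sup>2)\<close>. The element \<open>v\<^sup>\<star> b\<^sup>j a\<^sup>2 b\<^sup>j v\<close> of the ideal is close to the nonzero scalar
  \<open>v\<^sup>\<star> b\<^sup>2\<^sup>j\<^sup>+\<^sup>2 v\<close>, so the ideal contains \<open>1\<close>.\<close>

section \<open>Almost invariant vectors on amenable groups\<close>

text \<open>The usual tool would be a faithful conditional expectation onto the core. None is
  constructed here: the spans of monomials of different degrees are not shown to be independent, so
  \<open>\<Phi>\<close> is not known to be well defined on \<open>A\<close>, let alone bounded.
  Instead \<open>\<Phi>(b\<^sup>n)\<close> is read off a chosen homogeneous decomposition of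
  \<open>b\<close> by expanding the power into words, and Kesten's estimate replaces faithfulness.

  Why high powers: compressing \<open>b\<^sup>2\<close> alone gives a scalar of the order of
  \<open>\<parallel>\<Phi>(b\<^sup>2)\<parallel>\<close>. A lower bound for it that depends on the
  number of degrees in \<open>b\<close> is useless, since this number may grow as \<open>b\<close>
  approaches \<open>a\<close>, while the error of the approximation is a fixed multiple of
  \<open>\<parallel>b\<parallel>\<^sup>2\<close>. With the outer factors \<open>b\<^sup>j\<close>
  both scalar and error are measured against
  \<open>\<parallel>\<Phi>(b\<^sup>2\<^sup>j)\<parallel>\<close>, and the growth of this sequence is
  exactly what the estimate controls. Even exponents make \<open>\<Phi>(b\<^sup>2\<^sup>j)\<close>
  positive, so that a vector on which it is large also gives a large scalar. The growth factor may
  be any number below \<open>3/4\<close>; \<open>1/2\<close> is taken.\<close>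

context group begin

lemma mean_cong:
  assumes m: "left_invariant_mean G m" and "bounded (f ` carrier G)"
    and eq: "\<And>x. x \<in> carrier G \<Longrightarrow> f x = f' x"
  shows "m f = m f'"
proof -
  have b': "bounded (f' ` carrier G)" using assms(2) eq by (metis (no_types, lifting) image_cong)
  have *: "m f1 \<le> m f2" if b: "bounded (f1 ` carrier G)" "bounded (f2 ` carrier G)" 
    and e: "\<And>x. x \<in> carrier G \<Longrightarrow> f1 x = f2 x" for f1 f2
  proof -
    have b2: "bounded ((\<lambda>x. (-1) * f1 x) ` carrier G)"
      using b(1) unfolding bounded_iff by auto
    have b3: "bounded ((\<lambda>x. f2 x + (-1) * f1 x) ` carrier G)"
      using e by (auto simp: bounded_iff)
    have "0 \<le> m (\<lambda>x. f2 x + (-1) * f1 x)"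
      using m b3 e unfolding left_invariant_mean_def by (simp add: e)
    also have "\<dots> = m f2 + m (\<lambda>x. (-1) * f1 x)"
      using m b(2) b2 unfolding left_invariant_mean_def by blast
    also have "m (\<lambda>x. (-1) * f1 x) = (-1) * m f1"
      using m b(1) unfolding left_invariant_mean_def by blast
    finally show ?thesis by simp
  qed
  show ?thesis using *[OF assms(2) b'] *[OF b' assms(2)] eq by force
qed

lemma mean_sum:
  assumes m: "left_invariant_mean G m" and "finite I"
    and "\<And>i. i \<in> I \<Longrightarrow> bounded (f i ` carrier G)"
  shows "m (\<lambda>x. \<Sum>i\<in>I. f i x) = (\<Sum>i\<in>I. m (f i)) \<and> bounded ((\<lambda>x. \<Sum>i\<in>I. f i x) ` carrier G)"
  using assms(2,3)
proof (induction I)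
  case empty
  have "bounded ((\<lambda>_. 1::real) ` carrier G)" unfolding bounded_iff by auto
  then have "m (\<lambda>x. 0 * 1) = 0 * m (\<lambda>_. 1)"
    using m unfolding left_invariant_mean_def by blast
  then show ?case by (auto simp: bounded_iff)
next
  case (insert i I)
  have b1: "bounded (f i ` carrier G)" and b2: "bounded ((\<lambda>x. \<Sum>i\<in>I. f i x) ` carrier G)"
    using insert by auto
  have "m (\<lambda>x. f i x + (\<Sum>i\<in>I. f i x)) = m (f i) + m (\<lambda>x. \<Sum>i\<in>I. f i x)"
    using m b1 b2 unfolding left_invariant_mean_def by blast
  moreover have "bounded ((\<lambda>x. f i x + (\<Sum>i\<in>I. f i x)) ` carrier G)"
  proof -
    obtain A B where "\<forall>x\<in>carrier G. \<bar>f i x\<bar> \<le> A" "\<forall>x\<in>carrier G. \<bar>\<Sum>i\<in>I. f i x\<bar> \<le> B"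
      using b1 b2 unfolding bounded_iff by auto
    then show ?thesis unfolding bounded_iff
      by (intro exI[of _ "A + B"]) (force intro: abs_triangle_ineq[THEN order_trans] add_mono)
  qed
  ultimately show ?case using insert by simp
qed

lemma mean_le:
  assumes m: "left_invariant_mean G m" and b: "bounded (f ` carrier G)"
    and le: "\<And>x. x \<in> carrier G \<Longrightarrow> f x \<le> c"
  shows "m f \<le> c"
proof -
  have b1: "bounded ((\<lambda>x. (-1) * f x) ` carrier G)"
    using b unfolding bounded_iff by auto
  have bc: "bounded ((\<lambda>x. c * 1) ` carrier G)" and bo: "bounded ((\<lambda>x. 1::real) ` carrier G)"
    unfolding bounded_iff by auto
  have "m (\<lambda>x. c * 1) = c * m (\<lambda>_. 1)"
    using m bo unfolding left_invariant_mean_def by blast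
  moreover have "m (\<lambda>_. 1) = 1" using m unfolding left_invariant_mean_def by blast
  moreover have "m (\<lambda>x. c * 1 + (-1) * f x) = m (\<lambda>x. c * 1) + m (\<lambda>x. (-1) * f x)"
    using m b1 bc unfolding left_invariant_mean_def by blast
  moreover have "m (\<lambda>x. (-1) * f x) = (-1) * m f"
    using m b unfolding left_invariant_mean_def by blast
  moreover have "0 \<le> m (\<lambda>x. c * 1 + (-1) * f x)"
  proof -
    obtain B where "\<forall>x\<in>carrier G. \<bar>f x\<bar> \<le> B" using b unfolding bounded_iff by auto
    then have "bounded ((\<lambda>x. c * 1 + (-1) * f x) ` carrier G)" unfolding bounded_iff
      by (intro exI[of _ "\<bar>c\<bar> + B"]) force
    then show ?thesis using m le unfolding left_invariant_mean_def by force
  qed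
  ultimately show ?thesis by simp
qed

text \<open>If \<open>L\<close> has increments of bounded size, then its mean increment along \<open>f\<close> is odd in \<open>f\<close>,
  so the increments along a symmetric set cannot all be negative on average.\<close>

lemma no_negative_drift:
  assumes am: "amenable G" and F: "finite F" "F \<subseteq> carrier G" "\<And>f. f \<in> F \<Longrightarrow> inv f \<in> F"
    and bd: "\<And>f x. f \<in> F \<Longrightarrow> x \<in> carrier G \<Longrightarrow> \<bar>L (inv f \<otimes> x) - L x\<bar> \<le> (B::real)"
    and drift: "\<And>x. x \<in> carrier G \<Longrightarrow> (\<Sum>f\<in>F. L (inv f \<otimes> x) - L x) \<le> - c"
  shows "c \<le> 0"
proof -
  obtain m where m: "left_invariant_mean G m" using am unfolding amenable_def by blast
  define \<phi> where "\<phi> f x = L (inv f \<otimes> x) - L x" for f x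
  have b: "bounded (\<phi> f ` carrier G)" if "f \<in> F" for f
    unfolding bounded_iff \<phi>_def using bd[OF that] by auto
  have s: "m (\<lambda>x. \<Sum>f\<in>F. \<phi> f x) = (\<Sum>f\<in>F. m (\<phi> f))" "bounded ((\<lambda>x. \<Sum>f\<in>F. \<phi> f x) ` carrier G)"
    using mean_sum[OF m F(1), of \<phi>] b by auto
  \<comment> \<open>\<open>\<phi> (inv f)\<close> is minus the left translate of
    \<open>\<phi> f\<close> by \<open>f\<close>, and the mean is left invariant.\<close>
  have odd: "m (\<phi> (inv f)) = - m (\<phi> f)" if f: "f \<in> F" for f
  proof -
    have fc: "f \<in> carrier G" using F f by auto
    have b': "bounded ((\<lambda>x. \<phi> f (f \<otimes> x)) ` carrier G)"
      unfolding bounded_iff \<phi>_def using bd[OF f] fc by (intro exI[of _ B]) auto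
    have "m (\<lambda>x. (-1) * \<phi> f (f \<otimes> x)) = (-1) * m (\<lambda>x. \<phi> f (f \<otimes> x))"
      using m b' unfolding left_invariant_mean_def by blast
    also have "m (\<lambda>x. \<phi> f (f \<otimes> x)) = m (\<phi> f)"
      using m b[OF f] fc unfolding left_invariant_mean_def by blast
    finally have "m (\<lambda>x. (-1) * \<phi> f (f \<otimes> x)) = - m (\<phi> f)" by simp
    moreover have "m (\<phi> (inv f)) = m (\<lambda>x. (-1) * \<phi> f (f \<otimes> x))"
      by (rule mean_cong[OF m b[OF F(3)[OF f]]])
         (use fc in \<open>simp add: \<phi>_def m_assoc[symmetric]\<close>)
    ultimately show ?thesis by simp
  qed
  have "(\<Sum>f\<in>F. m (\<phi> f)) = (\<Sum>f\<in>F. m (\<phi> (inv f)))"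
    by (rule sum.reindex_bij_witness[of _ "\<lambda>f. inv f" "\<lambda>f. inv f"]) (use F in auto)
  also have "\<dots> = - (\<Sum>f\<in>F. m (\<phi> f))"
    using odd by (simp add: sum_negf)
  finally have "(\<Sum>f\<in>F. m (\<phi> f)) = 0" by simp
  moreover have "m (\<lambda>x. \<Sum>f\<in>F. \<phi> f x) \<le> - c"
    by (rule mean_le[OF m s(2)]) (use drift in \<open>auto simp: \<phi>_def\<close>)
  ultimately show ?thesis using s(1) by simp
qed

text \<open>The drift argument applies to \<open>ln h\<close>: by concavity of the logarithm,
  \<open>s < card F\<close> would push the total increment of \<open>ln h\<close> below a negative
  constant at every point.\<close>

lemma no_strict_superharmonic:
  assumes am: "amenable G" and F: "finite F" "F \<subseteq> carrier G" "\<And>f. f \<in> F \<Longrightarrow> inv f \<in> F" "F \<noteq> {}"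
    and pos: "\<And>x. x \<in> carrier G \<Longrightarrow> (0::real) < h x"
    and sup: "\<And>x. x \<in> carrier G \<Longrightarrow> (\<Sum>f\<in>F. h (inv f \<otimes> x)) \<le> s * h x"
  shows "real (card F) \<le> s"
proof (rule ccontr)
  assume "\<not> real (card F) \<le> s"
  then have sk: "s < real (card F)" by simp
  have step: "h (inv f \<otimes> x) \<le> s * h x" if "f \<in> F" "x \<in> carrier G" for f x
  proof -
    have "h (inv f \<otimes> x) \<le> (\<Sum>f\<in>F. h (inv f \<otimes> x))"
      by (rule member_le_sum) (use F that in \<open>auto intro!: less_imp_le[OF pos]\<close>)
    then show ?thesis using sup[OF that(2)] by linarith
  qed
  obtain f0 where f0: "f0 \<in> F" using F by blast
  then have "f0 \<in> carrier G" using F by auto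
  then have "0 < s * h \<one>" using step[OF f0, of \<one>] pos[of "inv f0 \<otimes> \<one>"] by simp
  then have s0: "0 < s" using pos[of \<one>] by (simp add: zero_less_mult_iff)
  have up: "ln (h (inv f \<otimes> x)) - ln (h x) \<le> ln s" if "f \<in> F" "x \<in> carrier G" for f x
  proof -
    have "ln (h (inv f \<otimes> x)) \<le> ln (s * h x)"
      using step[OF that] pos that F s0 by (subst ln_le_cancel_iff) auto
    then show ?thesis using s0 pos[OF that(2)] by (simp add: ln_mult)
  qed
  define k where "k = real (card F)"
  have "k * ln (k / s) \<le> 0"
  proof (rule no_negative_drift[OF am F(1-3), where L = "\<lambda>x. ln (h x)" and B = "ln s"])
    fix f x assume f: "f \<in> F" and x: "x \<in> carrier G"
    have fc: "f \<in> carrier G" using F f by auto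
    \<comment> \<open>The lower bound for the increment is the upper bound for the reverse step,
      taken at \<open>inv f \<otimes> x\<close>.\<close>
    have "ln (h (inv (inv f) \<otimes> (inv f \<otimes> x))) - ln (h (inv f \<otimes> x)) \<le> ln s"
      using up[OF F(3)[OF f], of "inv f \<otimes> x"] fc x by simp
    then have "ln (h x) - ln (h (inv f \<otimes> x)) \<le> ln s"
      using fc x by (simp add: m_assoc[symmetric])
    then show "\<bar>ln (h (inv f \<otimes> x)) - ln (h x)\<bar> \<le> ln s" using up[OF f x] by linarith
  next
    fix x assume x: "x \<in> carrier G"
    have k0: "0 < k" using F sk unfolding k_def by (simp add: card_gt_0_iff)
    \<comment> \<open>Jensen's inequality in the linearised form \<open>ln u \<le> u - 1\<close>.
      The factor \<open>k / s\<close> scales the ratios so that they add up to at most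
      \<open>k\<close>, which makes the right-hand sides add up to at most \<open>0\<close>.\<close>
    have "ln (h (inv f \<otimes> x)) - ln (h x) + ln (k / s) \<le> k / s * (h (inv f \<otimes> x) / h x) - 1" if "f \<in> F" for f
    proof -
      have p: "0 < h (inv f \<otimes> x)" "0 < h x" using pos x that F by auto
      have "ln (k / s * (h (inv f \<otimes> x) / h x)) = ln (k / s) + (ln (h (inv f \<otimes> x)) - ln (h x))"
        using p s0 k0 by (simp add: ln_mult ln_div)
      then show ?thesis using ln_le_minus_one[of "k / s * (h (inv f \<otimes> x) / h x)"] p s0 k0 by simp
    qed
    then have "(\<Sum>f\<in>F. ln (h (inv f \<otimes> x)) - ln (h x) + ln (k / s)) \<le> (\<Sum>f\<in>F. k / s * (h (inv f \<otimes> x) / h x) - 1)"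
      by (rule sum_mono)
    also have "\<dots> = k / (s * h x) * (\<Sum>f\<in>F. h (inv f \<otimes> x)) - k"
      by (simp add: sum_subtractf k_def sum_distrib_left)
    also have "\<dots> \<le> k / (s * h x) * (s * h x) - k"
      using sup[OF x] k0 s0 pos[OF x] by (intro diff_right_mono mult_left_mono) auto
    also have "\<dots> = 0" using s0 pos[OF x] by simp
    finally show "(\<Sum>f\<in>F. ln (h (inv f \<otimes> x)) - ln (h x)) \<le> - (k * ln (k / s))"
      by (simp add: sum.distrib sum_subtractf k_def)
  qed
  moreover have "0 < k * ln (k / s)"
    using sk s0 unfolding k_def by (intro mult_pos_pos ln_gt_zero) auto
  ultimately show False by simp
qed

text \<open>On the carrier this is the number of words of length \<open>n\<close> over
  \<open>F\<close> with product \<open>x\<close>, that is the \<open>n\<close>-fold convolution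
  power of the indicator function of \<open>F\<close>.\<close>

primrec walks :: "'a set \<Rightarrow> nat \<Rightarrow> 'a \<Rightarrow> real" where
  "walks F 0 x = (if x = \<one> then 1 else 0)"
| "walks F (Suc n) x = (\<Sum>f\<in>F. walks F n (inv f \<otimes> x))"

primrec walk_range :: "'a set \<Rightarrow> nat \<Rightarrow> 'a set" where
  "walk_range F 0 = {\<one>}"
| "walk_range F (Suc n) = (\<lambda>(f, x). f \<otimes> x) ` (F \<times> walk_range F n)"

lemma walks_nonneg: "0 \<le> walks F n x"
  by (induction n arbitrary: x) (auto intro: sum_nonneg)

lemma walk_range_finite: "finite F \<Longrightarrow> finite (walk_range F n)"
  by (induction n) auto

lemma walk_range_carrier: "F \<subseteq> carrier G \<Longrightarrow> walk_range F n \<subseteq> carrier G"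
  by (induction n) auto

lemma walks_outside:
  assumes "F \<subseteq> carrier G"
  shows "x \<in> carrier G \<Longrightarrow> x \<notin> walk_range F n \<Longrightarrow> walks F n x = 0"
proof (induction n arbitrary: x)
  case (Suc n)
  have "walks F n (inv f \<otimes> x) = 0" if f: "f \<in> F" for f
  proof (rule Suc.IH)
    have fc: "f \<in> carrier G" using f assms by auto
    show "inv f \<otimes> x \<in> carrier G" using fc Suc.prems by simp
    show "inv f \<otimes> x \<notin> walk_range F n"
    proof
      assume "inv f \<otimes> x \<in> walk_range F n"
      then have "f \<otimes> (inv f \<otimes> x) \<in> walk_range F (Suc n)" using f by force
      then show False using Suc.prems fc by (simp add: m_assoc[symmetric])
    qed
  qed
  then show ?case by simp
qed auto

text \<open>The squared norm of the \<open>n\<close>-fold convolution power in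
  \<open>\<ell>\<^sup>2(G)\<close>, as a finite sum because \<open>walk_range\<close> contains the
  support.\<close>

definition walk_energy :: "'a set \<Rightarrow> nat \<Rightarrow> real" where
  "walk_energy F n = (\<Sum>x\<in>walk_range F n. (walks F n x)\<^sup>2)"

lemma walks_le_energy:
  assumes "finite F" "F \<subseteq> carrier G" "x \<in> carrier G"
  shows "(walks F n x)\<^sup>2 \<le> walk_energy F n"
proof (cases "x \<in> walk_range F n")
  case True
  then show ?thesis unfolding walk_energy_def
    by (intro member_le_sum[of x _ "\<lambda>x. (walks F n x)\<^sup>2"]) (use assms in \<open>auto simp: walk_range_finite\<close>)
next
  case False
  then show ?thesis using walks_outside[OF assms(2,3)] unfolding walk_energy_def
    by (auto intro: sum_nonneg)
qed

text \<open>Otherwise the walk counts decay fast enough for a Green function, whose translates add up to an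
  everywhere positive strictly superharmonic function.\<close>

lemma walk_energy_ratio:
  assumes am: "amenable G" and cG: "countable (carrier G)"
    and F: "finite F" "F \<subseteq> carrier G" "\<And>f. f \<in> F \<Longrightarrow> inv f \<in> F" "\<one> \<in> F"
    and q: "0 < q" "q < real (card F)"
  shows "\<exists>n. q\<^sup>2 * walk_energy F n < walk_energy F (Suc n)"
proof (rule ccontr)
  assume "\<not> ?thesis"
  then have dec: "walk_energy F (Suc n) \<le> q\<^sup>2 * walk_energy F n" for n by (meson not_le)
  have en: "walk_energy F n \<le> (q ^ n)\<^sup>2" for n
  proof (induction n)
    case (Suc n)
    have "walk_energy F (Suc n) \<le> q\<^sup>2 * walk_energy F n" by (rule dec)
    also have "\<dots> \<le> q\<^sup>2 * (q ^ n)\<^sup>2" using Suc by (intro mult_left_mono) auto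
    finally show ?case by (simp add: power_mult_distrib)
  qed (simp add: walk_energy_def)
  have wq: "walks F n x \<le> q ^ n" if "x \<in> carrier G" for n x
    using walks_le_energy[OF F(1,2) that, of n] en[of n] q
    by (meson order_trans power2_le_imp_le zero_le_power less_imp_le)
  \<comment> \<open>The Green function at \<open>s\<close> converges geometrically because
    \<open>q < s\<close>, and its superharmonicity is strict because
    \<open>s < card F\<close>.\<close>
  obtain s where s: "q < s" "s < real (card F)" using q dense by blast
  have s0: "0 < s" using s q by simp
  define h where "h x = (\<Sum>n. walks F n x / s ^ n)" for x
  have geo: "summable (\<lambda>n. (q / s) ^ n)" using q s by (intro summable_geometric) auto
  have le: "walks F n x / s ^ n \<le> (q / s) ^ n" if "x \<in> carrier G" for n x
    using wq[OF that, of n] s0 by (simp add: power_divide divide_right_mono)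
  have nn: "0 \<le> walks F n x / s ^ n" for x n using walks_nonneg s0 by simp
  have sm: "summable (\<lambda>n. walks F n x / s ^ n)" if "x \<in> carrier G" for x
    by (rule summable_comparison_test'[OF geo, of 0]) (simp only: real_norm_def abs_of_nonneg[OF nn] le[OF that])
  have h0: "0 \<le> h x" if "x \<in> carrier G" for x
    unfolding h_def by (rule suminf_nonneg[OF sm[OF that]]) (rule nn)
  have hB: "h x \<le> (\<Sum>n. (q / s) ^ n)" if "x \<in> carrier G" for x
    unfolding h_def by (rule suminf_le[OF _ sm[OF that] geo]) (rule le[OF that])
  have h1: "0 < h \<one>" unfolding h_def
    by (rule suminf_pos2[OF sm[OF one_closed], of 0]) (use nn in auto)
  \<comment> \<open>One step shifts the index of the series: the sum over \<open>F\<close> is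
    \<open>s\<close> times the series without its term \<open>n = 0\<close>.\<close>
  have hs: "(\<Sum>f\<in>F. h (inv f \<otimes> x)) \<le> s * h x" if x: "x \<in> carrier G" for x
  proof -
    have "(\<Sum>f\<in>F. h (inv f \<otimes> x)) = (\<Sum>n. \<Sum>f\<in>F. walks F n (inv f \<otimes> x) / s ^ n)"
      unfolding h_def by (rule suminf_sum[symmetric]) (use F x in \<open>auto intro!: sm\<close>)
    also have "\<dots> = (\<Sum>n. s * (walks F (Suc n) x / s ^ Suc n))"
      using s0 by (simp add: sum_divide_distrib sum_distrib_left)
    also have "\<dots> = s * (\<Sum>n. walks F (Suc n) x / s ^ Suc n)"
      using sm[OF x] by (intro suminf_mult) (simp add: summable_Suc_iff[where f="\<lambda>n. walks F n x / s ^ n"] del: walks.simps power_Suc)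
    also have "(\<Sum>n. walks F (Suc n) x / s ^ Suc n) \<le> h x"
      unfolding h_def using suminf_split_head[OF sm[OF x]] nn[of 0 x] by linarith
    finally show ?thesis using s0 by simp
  qed
  define g where "g = from_nat_into (carrier G)"
  have gne: "carrier G \<noteq> {}" by auto
  have gc: "g j \<in> carrier G" for j unfolding g_def using from_nat_into[OF gne] .
  have gsurj: "\<exists>j. g j = x" if "x \<in> carrier G" for x
    unfolding g_def using from_nat_into_surj[OF cG that] by blast
  \<comment> \<open>\<open>h\<close> can vanish off the subgroup generated by \<open>F\<close>. Its
    right translates satisfy the same inequality, since the steps multiply on the left; summed over
    an enumeration of the group with weights \<open>(1/2) ^ j\<close> they are positive
    everywhere.\<close>
  define H where "H x = (\<Sum>j. (1/2) ^ j * h (x \<otimes> inv (g j)))" for x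
  define B where "B = (\<Sum>n. (q / s) ^ n)"
  have smH: "summable (\<lambda>j. (1/2) ^ j * h (x \<otimes> inv (g j)))" if "x \<in> carrier G" for x
    by (rule summable_comparison_test'[of "\<lambda>j. (1/2) ^ j * B" 0])
       (use h0 hB gc that in \<open>auto intro!: summable_mult2 summable_geometric simp: B_def abs_mult abs_of_nonneg\<close>)
  have "real (card F) \<le> s"
  proof (rule no_strict_superharmonic[OF am F(1-3), of H])
    show "F \<noteq> {}" using F by auto
  next
    fix x assume x: "x \<in> carrier G"
    obtain j where "g j = x" using gsurj[OF x] by blast
    then show "0 < H x" unfolding H_def
      by (intro suminf_pos2[OF smH[OF x], of j]) (use h0 h1 gc x in auto)
    have "(\<Sum>f\<in>F. H (inv f \<otimes> x)) = (\<Sum>j. \<Sum>f\<in>F. (1/2) ^ j * h (inv f \<otimes> x \<otimes> inv (g j)))"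
      unfolding H_def by (rule suminf_sum[symmetric]) (use F x in \<open>auto intro!: smH\<close>)
    also have "\<dots> \<le> (\<Sum>j. s * ((1/2) ^ j * h (x \<otimes> inv (g j))))"
    proof (rule suminf_le)
      fix j
      have "(\<Sum>f\<in>F. (1/2) ^ j * h (inv f \<otimes> x \<otimes> inv (g j))) = (1/2) ^ j * (\<Sum>f\<in>F. h (inv f \<otimes> (x \<otimes> inv (g j))))"
        using F x gc by (auto simp: sum_distrib_left m_assoc subset_iff intro!: sum.cong)
      also have "\<dots> \<le> (1/2) ^ j * (s * h (x \<otimes> inv (g j)))"
        using hs[of "x \<otimes> inv (g j)"] x gc by (intro mult_left_mono) auto
      finally show "(\<Sum>f\<in>F. (1/2) ^ j * h (inv f \<otimes> x \<otimes> inv (g j))) \<le> s * ((1/2) ^ j * h (x \<otimes> inv (g j)))"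
        by (simp add: mult_ac)
    next
      show "summable (\<lambda>j. \<Sum>f\<in>F. (1/2) ^ j * h (inv f \<otimes> x \<otimes> inv (g j)))"
        by (rule summable_sum) (use F x in \<open>auto intro!: smH\<close>)
      show "summable (\<lambda>j. s * ((1/2) ^ j * h (x \<otimes> inv (g j))))"
        by (rule summable_mult[OF smH[OF x]])
    qed
    also have "\<dots> = s * H x" unfolding H_def by (rule suminf_mult[OF smH[OF x]])
    finally show "(\<Sum>f\<in>F. H (inv f \<otimes> x)) \<le> s * H x" .
  qed
  then show False using s by simp
qed

text \<open>The almost invariant vector is a normalised walk count: as the energy grows by nearly the
  maximal factor, each of the \<open>card F\<close> squared inner products is nearly maximal.\<close>

lemma almost_invariant_vector:
  assumes am: "amenable G" and cG: "countable (carrier G)"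
    and F: "finite F" "F \<subseteq> carrier G" "\<And>f. f \<in> F \<Longrightarrow> inv f \<in> F" "\<one> \<in> F" and e: "0 < e"
  shows "\<exists>X \<xi>. finite X \<and> X \<subseteq> carrier G \<and> (\<forall>x\<in>carrier G - X. \<xi> x = 0) \<and>
    (\<Sum>x\<in>X. (\<xi> x)\<^sup>2) = (1::real) \<and> (\<forall>f\<in>F. \<bar>(\<Sum>x\<in>X. \<xi> x * \<xi> (f \<otimes> x)) - 1\<bar> \<le> e)"
proof -
  define k where "k = real (card F)"
  have k1: "1 \<le> k" using F unfolding k_def by (metis card_0_eq empty_iff of_nat_1 of_nat_le_iff One_nat_def Suc_leI gr0I)
  \<comment> \<open>The energy of step \<open>n + 1\<close> is a sum of \<open>k\<^sup>2\<close>
    inner products, each at most \<open>a\<close>. If the sum misses its maximum by the proportion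
    \<open>\<delta>\<close>, a single term misses \<open>a\<close> by at most
    \<open>k\<^sup>2 * \<delta> * a\<close>, which should be at most \<open>e * a\<close>. The
    cutoff \<open>1/2\<close> keeps \<open>q\<close> positive.\<close>
  define \<delta> where "\<delta> = min (e / k\<^sup>2) (1/2)"
  have \<delta>: "0 < \<delta>" "\<delta> < 1" "k\<^sup>2 * \<delta> \<le> e" using e k1 unfolding \<delta>_def
    by (auto simp: min_def field_simps)
  define q where "q = k * sqrt (1 - \<delta>)"
  have q: "0 < q" "q < k" "q\<^sup>2 = k\<^sup>2 * (1 - \<delta>)" using \<delta> k1 unfolding q_def
    by (auto simp: power_mult_distrib mult_less_cancel_left2)
  obtain n where n: "q\<^sup>2 * walk_energy F n < walk_energy F (Suc n)"
    using walk_energy_ratio[OF am cG F q(1)] q(2) unfolding k_def by blast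
  define w where "w = walks F n"
  define X where "X = walk_range F n"
  define Y where "Y = walk_range F (Suc n)"
  define a where "a = walk_energy F n"
  have fin: "finite X" "finite Y" "X \<subseteq> carrier G" "Y \<subseteq> carrier G"
    unfolding X_def Y_def using F walk_range_finite walk_range_carrier by (auto simp del: walk_range.simps)
  have wX: "w x = 0" if "x \<in> carrier G" "x \<notin> X" for x using walks_outside[OF F(2) that[unfolded X_def]] unfolding w_def .
  have aX: "a = (\<Sum>x\<in>X. (w x)\<^sup>2)" unfolding a_def walk_energy_def w_def X_def ..
  have shift: "(\<Sum>y\<in>Y. u (inv f \<otimes> y)) = (\<Sum>x\<in>X. u x)" 
    if f: "f \<in> F" and u: "\<And>x. x \<in> carrier G \<Longrightarrow> x \<notin> X \<Longrightarrow> u x = (0::real)" for f u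
  proof -
    have fc: "f \<in> carrier G" using f F by auto
    have sub: "(\<lambda>x. f \<otimes> x) ` X \<subseteq> Y" unfolding X_def Y_def using f by auto
    have "(\<Sum>y\<in>Y. u (inv f \<otimes> y)) = (\<Sum>y\<in>(\<lambda>x. f \<otimes> x) ` X. u (inv f \<otimes> y))"
    proof (rule sum.mono_neutral_right[OF fin(2) sub], intro ballI u)
      fix y assume y: "y \<in> Y - (\<lambda>x. f \<otimes> x) ` X"
      then show yc: "inv f \<otimes> y \<in> carrier G" using fin fc by auto
      have "y = f \<otimes> (inv f \<otimes> y)" using y fin fc by (auto simp: m_assoc[symmetric])
      then show "inv f \<otimes> y \<notin> X" using y by blast
    qed
    also have "\<dots> = (\<Sum>x\<in>X. u (inv f \<otimes> (f \<otimes> x)))"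
      using fc fin by (subst sum.reindex) (auto intro!: inj_onI simp: subset_iff)
    also have "\<dots> = (\<Sum>x\<in>X. u x)"
      using fc fin by (intro sum.cong) (auto simp: m_assoc[symmetric] subset_iff)
    finally show ?thesis .
  qed
  have sq: "(\<Sum>y\<in>Y. (w (inv f \<otimes> y))\<^sup>2) = a" if "f \<in> F" for f
    using shift[OF that, of "\<lambda>x. (w x)\<^sup>2"] wX aX by simp
  define ip where "ip f g = (\<Sum>y\<in>Y. w (inv f \<otimes> y) * w (inv g \<otimes> y))" for f g
  have ip_le: "ip f g \<le> a" if "f \<in> F" "g \<in> F" for f g
  proof -
    have "2 * (x * y) \<le> x\<^sup>2 + y\<^sup>2" for x y :: real using sum_squares_bound[of x y] by simp
    then have "2 * ip f g \<le> (\<Sum>y\<in>Y. (w (inv f \<otimes> y))\<^sup>2 + (w (inv g \<otimes> y))\<^sup>2)"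
      unfolding ip_def sum_distrib_left by (intro sum_mono)
    then show ?thesis using sq[OF that(1)] sq[OF that(2)] by (simp add: sum.distrib)
  qed
  have tot: "walk_energy F (Suc n) = (\<Sum>(f,g)\<in>F \<times> F. ip f g)"
  proof -
    have "walk_energy F (Suc n) = (\<Sum>y\<in>Y. \<Sum>f\<in>F. \<Sum>g\<in>F. w (inv f \<otimes> y) * w (inv g \<otimes> y))"
      unfolding walk_energy_def Y_def[symmetric] by (simp add: w_def power2_eq_square sum_product)
    also have "\<dots> = (\<Sum>f\<in>F. \<Sum>g\<in>F. ip f g)"
      unfolding ip_def by (subst sum.swap, rule sum.cong[OF refl], rule sum.swap)
    finally show ?thesis by (simp add: sum.cartesian_product)
  qed
  \<comment> \<open>As \<open>\<one> \<in> F\<close>, staying put is an admissible step. This makes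
    the energy positive, so that the walk count can be normalised.\<close>
  have w1: "1 \<le> walks F n \<one>" for n
  proof (induction n)
    case (Suc n)
    have "walks F n (inv \<one> \<otimes> \<one>) \<le> walks F (Suc n) \<one>" unfolding walks.simps
      by (rule member_le_sum[OF F(4)]) (auto simp: walks_nonneg F)
    then show ?case using Suc by simp
  qed simp
  have a0: "0 < a" using walks_le_energy[OF F(1,2), of \<one> n] w1[of n] unfolding a_def
    by (smt (verit, ccfv_SIG) one_closed one_le_power)
  have ip_ge: "(1 - e) * a \<le> ip f \<one>" if f: "f \<in> F" for f
  proof -
    have fin2: "finite (F \<times> F)" and mem: "(f, \<one>) \<in> F \<times> F" using F f by auto
    have "walk_energy F (Suc n) = ip f \<one> + (\<Sum>(f,g)\<in>F \<times> F - {(f,\<one>)}. ip f g)"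
      unfolding tot using sum.remove[OF fin2 mem, of "\<lambda>(f,g). ip f g"] by simp
    also have "(\<Sum>(f,g)\<in>F \<times> F - {(f,\<one>)}. ip f g) \<le> (\<Sum>(f,g)\<in>F \<times> F - {(f,\<one>)}. a)"
      by (rule sum_mono) (use ip_le in auto)
    also have "\<dots> = (k\<^sup>2 - 1) * a"
      using mem fin2 F k1 by (simp add: card_Diff_singleton card_cartesian_product k_def power2_eq_square
        of_nat_diff mult_le_cancel2 Suc_le_eq card_gt_0_iff)
    finally have "k\<^sup>2 * (1 - \<delta>) * a < ip f \<one> + (k\<^sup>2 - 1) * a" using n q unfolding a_def by simp
    then have "(1 - k\<^sup>2 * \<delta>) * a < ip f \<one>" by (simp add: algebra_simps)
    moreover have "(1 - e) * a \<le> (1 - k\<^sup>2 * \<delta>) * a" using \<delta>(3) a0 by (intro mult_right_mono) auto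
    ultimately show ?thesis by simp
  qed
  define \<xi> where "\<xi> x = w x / sqrt a" for x
  have ipX: "ip (inv f) \<one> = (\<Sum>x\<in>X. w x * w (f \<otimes> x))" if f: "f \<in> F" for f
  proof -
    have fc: "f \<in> carrier G" using f F by auto
    have "ip (inv f) \<one> = (\<Sum>y\<in>Y. w y * w (f \<otimes> y))"
      unfolding ip_def using fin fc by (intro sum.cong) (auto simp: mult.commute)
    also have "\<dots> = (\<Sum>y\<in>Y. (\<lambda>x. w x * w (f \<otimes> x)) (inv \<one> \<otimes> y))"
      using fin by (intro sum.cong) auto
    also have "\<dots> = (\<Sum>x\<in>X. w x * w (f \<otimes> x))"
      by (rule shift[OF F(4)]) (use wX in auto)
    finally show ?thesis .
  qed
  show ?thesis
  proof (intro exI[of _ X] exI[of _ \<xi>] conjI ballI fin(1,3))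
    show "\<xi> x = 0" if "x \<in> carrier G - X" for x using wX that unfolding \<xi>_def by auto
    show "(\<Sum>x\<in>X. (\<xi> x)\<^sup>2) = 1"
      unfolding \<xi>_def power_divide using a0 aX by (simp flip: sum_divide_distrib)
    fix f assume f: "f \<in> F"
    have "(\<Sum>x\<in>X. \<xi> x * \<xi> (f \<otimes> x)) = ip (inv f) \<one> / a"
      unfolding \<xi>_def ipX[OF f] using a0 by (simp flip: sum_divide_distrib)
    moreover
    have "(1 - e) * a \<le> ip (inv f) \<one>" "ip (inv f) \<one> \<le> a"
      using ip_ge ip_le F f by auto
    then have "1 - e \<le> ip (inv f) \<one> / a" "ip (inv f) \<one> / a \<le> 1"
      using a0 by (auto simp: pos_le_divide_eq)
    ultimately show "\<bar>(\<Sum>x\<in>X. \<xi> x * \<xi> (f \<otimes> x)) - 1\<bar> \<le> e"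
      using e by linarith
  qed
qed

end

section \<open>Unital C*-algebras\<close>

text \<open>A constant factor disappears on taking roots of order \<open>2 ^ k\<close>. Exponents of
  this form are those for which the C*-identity, applied repeatedly, gives the norm of a power of a
  self-adjoint element.\<close>

lemma le_of_power_bound:
  fixes x r C :: real
  assumes "0 \<le> x" "0 \<le> r" and le: "\<And>k. x ^ 2 ^ k \<le> C * r ^ 2 ^ k"
  shows "x \<le> r"
proof (rule ccontr)
  assume "\<not> x \<le> r"
  then have xr: "r < x" by simp
  show False
  proof (cases "r = 0")
    case True
    then show False using le[of 0] xr by simp
  next
    case False
    then have r: "0 < r" using assms by simp
    obtain n where n: "C < (x / r) ^ n" using real_arch_pow[of "x / r" C] xr r by auto
    have "(x / r) ^ n \<le> (x / r) ^ 2 ^ n"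
      using xr r by (intro power_increasing) (auto intro: less_imp_le)
    also have "\<dots> \<le> C" using le[of n] r by (simp add: power_divide divide_le_eq)
    finally show False using n by simp
  qed
qed

text \<open>The missing factor \<open>r\<close> goes into the constant if
  \<open>r \<noteq> 0\<close>. The case \<open>r = 0\<close> is settled by \<open>k = 1\<close>,
  because \<open>k = 0\<close> only says \<open>x \<le> C\<close>.\<close>

lemma le_of_power_bound':
  fixes x r C :: real
  assumes "0 \<le> x" "0 \<le> r" and le: "\<And>k. x ^ 2 ^ k \<le> C * r ^ (2 ^ k - 1)"
  shows "x \<le> r"
proof (cases "r = 0")
  case True
  then show ?thesis using le[of 1] by simp
next
  case False
  have "x ^ 2 ^ k \<le> (C / r) * r ^ 2 ^ k" for k
    using le[of k] False by (simp add: power_diff)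
  then show ?thesis by (rule le_of_power_bound[OF assms(1,2)])
qed

text \<open>In \<^locale>\<open>unital_cstar_algebra\<close> the names of the ring facts of \<open>A\<close> are hidden by those of the
  scalar ring; this locale makes them accessible.\<close>

locale unital_cstar = ring A for A :: "'a cstar" (structure) +
  assumes cstar: "unital_cstar_algebra A"
begin

abbreviation star ("_\<star>" [1000] 1000) where "x\<star> \<equiv> adj A x"
abbreviation nrm ("\<parallel>_\<parallel>") where "\<parallel>x\<parallel> \<equiv> cnorm A x"

lemma module: "Module.module complex_ring A"
  using cstar by (simp add: unital_cstar_algebra_def)

lemma scalar_carrier [simp]: "c \<in> carrier complex_ring"
  and scalar_zero: "\<zero>\<^bsub>complex_ring\<^esub> = 0"
  and scalar_one: "\<one>\<^bsub>complex_ring\<^esub> = 1"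
  and scalar_add: "c \<oplus>\<^bsub>complex_ring\<^esub> d = c + d"
  and scalar_mult: "c \<otimes>\<^bsub>complex_ring\<^esub> d = c * d"
  by (simp_all add: complex_ring_def)

lemmas smult_mult_left [simp] = unital_cstar_algebra.smult_mult_left[OF cstar]
  and smult_mult_right [simp] = unital_cstar_algebra.smult_mult_right[OF cstar]
  and adj_closed [simp, intro] = unital_cstar_algebra.adj_closed[OF cstar]
  and adj_adj [simp] = unital_cstar_algebra.adj_adj[OF cstar]
  and adj_add = unital_cstar_algebra.adj_add[OF cstar]
  and adj_smult = unital_cstar_algebra.adj_smult[OF cstar]
  and adj_mult = unital_cstar_algebra.adj_mult[OF cstar]
  and cnorm_nonneg = unital_cstar_algebra.cnorm_nonneg[OF cstar]
  and cnorm_eq_0 = unital_cstar_algebra.cnorm_eq_0[OF cstar]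
  and cnorm_triangle = unital_cstar_algebra.cnorm_triangle[OF cstar]
  and cnorm_smult = unital_cstar_algebra.cnorm_smult[OF cstar]
  and cnorm_mult = unital_cstar_algebra.cnorm_mult[OF cstar]
  and cstar_identity = unital_cstar_algebra.cstar_identity[OF cstar]

lemma smult_zero_left [simp]: "x \<in> carrier A \<Longrightarrow> 0 \<odot> x = \<zero>"
  using module.smult_l_null[OF module] by (simp add: scalar_zero)

lemma smult_zero_right [simp]: "c \<odot> \<zero> = \<zero>"
  using module.smult_r_null[OF module] by simp

lemma smult_1 [simp]: "x \<in> carrier A \<Longrightarrow> 1 \<odot> x = x"
  using module.smult_one[OF module] by (simp add: scalar_one)

lemma smult_in [simp, intro]: "x \<in> carrier A \<Longrightarrow> c \<odot> x \<in> carrier A"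
  using module.smult_closed[OF module] by simp

lemma smult_add_left: "x \<in> carrier A \<Longrightarrow> (c + d) \<odot> x = c \<odot> x \<oplus> d \<odot> x"
  using module.smult_l_distr[OF module, of c d x] by (simp add: scalar_add)

lemma smult_add_right: "x \<in> carrier A \<Longrightarrow> y \<in> carrier A \<Longrightarrow> c \<odot> (x \<oplus> y) = c \<odot> x \<oplus> c \<odot> y"
  using module.smult_r_distr[OF module] by simp

lemma smult_smult [simp]: "x \<in> carrier A \<Longrightarrow> c \<odot> (d \<odot> x) = (c * d) \<odot> x"
  using module.smult_assoc1[OF module, of c d x] by (simp add: scalar_mult)

lemma smult_minus_one: "x \<in> carrier A \<Longrightarrow> (- 1) \<odot> x = \<ominus> x"
proof -
  assume x: "x \<in> carrier A"
  have "(- 1) \<odot> x \<oplus> x = \<zero>" using smult_add_left[OF x, of "-1" 1] x by simp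
  then show ?thesis using minus_equality[of "(- 1) \<odot> x" x] x by simp
qed

lemma smult_neg: "x \<in> carrier A \<Longrightarrow> (- c) \<odot> x = \<ominus> (c \<odot> x)"
  using smult_smult[of x "-1" c] smult_minus_one[of "c \<odot> x"] by simp

lemma smult_minus_right: "x \<in> carrier A \<Longrightarrow> c \<odot> (\<ominus> x) = \<ominus> (c \<odot> x)"
  using smult_smult[of x c "-1"] by (simp add: smult_minus_one smult_neg)

lemma smult_diff_right: "x \<in> carrier A \<Longrightarrow> y \<in> carrier A \<Longrightarrow> c \<odot> (x \<ominus> y) = c \<odot> x \<ominus> c \<odot> y"
  by (simp add: minus_eq smult_add_right smult_minus_right)

lemma smult_cancel:
  assumes "c \<noteq> 0" "x \<in> carrier A" "y \<in> carrier A" "c \<odot> x = c \<odot> y"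
  shows "x = y"
  by (metis assms smult_1 smult_smult left_inverse)

lemma adj_zero [simp]: "\<zero>\<star> = \<zero>"
  using adj_smult[of \<zero> 0] by simp

lemma adj_one [simp]: "\<one>\<star> = \<one>"
proof -
  have "(\<one>\<star> \<otimes> \<one>)\<star> = \<one>\<star> \<otimes> \<one>\<star>\<star>" by (subst adj_mult) auto
  then show ?thesis by simp
qed

lemma adj_uminus: "x \<in> carrier A \<Longrightarrow> (\<ominus> x)\<star> = \<ominus> (x\<star>)"
  using adj_smult[of x "-1"] by (simp add: smult_minus_one)

lemma adj_diff: "x \<in> carrier A \<Longrightarrow> y \<in> carrier A \<Longrightarrow> (x \<ominus> y)\<star> = x\<star> \<ominus> y\<star>"
  by (simp add: minus_eq adj_add adj_uminus)

lemma adj_finsum: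
  assumes "finite X" "f \<in> X \<rightarrow> carrier A"
  shows "(finsum A f X)\<star> = (\<Oplus>x\<in>X. (f x)\<star>)"
  using assms by (induction X) (auto simp: adj_add finsum_insert Pi_def)

lemma smult_finsum:
  assumes "finite X" "f \<in> X \<rightarrow> carrier A"
  shows "c \<odot> finsum A f X = (\<Oplus>x\<in>X. c \<odot> f x)"
  using assms by (induction X) (auto simp: smult_add_right finsum_insert Pi_def)

lemma cnorm_zero [simp]: "\<parallel>\<zero>\<parallel> = 0"
  using cnorm_eq_0[of \<zero>] by simp

lemma cnorm_minus [simp]: "x \<in> carrier A \<Longrightarrow> \<parallel>\<ominus> x\<parallel> = \<parallel>x\<parallel>"
  using cnorm_smult[of x "-1"] by (simp add: smult_minus_one)

lemma cnorm_diff_commute: "x \<in> carrier A \<Longrightarrow> y \<in> carrier A \<Longrightarrow> \<parallel>x \<ominus> y\<parallel> = \<parallel>y \<ominus> x\<parallel>"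
proof -
  assume xy: "x \<in> carrier A" "y \<in> carrier A"
  have "y \<ominus> x = \<ominus> (x \<ominus> y)" using xy by algebra
  then show ?thesis using xy by simp
qed

lemma cnorm_diff_le: "x \<in> carrier A \<Longrightarrow> y \<in> carrier A \<Longrightarrow> \<parallel>x \<ominus> y\<parallel> \<le> \<parallel>x\<parallel> + \<parallel>y\<parallel>"
  using cnorm_triangle[of x "\<ominus> y"] by (simp add: minus_eq)

lemma cnorm_diff_triangle:
  assumes "x \<in> carrier A" "y \<in> carrier A" "z \<in> carrier A"
  shows "\<parallel>x \<ominus> z\<parallel> \<le> \<parallel>x \<ominus> y\<parallel> + \<parallel>y \<ominus> z\<parallel>"
proof -
  have "x \<ominus> z = (x \<ominus> y) \<oplus> (y \<ominus> z)" using assms by algebra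
  then show ?thesis using cnorm_triangle[of "x \<ominus> y" "y \<ominus> z"] assms by simp
qed

lemma cnorm_le_diff_add:
  assumes "x \<in> carrier A" "y \<in> carrier A"
  shows "\<parallel>x\<parallel> \<le> \<parallel>x \<ominus> y\<parallel> + \<parallel>y\<parallel>"
  using cnorm_diff_triangle[of x y \<zero>] assms by (simp add: minus_eq)

lemma cnorm_adj [simp]: assumes "x \<in> carrier A" shows "\<parallel>x\<star>\<parallel> = \<parallel>x\<parallel>"
proof -
  have *: "\<parallel>y\<parallel> \<le> \<parallel>y\<star>\<parallel>" if y: "y \<in> carrier A" for y
  proof (cases "\<parallel>y\<parallel> = 0")
    case True
    then show ?thesis using cnorm_nonneg[of "y\<star>"] y by simp
  next
    case False
    have "\<parallel>y\<parallel>\<^sup>2 \<le> \<parallel>y\<star>\<parallel> * \<parallel>y\<parallel>"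
      using cstar_identity[OF y] cnorm_mult[of "y\<star>" y] y by simp
    then show ?thesis using False cnorm_nonneg[OF y] by (simp add: power2_eq_square)
  qed
  show ?thesis using *[of x] *[of "x\<star>"] assms by simp
qed

lemma cnorm_finsum_le:
  assumes "finite X" "f \<in> X \<rightarrow> carrier A"
  shows "\<parallel>finsum A f X\<parallel> \<le> (\<Sum>x\<in>X. \<parallel>f x\<parallel>)"
  using assms
proof (induction X)
  case (insert x X)
  then have "\<parallel>finsum A f (insert x X)\<parallel> \<le> \<parallel>f x\<parallel> + \<parallel>finsum A f X\<parallel>"
    by (simp add: finsum_insert cnorm_triangle Pi_def finsum_closed)
  then show ?case using insert by (simp add: Pi_def)
qed simp

lemma cnorm_one_cases: "\<parallel>\<one>\<parallel> = 0 \<or> \<parallel>\<one>\<parallel> = 1"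
  using cstar_identity[of \<one>] by (simp add: power2_eq_square)

lemma cnorm_one_le: "\<parallel>\<one>\<parallel> \<le> 1"
  using cnorm_one_cases by auto

lemma cnorm_mult_le:
  assumes "x \<in> carrier A" "y \<in> carrier A" "\<parallel>x\<parallel> \<le> a" "\<parallel>y\<parallel> \<le> b"
  shows "\<parallel>x \<otimes> y\<parallel> \<le> a * b"
proof -
  have "\<parallel>x\<parallel> * \<parallel>y\<parallel> \<le> a * b"
    using assms cnorm_nonneg[of x] cnorm_nonneg[of y] by (intro mult_mono) auto
  then show ?thesis using cnorm_mult[of x y] assms by linarith
qed

lemma isometry_cnorm_le: 
  assumes "v \<in> carrier A" "v\<star> \<otimes> v = \<one>" shows "\<parallel>v\<parallel> \<le> 1"
  using cstar_identity[OF assms(1)] cnorm_one_le assms(2) cnorm_nonneg[OF assms(1)]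
  by (metis abs_le_square_iff abs_of_nonneg abs_one one_power2)

lemma isometry_mult_left:
  assumes "v \<in> carrier A" "v\<star> \<otimes> v = \<one>" "x \<in> carrier A" 
  shows "(v \<otimes> x)\<star> \<otimes> (v \<otimes> x) = x\<star> \<otimes> x"
proof -
  have "(v \<otimes> x)\<star> \<otimes> (v \<otimes> x) = x\<star> \<otimes> (v\<star> \<otimes> v) \<otimes> x"
    using assms(1,3) by (simp add: adj_mult m_assoc)
  then show ?thesis using assms by simp
qed

lemma isometry_compress_le:
  assumes "v \<in> carrier A" "v\<star> \<otimes> v = \<one>" "x \<in> carrier A"
  shows "\<parallel>v\<star> \<otimes> x \<otimes> v\<parallel> \<le> \<parallel>x\<parallel>"
proof -
  have v: "\<parallel>v\<parallel> \<le> 1" using isometry_cnorm_le[OF assms(1,2)] .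
  have "\<parallel>v\<star> \<otimes> x\<parallel> \<le> 1 * \<parallel>x\<parallel>" by (rule cnorm_mult_le) (use assms v in auto)
  then have "\<parallel>v\<star> \<otimes> x \<otimes> v\<parallel> \<le> \<parallel>x\<parallel> * 1" by (intro cnorm_mult_le) (use assms v in auto)
  then show ?thesis by simp
qed

lemma power_Suc2: "h \<in> carrier A \<Longrightarrow> h [^] Suc n = h \<otimes> h [^] n"
  by (rule nat_pow_Suc2)

lemma power_selfadj: "h \<in> carrier A \<Longrightarrow> h\<star> = h \<Longrightarrow> (h [^] (n::nat))\<star> = h [^] n"
  by (induction n) (simp_all add: adj_mult power_Suc2[symmetric])

lemma cnorm_sq_selfadj:
  assumes "h \<in> carrier A" "h\<star> = h" shows "\<parallel>h \<otimes> h\<parallel> = \<parallel>h\<parallel>\<^sup>2"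
  using cstar_identity[OF assms(1)] assms by simp

lemma cnorm_power_selfadj:
  assumes "h \<in> carrier A" "h\<star> = h" shows "\<parallel>h [^] (2 ^ k :: nat)\<parallel> = \<parallel>h\<parallel> ^ 2 ^ k"
proof (induction k)
  case (Suc k)
  have "h [^] (2 ^ Suc k :: nat) = h [^] (2 ^ k :: nat) \<otimes> h [^] (2 ^ k :: nat)"
    using assms by (simp add: nat_pow_mult mult_2)
  then have "\<parallel>h [^] (2 ^ Suc k :: nat)\<parallel> = \<parallel>h [^] (2 ^ k :: nat)\<parallel>\<^sup>2"
    using assms by (simp add: cnorm_sq_selfadj power_selfadj)
  then show ?case using Suc by (simp add: power_mult[symmetric] mult.commute)
qed (use assms in simp)

section \<open>The norm topology and closed ideals\<close>

interpretation MS: Metric_space "carrier A" "norm_dist A (cnorm A)"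
proof
  fix x y z
  show "0 \<le> norm_dist A (cnorm A) x y" by (simp add: norm_dist_def cnorm_nonneg)
  show "norm_dist A (cnorm A) x y = norm_dist A (cnorm A) y x" 
    by (simp add: norm_dist_def cnorm_diff_commute)
  show "norm_dist A (cnorm A) x y = 0 \<longleftrightarrow> x = y" if "x \<in> carrier A" "y \<in> carrier A"
    using that by (simp add: norm_dist_def cnorm_eq_0 r_right_minus_eq)
  show "norm_dist A (cnorm A) x z \<le> norm_dist A (cnorm A) x y + norm_dist A (cnorm A) y z" 
    if "x \<in> carrier A" "y \<in> carrier A" "z \<in> carrier A"
    using that by (simp add: norm_dist_def cnorm_diff_triangle)
qed

lemma closedin_norm_topology_iff:
  "closedin (norm_topology A (cnorm A)) S \<longleftrightarrow>
     S \<subseteq> carrier A \<and> (\<forall>x\<in>carrier A. (\<forall>e>0. \<exists>y\<in>S. \<parallel>x \<ominus> y\<parallel> < e) \<longrightarrow> x \<in> S)"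
  unfolding norm_topology_def MS.closedin_metric
  by (auto simp: disjnt_iff MS.in_mball norm_dist_def subset_iff) (metis not_le)+

definition norm_closure :: "'a set \<Rightarrow> 'a set" where
  "norm_closure S = {x \<in> carrier A. \<forall>e>0. \<exists>y\<in>S. \<parallel>x \<ominus> y\<parallel> < e}"

lemma norm_closure_superset: "S \<subseteq> carrier A \<Longrightarrow> S \<subseteq> norm_closure S"
  unfolding norm_closure_def by (auto simp: r_right_minus_eq intro!: bexI) (metis cnorm_zero minus_eq r_neg subsetD)

lemma closedin_norm_closure:
  assumes "S \<subseteq> carrier A" shows "closedin (norm_topology A (cnorm A)) (norm_closure S)"
  unfolding closedin_norm_topology_iff
proof (intro conjI ballI impI)
  show "norm_closure S \<subseteq> carrier A" unfolding norm_closure_def by auto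
  fix x assume x: "x \<in> carrier A" and ap: "\<forall>e>0. \<exists>y\<in>norm_closure S. \<parallel>x \<ominus> y\<parallel> < e"
  show "x \<in> norm_closure S" unfolding norm_closure_def
  proof (clarify, intro conjI allI impI x)
    fix e :: real assume e: "0 < e"
    obtain y where y: "y \<in> norm_closure S" "\<parallel>x \<ominus> y\<parallel> < e / 2" using ap e by (meson half_gt_zero)
    obtain z where z: "z \<in> S" "\<parallel>y \<ominus> z\<parallel> < e / 2" using y e unfolding norm_closure_def by (auto dest: spec[of _ "e/2"])
    have "\<parallel>x \<ominus> z\<parallel> < e" using cnorm_diff_triangle[of x y z] x y z assms unfolding norm_closure_def by force
    then show "\<exists>y\<in>S. \<parallel>x \<ominus> y\<parallel> < e" using z by blast
  qed
qed

text \<open>An ideal element closer to \<open>\<lambda> 1\<close> than \<open>|\<lambda>|\<close> has the form \<open>\<lambda>(1 - q)\<close> with \<open>\<parallel>q\<parallel> < 1\<close>, and the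
  elements \<open>(1 - q)(1 + q + \<dots> + q\<^sup>n) = 1 - q\<^sup>n\<^sup>+\<^sup>1\<close> of the ideal tend to \<open>1\<close>.\<close>

lemma closed_ideal_near_scalar:
  assumes I: "ideal I A" and cl: "closedin (norm_topology A (cnorm A)) I"
    and z: "z \<in> I" and lt: "\<parallel>z \<ominus> c \<odot> \<one>\<parallel> < cmod c"
  shows "I = carrier A"
proof -
  interpret I: ideal I A by (rule I)
  have zc: "z \<in> carrier A" using z I.a_subset by auto
  have c: "c \<noteq> 0" using lt cnorm_nonneg[of "z \<ominus> c \<odot> \<one>"] zc by auto
  define w where "w = inverse c \<odot> z"
  define q where "q = \<one> \<ominus> w"
  have wc: "w \<in> carrier A" and qc: "q \<in> carrier A" unfolding w_def q_def using zc by auto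
  have wI: "w \<in> I"
    using I.I_r_closed[OF z, of "inverse c \<odot> \<one>"] zc unfolding w_def by simp
  have "q = (- inverse c) \<odot> (z \<ominus> c \<odot> \<one>)"
    using zc c unfolding q_def w_def by (simp add: smult_add_right smult_minus_right smult_neg minus_eq minus_add a_comm)
  then have "\<parallel>q\<parallel> = inverse (cmod c) * \<parallel>z \<ominus> c \<odot> \<one>\<parallel>"
    using zc by (simp add: cnorm_smult norm_inverse)
  also have "\<dots> < 1" using lt c by (simp add: field_simps)
  finally have q1: "\<parallel>q\<parallel> < 1" .
  have qn: "\<parallel>q [^] n\<parallel> \<le> \<parallel>q\<parallel> ^ n" for n :: nat
  proof (induction n)
    case (Suc n)
    then show ?case using cnorm_mult_le[OF _ qc Suc order_refl] qc by (simp add: mult.commute)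
  qed (simp add: cnorm_one_le)
  have inI: "\<one> \<ominus> q [^] n \<in> I" for n :: nat
  proof (induction n)
    case 0
    then show ?case by (simp add: r_neg minus_eq I.zero_closed)
  next
    case (Suc n)
    have e: "q [^] n = q [^] n \<otimes> q \<oplus> q [^] n \<otimes> w"
    proof -
      have "q \<oplus> w = \<one>" unfolding q_def using wc by algebra
      then have "q [^] n \<otimes> (q \<oplus> w) = q [^] n" using qc by simp
      then show ?thesis using qc wc by (simp add: r_distr)
    qed
    have "\<one> \<ominus> q [^] Suc n = (\<one> \<ominus> q [^] n) \<oplus> q [^] n \<otimes> w"
      using qc wc by (subst e) (simp add: minus_eq minus_add a_assoc l_neg)
    moreover have "q [^] n \<otimes> w \<in> I" using I.I_l_closed[OF wI] qc by simp
    ultimately show ?case using Suc I.a_closed by simp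
  qed
  have "\<one> \<in> I"
  proof -
    have "\<exists>y\<in>I. \<parallel>\<one> \<ominus> y\<parallel> < e" if e: "0 < e" for e
    proof -
      obtain n where n: "\<parallel>q\<parallel> ^ n < e" using real_arch_pow_inv[OF e q1] by blast
      have "\<one> \<ominus> (\<one> \<ominus> q [^] n) = q [^] n" using qc by (simp add: minus_eq minus_add r_neg2)
      then have "\<parallel>\<one> \<ominus> (\<one> \<ominus> q [^] n)\<parallel> < e" using qn[of n] n by simp
      then show ?thesis using inI by blast
    qed
    then show ?thesis using cl unfolding closedin_norm_topology_iff by simp
  qed
  then show ?thesis using I.one_imp_carrier by blast
qed

end

section \<open>Isometric fibres in a C*-algebra\<close>

text \<open>What the argument uses of a represented product system, stated inside \<open>A\<close>,
  with \<open>H s\<close> in place of the fibre over \<open>s\<close>. Infinite dimension enters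
  only as \<open>H_infinite\<close>, a unit vector orthogonal to finitely many given ones.
  \<open>H_divide\<close> is the consequence needed of the density of the products of two fibres in
  the fibre over the product.\<close>

locale isometric_fibres = unital_cstar A + G: totally_ordered_amenable_group G P
  for A :: "'a cstar" (structure) and G :: "('g, 'm) monoid_scheme" and P :: "'g set" +
  fixes H :: "'g \<Rightarrow> 'a set"
  assumes one_not_zero: "\<one> \<noteq> \<zero>"
    and H_subset: "s \<in> P \<Longrightarrow> H s \<subseteq> carrier A"
    and H_smult: "\<lbrakk>s \<in> P; x \<in> H s\<rbrakk> \<Longrightarrow> c \<odot> x \<in> H s"
    and H_add: "\<lbrakk>s \<in> P; x \<in> H s; y \<in> H s\<rbrakk> \<Longrightarrow> x \<oplus> y \<in> H s"
    and H_mult: "\<lbrakk>s \<in> P; t \<in> P; x \<in> H s; y \<in> H t\<rbrakk> \<Longrightarrow> x \<otimes> y \<in> H (s \<otimes>\<^bsub>G\<^esub> t)"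
    and H_norm: "\<lbrakk>s \<in> P; x \<in> H s\<rbrakk> \<Longrightarrow> adj A x \<otimes> x = complex_of_real ((cnorm A x)\<^sup>2) \<odot> \<one>"
    and H_scalar: "\<lbrakk>s \<in> P; x \<in> H s; y \<in> H s\<rbrakk> \<Longrightarrow> \<exists>c. adj A x \<otimes> y = c \<odot> \<one>"
    and H_divide: "\<lbrakk>s \<in> P; t \<in> P; x \<in> H s; y \<in> H (s \<otimes>\<^bsub>G\<^esub> t)\<rbrakk> \<Longrightarrow> adj A x \<otimes> y \<in> H t"
    and H_one: "\<one> \<in> H \<one>\<^bsub>G\<^esub>"
    and H_unit: "s \<in> P \<Longrightarrow> \<exists>x\<in>H s. adj A x \<otimes> x = \<one>"
    and H_infinite: "\<lbrakk>s \<in> P; s \<noteq> \<one>\<^bsub>G\<^esub>; finite M; M \<subseteq> H s\<rbrakk> \<Longrightarrow>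
      \<exists>x\<in>H s. adj A x \<otimes> x = \<one> \<and> (\<forall>m\<in>M. adj A m \<otimes> x = \<zero>)"

section \<open>The left-invariant order on \<open>P\<close>\<close>

context totally_ordered_amenable_group begin

definition below (infix "\<preceq>" 50) where "s \<preceq> t \<longleftrightarrow> inv s \<otimes> t \<in> P"

lemma P_carrier [simp, intro]: "s \<in> P \<Longrightarrow> s \<in> carrier G" using P_subset by auto
lemma one_in_P [simp, intro]: "\<one> \<in> P" using P_Int_inverse by auto

lemma mult_inv_cancel [simp]: "s \<in> carrier G \<Longrightarrow> t \<in> carrier G \<Longrightarrow> s \<otimes> (inv s \<otimes> t) = t"
  by (simp add: m_assoc[symmetric])

lemma inv_mult_cancel [simp]: "s \<in> carrier G \<Longrightarrow> t \<in> carrier G \<Longrightarrow> inv s \<otimes> (s \<otimes> t) = t"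
  by (simp add: m_assoc[symmetric])

lemma below_refl [simp]: "s \<in> P \<Longrightarrow> s \<preceq> s" unfolding below_def by simp

lemma below_total: assumes "s \<in> P" "t \<in> P" shows "s \<preceq> t \<or> t \<preceq> s"
proof -
  have "inv s \<otimes> t \<in> P \<union> (\<lambda>s. inv s) ` P" using P_Un_inverse assms by auto
  moreover have "t \<preceq> s" if "inv s \<otimes> t = inv r" "r \<in> P" for r
  proof -
    have "inv t \<otimes> s = inv (inv s \<otimes> t)" using assms by (simp add: inv_mult_group)
    also have "\<dots> = r" using that by simp
    finally show ?thesis using that unfolding below_def by simp
  qed
  ultimately show ?thesis unfolding below_def by auto
qed

lemma below_trans: assumes "s \<in> P" "t \<in> P" "u \<in> P" "s \<preceq> t" "t \<preceq> u" shows "s \<preceq> u"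
proof -
  have "(inv s \<otimes> t) \<otimes> (inv t \<otimes> u) \<in> P" using assms P_closed unfolding below_def by blast
  moreover have "(inv s \<otimes> t) \<otimes> (inv t \<otimes> u) = inv s \<otimes> (t \<otimes> inv t) \<otimes> u"
    using assms by (simp add: m_assoc del: r_inv)
  ultimately show ?thesis using assms unfolding below_def by simp
qed

lemma below_shift:
  assumes "s \<in> P" "t \<in> P" "u \<in> P" "s \<preceq> t" "s \<preceq> u"
  shows "inv s \<otimes> t \<preceq> inv s \<otimes> u \<longleftrightarrow> t \<preceq> u"
  using assms unfolding below_def by (simp add: inv_mult_group m_assoc)

lemma diff_ne_one: "s \<in> P \<Longrightarrow> t \<in> P \<Longrightarrow> s \<noteq> t \<Longrightarrow> inv s \<otimes> t \<noteq> \<one>"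
  by (metis P_carrier inv_closed inv_equality inv_inv)

lemma below_minimum:
  assumes "finite X" "X \<noteq> {}" "X \<subseteq> P" shows "\<exists>m\<in>X. \<forall>x\<in>X. m \<preceq> x"
  using assms
proof (induction X rule: finite_ne_induct)
  case (insert x X)
  then obtain m where m: "m \<in> X" "\<forall>x\<in>X. m \<preceq> x" by auto
  show ?case
  proof (cases "m \<preceq> x")
    case True
    then show ?thesis using m by auto
  next
    case False
    then have "x \<preceq> m" using below_total[of x m] m insert by auto
    then have "\<forall>y\<in>X. x \<preceq> y" using m insert below_trans[of x m] by blast
    then show ?thesis using insert by auto
  qed
qed auto

lemma below_upper_bound:
  assumes "finite X" "X \<subseteq> P" shows "\<exists>m\<in>P. \<forall>x\<in>X. x \<preceq> m"
  using assms
proof (induction X)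
  case (insert x X)
  then obtain m where m: "m \<in> P" "\<forall>x\<in>X. x \<preceq> m" by auto
  show ?case
  proof (cases "x \<preceq> m")
    case True
    then show ?thesis using m by auto
  next
    case False
    then have "m \<preceq> x" using below_total[of x m] m insert by auto
    then have "\<forall>y\<in>X. y \<preceq> x" using m insert below_trans[of _ m x] by blast
    then show ?thesis using insert by (intro bexI[of _ x]) auto
  qed
qed auto

end

section \<open>Sums of generators\<close>

context unital_cstar begin

text \<open>Scalars are left out because the sets of monomials it is applied to are closed under
  scalar multiples. So this is their linear span, and an induction adds one monomial at a
  time.\<close>

inductive_set addspan :: "'a set \<Rightarrow> 'a set" for Z where
  zero: "\<zero> \<in> addspan Z"
| add: "z \<in> Z \<Longrightarrow> w \<in> addspan Z \<Longrightarrow> z \<oplus> w \<in> addspan Z"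

lemma addspan_carrier: assumes "Z \<subseteq> carrier A" shows "x \<in> addspan Z \<Longrightarrow> x \<in> carrier A"
  by (induction rule: addspan.induct) (use assms in auto)

lemma addspan_gen: "Z \<subseteq> carrier A \<Longrightarrow> z \<in> Z \<Longrightarrow> z \<in> addspan Z"
  using addspan.add[OF _ addspan.zero, of z Z] by auto

lemma addspan_plus:
  assumes "Z \<subseteq> carrier A" "y \<in> addspan Z" shows "x \<in> addspan Z \<Longrightarrow> x \<oplus> y \<in> addspan Z"
proof (induction rule: addspan.induct)
  case zero
  then show ?case using assms addspan_carrier[OF assms] by simp
next
  case (add z w)
  then have "z \<oplus> w \<oplus> y = z \<oplus> (w \<oplus> y)" using assms addspan_carrier[OF assms(1)] by (auto simp: a_assoc)
  then show ?case using addspan.add add by metis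
qed

lemma addspan_mono: assumes "Z \<subseteq> W" shows "x \<in> addspan Z \<Longrightarrow> x \<in> addspan W"
  by (induction rule: addspan.induct) (use assms in \<open>auto intro: addspan.intros\<close>)

lemma addspan_smult:
  assumes "Z \<subseteq> carrier A" "\<And>z. z \<in> Z \<Longrightarrow> c \<odot> z \<in> Z" shows "x \<in> addspan Z \<Longrightarrow> c \<odot> x \<in> addspan Z"
proof (induction rule: addspan.induct)
  case (add z w)
  then have "c \<odot> (z \<oplus> w) = c \<odot> z \<oplus> c \<odot> w" using assms addspan_carrier[OF assms(1)] by (auto simp: smult_add_right)
  then show ?case using add assms by (auto intro: addspan.add)
qed (auto intro: addspan.zero)

lemma addspan_adj:
  assumes "Z \<subseteq> carrier A" "\<And>z. z \<in> Z \<Longrightarrow> z\<star> \<in> W" shows "x \<in> addspan Z \<Longrightarrow> x\<star> \<in> addspan W"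
proof (induction rule: addspan.induct)
  case (add z w)
  then have "(z \<oplus> w)\<star> = z\<star> \<oplus> w\<star>" using assms addspan_carrier[OF assms(1)] by (auto simp: adj_add)
  then show ?case using add assms by (auto intro: addspan.add)
qed (auto intro: addspan.zero)

lemma addspan_mult:
  assumes Z: "Z \<subseteq> carrier A" and W: "W \<subseteq> carrier A" and V: "V \<subseteq> carrier A"
    and ZW: "\<And>z w. z \<in> Z \<Longrightarrow> w \<in> W \<Longrightarrow> z \<otimes> w \<in> addspan V"
    and x: "x \<in> addspan Z" and y: "y \<in> addspan W"
  shows "x \<otimes> y \<in> addspan V"
proof -
  have *: "z \<otimes> y \<in> addspan V" if z: "z \<in> Z" for z
    using y
  proof (induction rule: addspan.induct)
    case (add w v)
    have "z \<otimes> (w \<oplus> v) = z \<otimes> w \<oplus> z \<otimes> v"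
      using add z Z W addspan_carrier[OF W] by (intro r_distr) auto
    then show ?case using add ZW[OF z] addspan_plus[OF V] by auto
  next
    case zero
    have "z \<in> carrier A" using z Z by auto
    then show ?case by (simp add: addspan.zero)
  qed
  have yc: "y \<in> carrier A" using y addspan_carrier[OF W] by auto
  from x show ?thesis
  proof (induction rule: addspan.induct)
    case (add z v)
    have "(z \<oplus> v) \<otimes> y = z \<otimes> y \<oplus> v \<otimes> y"
      using add Z yc addspan_carrier[OF Z] by (intro l_distr) auto
    then show ?case using add * addspan_plus[OF V] by auto
  qed (use yc in \<open>auto intro: addspan.zero\<close>)
qed

lemma addspan_finsum:
  assumes "Z \<subseteq> carrier A" "finite X" "\<And>x. x \<in> X \<Longrightarrow> f x \<in> addspan Z"
  shows "finsum A f X \<in> addspan Z"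
  using assms(2,3)
proof (induction X)
  case (insert x X)
  then have "f \<in> insert x X \<rightarrow> carrier A" using addspan_carrier[OF assms(1)] by auto
  then show ?case using insert addspan_plus[OF assms(1)] by (simp add: finsum_insert)
qed (auto intro: addspan.zero)

end

context isometric_fibres begin

notation G.below (infix "\<preceq>" 50)
abbreviation gmult (infixl "\<cdot>" 70) where "g \<cdot> h \<equiv> g \<otimes>\<^bsub>G\<^esub> h"
abbreviation gunit ("\<e>") where "\<e> \<equiv> \<one>\<^bsub>G\<^esub>"
abbreviation ginv ("inv\<^sub>G _" [81] 80) where "inv\<^sub>G g \<equiv> inv\<^bsub>G\<^esub> g"

lemma H_carrier [intro, simp]: "x \<in> H s \<Longrightarrow> s \<in> P \<Longrightarrow> x \<in> carrier A" using H_subset by blast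

lemma cnorm_one [simp]: "\<parallel>\<one>\<parallel> = 1" using cnorm_one_cases one_not_zero cnorm_eq_0[of \<one>] by auto

lemma cnorm_scalar [simp]: "\<parallel>c \<odot> \<one>\<parallel> = cmod c" by (simp add: cnorm_smult)

lemma H_normalize:
  assumes "s \<in> P" "x \<in> H s" "x \<noteq> \<zero>"
  shows "\<exists>v\<in>H s. v\<star> \<otimes> v = \<one> \<and> x = complex_of_real \<parallel>x\<parallel> \<odot> v"
proof -
  have xc: "x \<in> carrier A" using assms by auto
  then have n: "\<parallel>x\<parallel> \<noteq> 0" using assms cnorm_eq_0 by simp
  define v where "v = complex_of_real (inverse \<parallel>x\<parallel>) \<odot> x"
  have "v\<star> \<otimes> v = complex_of_real (inverse \<parallel>x\<parallel> * inverse \<parallel>x\<parallel> * \<parallel>x\<parallel>\<^sup>2) \<odot> \<one>"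
    unfolding v_def using xc by (simp add: adj_smult H_norm[OF assms(1,2)] mult.assoc)
  also have "inverse \<parallel>x\<parallel> * inverse \<parallel>x\<parallel> * \<parallel>x\<parallel>\<^sup>2 = 1" using n by (simp add: power2_eq_square field_simps)
  also have "complex_of_real 1 \<odot> \<one> = \<one>" by simp
  finally have "v\<star> \<otimes> v = \<one>" .
  moreover have "x = complex_of_real \<parallel>x\<parallel> \<odot> v" unfolding v_def using xc n by (simp flip: of_real_mult)
  ultimately show ?thesis using H_smult[OF assms(1,2)] unfolding v_def by blast
qed

lemma H_divide':
  assumes "s \<in> P" "t \<in> P" "s \<preceq> t" "x \<in> H s" "y \<in> H t"
  shows "x\<star> \<otimes> y \<in> H (inv\<^sub>G s \<cdot> t)"
  using H_divide[of s "inv\<^sub>G s \<cdot> t" x y] assms unfolding G.below_def by simp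

text \<open>Right multiplication by an isometry can lower the norm of a general element. Here
  \<open>x\<star> \<otimes> x\<close> is a scalar and passes through \<open>v\<close>.\<close>

lemma H_mult_isometry_norm:
  assumes "s \<in> P" "x \<in> H s" "v \<in> carrier A" "v\<star> \<otimes> v = \<one>"
  shows "\<parallel>x \<otimes> v\<parallel> = \<parallel>x\<parallel>"
proof -
  have x: "x \<in> carrier A" using assms by auto
  have "(x \<otimes> v)\<star> \<otimes> (x \<otimes> v) = v\<star> \<otimes> (x\<star> \<otimes> x) \<otimes> v" using x assms by (simp add: adj_mult m_assoc)
  also have "\<dots> = complex_of_real (\<parallel>x\<parallel>\<^sup>2) \<odot> \<one>" using assms by (simp add: H_norm)
  finally have "\<parallel>x \<otimes> v\<parallel>\<^sup>2 = \<parallel>x\<parallel>\<^sup>2" using cstar_identity[of "x \<otimes> v"] x assms by (simp add: norm_power)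
  then show ?thesis using cnorm_nonneg x assms by (simp add: power2_eq_iff_nonneg)
qed

subsection \<open>Generic isometries\<close>

text \<open>For \<open>u\<close> strictly below \<open>t\<close> the condition
  \<open>m\<star> \<otimes> v = \<zero>\<close> is orthogonality of \<open>v\<close> to all of
  \<open>m \<otimes> H (u\<^sup>-\<^sup>1 t)\<close>, so \<open>H_infinite\<close> at level
  \<open>t\<close> is not enough. It is applied at the least level \<open>u0\<close> of
  \<open>M\<close> and yields the first factor \<open>v\<close> of the isometry. For a higher level,
  \<open>m\<star> \<otimes> (v \<otimes> w) = (v\<star> \<otimes> m)\<star> \<otimes> w\<close>, and
  \<open>v\<star> \<otimes> m\<close> has level \<open>u0\<^sup>-\<^sup>1 u\<close>, still different
  from \<open>\<e>\<close>; the second factor \<open>w\<close> comes from the induction hypothesis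
  for these fewer vectors.\<close>

lemma generic_isometry:
  assumes "finite M" and "\<And>u m. (u, m) \<in> M \<Longrightarrow> u \<in> P \<and> u \<noteq> \<e> \<and> m \<in> H u \<and> u \<preceq> t" and "t \<in> P"
  shows "\<exists>v\<in>H t. v\<star> \<otimes> v = \<one> \<and> (\<forall>(u, m)\<in>M. m\<star> \<otimes> v = \<zero>)"
  using assms
proof (induction "card M" arbitrary: M t rule: less_induct)
  case less
  show ?case
  proof (cases "M = {}")
    case True
    then show ?thesis using H_unit[OF less.prems(3)] by auto
  next
    case False
    have "\<exists>u0\<in>fst ` M. \<forall>u\<in>fst ` M. u0 \<preceq> u"
      by (rule G.below_minimum) (use less.prems False in auto)
    then obtain u0 m0 where u0: "(u0, m0) \<in> M" and min: "\<And>u m. (u, m) \<in> M \<Longrightarrow> u0 \<preceq> u" by force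
    have u0P: "u0 \<in> P" "u0 \<noteq> \<e>" "u0 \<preceq> t" using less.prems u0 by auto
    define M0 where "M0 = {m. (u0, m) \<in> M}"
    have "M0 \<subseteq> snd ` M" unfolding M0_def by force
    then have "finite M0" using less.prems by (meson finite_imageI finite_subset)
    moreover have "M0 \<subseteq> H u0" unfolding M0_def using less.prems by auto
    ultimately obtain v where v: "v \<in> H u0" "v\<star> \<otimes> v = \<one>" "\<forall>m\<in>M0. m\<star> \<otimes> v = \<zero>"
      using H_infinite[OF u0P(1,2)] by blast
    define M' where "M' = (\<lambda>(u, m). (inv\<^sub>G u0 \<cdot> u, v\<star> \<otimes> m)) ` {(u, m) \<in> M. u \<noteq> u0}"
    have sub: "{(u, m) \<in> M. u \<noteq> u0} \<subset> M" using u0 by auto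
    have "card M' \<le> card {(u, m) \<in> M. u \<noteq> u0}"
      unfolding M'_def by (rule card_image_le) (use less.prems sub in \<open>auto intro: finite_subset\<close>)
    also have "\<dots> < card M" using sub less.prems by (intro psubset_card_mono) auto
    finally have c: "card M' < card M" .
    have fin: "finite M'" unfolding M'_def using less.prems sub by (auto intro: finite_subset)
    have lev: "u' \<in> P \<and> u' \<noteq> \<e> \<and> m' \<in> H u' \<and> u' \<preceq> inv\<^sub>G u0 \<cdot> t" if in': "(u', m') \<in> M'" for u' m'
    proof -
      obtain u m where um: "(u, m) \<in> M" "u \<noteq> u0" "u' = inv\<^sub>G u0 \<cdot> u" "m' = v\<star> \<otimes> m"
        using in' unfolding M'_def by auto
      have uP: "u \<in> P" "m \<in> H u" "u \<preceq> t" "u0 \<preceq> u" using less.prems um min by auto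
      show ?thesis
        using um uP u0P v less.prems(3) G.diff_ne_one[of u0 u] H_divide'[of u0 u v m] G.below_shift[of u0 u t]
        by (auto simp: G.below_def)
    qed
    have tP: "inv\<^sub>G u0 \<cdot> t \<in> P" using u0P unfolding G.below_def by auto
    obtain w where w: "w \<in> H (inv\<^sub>G u0 \<cdot> t)" "w\<star> \<otimes> w = \<one>" "\<forall>(u, m)\<in>M'. m\<star> \<otimes> w = \<zero>"
      using less.hyps[OF c fin lev tP] by blast
    have vc: "v \<in> carrier A" and wc: "w \<in> carrier A" using v u0P w tP by auto
    have "v \<otimes> w \<in> H t" using H_mult[OF u0P(1) tP v(1) w(1)] u0P less.prems by simp
    moreover have "(v \<otimes> w)\<star> \<otimes> (v \<otimes> w) = \<one>" using isometry_mult_left[OF vc v(2) wc] w by simp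
    moreover have "m\<star> \<otimes> (v \<otimes> w) = \<zero>" if "(u, m) \<in> M" for u m
    proof -
      have mc: "m \<in> carrier A" using that less.prems by blast
      show ?thesis
      proof (cases "u = u0")
        case True
        then have "m\<star> \<otimes> v = \<zero>" using v that unfolding M0_def by auto
        then show ?thesis using mc vc wc by (simp add: m_assoc[symmetric])
      next
        case False
        then have "(inv\<^sub>G u0 \<cdot> u, v\<star> \<otimes> m) \<in> M'" using that unfolding M'_def by force
        then have "(v\<star> \<otimes> m)\<star> \<otimes> w = \<zero>" using w by auto
        then show ?thesis using mc vc wc by (simp add: adj_mult m_assoc)
      qed
    qed
    ultimately show ?thesis by blast
  qed
qed


subsection \<open>Spans of monomials\<close>

text \<open>The relation \<open>Q\<close> selects degrees, so that one set of closure lemmas serves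
  the core, the off-diagonal part, the homogeneous parts and the whole algebra. \<open>T\<close>
  records the levels that occur; only finitely many occur in a given element, and the norm estimates
  need a bound for them.\<close>

definition gens :: "'g set \<Rightarrow> ('g \<Rightarrow> 'g \<Rightarrow> bool) \<Rightarrow> 'a set" where
  "gens T Q = {x \<otimes> y\<star> | s t x y. s \<in> T \<and> t \<in> T \<and> Q s t \<and> x \<in> H s \<and> y \<in> H t}"

definition sp :: "'g set \<Rightarrow> ('g \<Rightarrow> 'g \<Rightarrow> bool) \<Rightarrow> 'a set" where
  "sp T Q = addspan (gens T Q)"

lemma gensI: "\<lbrakk>s \<in> T; t \<in> T; Q s t; x \<in> H s; y \<in> H t\<rbrakk> \<Longrightarrow> x \<otimes> y\<star> \<in> gens T Q"
  unfolding gens_def by blast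

lemma gens_carrier: "T \<subseteq> P \<Longrightarrow> gens T Q \<subseteq> carrier A"
  unfolding gens_def by (auto simp: subset_iff)

lemma sp_carrier: "T \<subseteq> P \<Longrightarrow> x \<in> sp T Q \<Longrightarrow> x \<in> carrier A"
  unfolding sp_def by (rule addspan_carrier[OF gens_carrier])

lemma spI: "\<lbrakk>T \<subseteq> P; s \<in> T; t \<in> T; Q s t; x \<in> H s; y \<in> H t\<rbrakk> \<Longrightarrow> x \<otimes> y\<star> \<in> sp T Q"
  unfolding sp_def by (rule addspan_gen[OF gens_carrier gensI])

lemma sp_zero: "\<zero> \<in> sp T Q" unfolding sp_def by (rule addspan.zero)

lemma sp_plus: "T \<subseteq> P \<Longrightarrow> x \<in> sp T Q \<Longrightarrow> y \<in> sp T Q \<Longrightarrow> x \<oplus> y \<in> sp T Q"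
  unfolding sp_def by (rule addspan_plus[OF gens_carrier])

lemma sp_mono:
  assumes "T \<subseteq> T'" "\<And>s t. s \<in> T \<Longrightarrow> t \<in> T \<Longrightarrow> Q s t \<Longrightarrow> Q' s t" "x \<in> sp T Q" shows "x \<in> sp T' Q'"
  using assms(3) unfolding sp_def
  by (rule addspan_mono[rotated]) (use assms(1,2) in \<open>unfold gens_def; blast\<close>)

lemma sp_smult: assumes "T \<subseteq> P" "x \<in> sp T Q" shows "c \<odot> x \<in> sp T Q"
  using assms(2) unfolding sp_def
proof (rule addspan_smult[OF gens_carrier[OF assms(1)], rotated])
  fix z assume "z \<in> gens T Q"
  then obtain s t x y where z: "z = x \<otimes> y\<star>" "s \<in> T" "t \<in> T" "Q s t" "x \<in> H s" "y \<in> H t"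
    unfolding gens_def by blast
  then have "c \<odot> z = (c \<odot> x) \<otimes> y\<star>" using assms(1) by (auto simp: subset_iff)
  then show "c \<odot> z \<in> gens T Q" using z H_smult[of s x c] assms(1) gensI[of s T t Q "c \<odot> x" y] by auto
qed

lemma sp_adj:
  assumes "T \<subseteq> P" "\<And>s t. s \<in> T \<Longrightarrow> t \<in> T \<Longrightarrow> Q s t \<Longrightarrow> Q' t s" "x \<in> sp T Q" shows "x\<star> \<in> sp T Q'"
  using assms(3) unfolding sp_def
proof (rule addspan_adj[OF gens_carrier[OF assms(1)], rotated])
  fix z assume "z \<in> gens T Q"
  then obtain s t x y where z: "z = x \<otimes> y\<star>" "s \<in> T" "t \<in> T" "Q s t" "x \<in> H s" "y \<in> H t"
    unfolding gens_def by blast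
  then have "z\<star> = y \<otimes> x\<star>" using assms(1) by (auto simp: subset_iff adj_mult)
  then show "z\<star> \<in> gens T Q'" using z assms(2) gensI[of t T s Q' y x] by auto
qed

text \<open>The order is total, so the middle factor of
  \<open>x \<otimes> y\<star> \<otimes> x' \<otimes> y'\<star>\<close> is either a vector, absorbed
  by \<open>x\<close> on the left, or the adjoint of a vector, absorbed by \<open>y'\<star>\<close>
  on the right. The product of two monomials is therefore a monomial; the two premises on
  \<open>Q''\<close> follow its levels in the two cases.\<close>

lemma sp_mult:
  assumes T: "T \<subseteq> P"
    and Q1: "\<And>s t s' t'. \<lbrakk>s \<in> T; t \<in> T; s' \<in> T; t' \<in> T; Q s t; Q' s' t'; t \<preceq> s'\<rbrakk> \<Longrightarrow>
      s \<cdot> (inv\<^sub>G t \<cdot> s') \<in> T \<and> Q'' (s \<cdot> (inv\<^sub>G t \<cdot> s')) t'"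
    and Q2: "\<And>s t s' t'. \<lbrakk>s \<in> T; t \<in> T; s' \<in> T; t' \<in> T; Q s t; Q' s' t'; s' \<preceq> t\<rbrakk> \<Longrightarrow>
      t' \<cdot> (inv\<^sub>G s' \<cdot> t) \<in> T \<and> Q'' s (t' \<cdot> (inv\<^sub>G s' \<cdot> t))"
    and x: "x \<in> sp T Q" and y: "y \<in> sp T Q'"
  shows "x \<otimes> y \<in> sp T Q''"
  using x y unfolding sp_def
proof (rule addspan_mult[OF gens_carrier[OF T] gens_carrier[OF T] gens_carrier[OF T], rotated 1])
  fix z w assume "z \<in> gens T Q" "w \<in> gens T Q'"
  then obtain s t x y s' t' x' y' where z: "z = x \<otimes> y\<star>" "s \<in> T" "t \<in> T" "Q s t" "x \<in> H s" "y \<in> H t"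
    and w: "w = x' \<otimes> y'\<star>" "s' \<in> T" "t' \<in> T" "Q' s' t'" "x' \<in> H s'" "y' \<in> H t'"
    unfolding gens_def by blast
  have P: "s \<in> P" "t \<in> P" "s' \<in> P" "t' \<in> P" using z w T by auto
  have car: "x \<in> carrier A" "y \<in> carrier A" "x' \<in> carrier A" "y' \<in> carrier A" using z w P by auto
  from G.below_total[OF P(2,3)] have "z \<otimes> w \<in> gens T Q''"
  proof
    assume l: "t \<preceq> s'"
    have "x \<otimes> (y\<star> \<otimes> x') \<in> H (s \<cdot> (inv\<^sub>G t \<cdot> s'))"
      using H_mult[OF P(1) _ z(5) H_divide'[OF P(2,3) l z(6) w(5)]] l unfolding G.below_def by blast
    moreover have "z \<otimes> w = (x \<otimes> (y\<star> \<otimes> x')) \<otimes> y'\<star>" using z w car by (simp add: m_assoc)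
    ultimately show ?thesis using Q1[OF z(2,3) w(2,3) z(4) w(4) l] w(3,6) gensI by metis
  next
    assume l: "s' \<preceq> t"
    have "y' \<otimes> (x'\<star> \<otimes> y) \<in> H (t' \<cdot> (inv\<^sub>G s' \<cdot> t))"
      using H_mult[OF P(4) _ w(6) H_divide'[OF P(3,2) l w(5) z(6)]] l unfolding G.below_def by blast
    moreover have "z \<otimes> w = x \<otimes> (y' \<otimes> (x'\<star> \<otimes> y))\<star>" using z w car by (simp add: m_assoc adj_mult)
    ultimately show ?thesis using Q2[OF z(2,3) w(2,3) z(4) w(4) l] z(2,5) gensI by metis
  qed
  then show "z \<otimes> w \<in> addspan (gens T Q'')" by (rule addspan_gen[OF gens_carrier[OF T]])
qed

lemma sp_finite_levels:
  assumes "x \<in> sp P Q" shows "\<exists>T. finite T \<and> T \<subseteq> P \<and> x \<in> sp T Q"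
  using assms unfolding sp_def
proof (induction rule: addspan.induct)
  case zero
  then show ?case using addspan.zero by (intro exI[of _ "{}"]) auto
next
  case (add z w)
  then obtain T where T: "finite T" "T \<subseteq> P" "w \<in> addspan (gens T Q)" by blast
  obtain s t x y where z: "z = x \<otimes> y\<star>" "s \<in> P" "t \<in> P" "Q s t" "x \<in> H s" "y \<in> H t"
    using add(1) unfolding gens_def by blast
  let ?T = "insert s (insert t T)"
  have "w \<in> addspan (gens ?T Q)" using sp_mono[of T ?T Q Q w] T unfolding sp_def by auto
  moreover have "z \<in> gens ?T Q" unfolding z(1) by (rule gensI) (use z in auto)
  ultimately have "z \<oplus> w \<in> addspan (gens ?T Q)" by (intro addspan.add)
  then show ?case using T z by (intro exI[of _ ?T]) auto
qed

abbreviation core :: "'g set \<Rightarrow> 'a set" where "core T \<equiv> sp T (=)"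
abbreviation offdiag :: "'g set \<Rightarrow> 'a set" where "offdiag T \<equiv> sp T (\<noteq>)"

lemma core_mult: assumes "T \<subseteq> P" "x \<in> core T" "y \<in> core T" shows "x \<otimes> y \<in> core T"
  by (rule sp_mult[OF assms(1) _ _ assms(2,3)]) (use assms(1) in \<open>auto simp: subset_iff\<close>)

lemma core_adj: "T \<subseteq> P \<Longrightarrow> x \<in> core T \<Longrightarrow> x\<star> \<in> core T"
  by (rule sp_adj[of T "(=)" "(=)"]) auto

text \<open>Exponent \<open>0\<close> is excluded because \<open>\<one>\<close> need not lie in
  \<open>core T\<close>.\<close>

lemma core_power: assumes "T \<subseteq> P" "x \<in> core T" shows "x [^] Suc n \<in> core T"
  using assms sp_carrier[OF assms] by (induction n) (auto intro: core_mult)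

text \<open>This makes \<open>core T\<close> act by operators on the single Hilbert space
  \<open>H t\<close>, as soon as \<open>t\<close> bounds \<open>T\<close>: a monomial
  \<open>x \<otimes> y\<star>\<close> of level \<open>s\<close> strips a factor of level
  \<open>s\<close> from \<open>\<xi>\<close> and puts one back.\<close>

lemma core_act:
  assumes T: "T \<subseteq> P" and t: "t \<in> P" "\<And>s. s \<in> T \<Longrightarrow> s \<preceq> t" and \<xi>: "\<xi> \<in> H t" and y: "y \<in> core T"
  shows "y \<otimes> \<xi> \<in> H t"
  using y unfolding sp_def
proof (induction rule: addspan.induct)
  case zero
  have "0 \<odot> \<xi> \<in> H t" using H_smult t \<xi> by blast
  then show ?case using \<xi> t by auto
next
  case (add z w)
  obtain s x y where z: "z = x \<otimes> y\<star>" "s \<in> T" "x \<in> H s" "y \<in> H s"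
    using add(1) unfolding gens_def by blast
  have s: "s \<in> P" "s \<preceq> t" using z T t by auto
  have car: "x \<in> carrier A" "y \<in> carrier A" "w \<in> carrier A" "\<xi> \<in> carrier A"
    using z s \<xi> t addspan_carrier[OF gens_carrier[OF T]] add by auto
  have "x \<otimes> (y\<star> \<otimes> \<xi>) \<in> H (s \<cdot> (inv\<^sub>G s \<cdot> t))"
    using H_mult[OF s(1) _ z(3) H_divide'[OF s(1) t(1) s(2) z(4) \<xi>]] s(2) unfolding G.below_def by blast
  then have "x \<otimes> (y\<star> \<otimes> \<xi>) \<oplus> w \<otimes> \<xi> \<in> H t" using add.IH H_add[OF t(1)] s t by simp
  moreover have "(z \<oplus> w) \<otimes> \<xi> = x \<otimes> (y\<star> \<otimes> \<xi>) \<oplus> w \<otimes> \<xi>"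
    using car z by (simp add: l_distr m_assoc)
  ultimately show ?case by simp
qed

subsection \<open>Norms of core elements\<close>

lemma core_power_act_le:
  assumes T: "T \<subseteq> P" and t: "t \<in> P" "\<And>s. s \<in> T \<Longrightarrow> s \<preceq> t" and y: "y \<in> core T" and R: "0 \<le> R"
    and le: "\<And>\<xi>. \<xi> \<in> H t \<Longrightarrow> \<parallel>y \<otimes> \<xi>\<parallel> \<le> R * \<parallel>\<xi>\<parallel>" and \<xi>: "\<xi> \<in> H t"
  shows "y [^] (n::nat) \<otimes> \<xi> \<in> H t \<and> \<parallel>y [^] n \<otimes> \<xi>\<parallel> \<le> R ^ n * \<parallel>\<xi>\<parallel>"
proof (induction n)
  case (Suc n)
  have car: "y \<in> carrier A" "\<xi> \<in> carrier A" using sp_carrier[OF T y] \<xi> t by auto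
  have e: "y [^] Suc n \<otimes> \<xi> = y \<otimes> (y [^] n \<otimes> \<xi>)" using car by (simp only: power_Suc2) (simp add: m_assoc)
  have "\<parallel>y \<otimes> (y [^] n \<otimes> \<xi>)\<parallel> \<le> R * \<parallel>y [^] n \<otimes> \<xi>\<parallel>" using le Suc by blast
  also have "\<dots> \<le> R * (R ^ n * \<parallel>\<xi>\<parallel>)" using Suc R by (intro mult_left_mono) auto
  finally show ?case unfolding e using core_act[OF T t _ y] Suc by (auto simp: mult_ac)
qed (use \<xi> t in auto)

text \<open>The product of \<open>W\<^sup>n\<close> and a rank one element \<open>x y\<^sup>\<star>\<close> only involves the vector \<open>W\<^sup>n x\<close>, so that \<open>\<parallel>W\<^sup>n\<^sup>+\<^sup>1\<parallel>\<close>
  grows at most like \<open>R\<^sup>n\<close>; the C*-identity removes the constant.\<close>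

lemma core_level_norm_le:
  assumes s: "s \<in> P" and Z: "Z \<in> core {s}" and R: "0 \<le> R"
    and le: "\<And>\<xi>. \<xi> \<in> H s \<Longrightarrow> \<parallel>Z \<otimes> \<xi>\<parallel> \<le> R * \<parallel>\<xi>\<parallel>"
  shows "\<parallel>Z\<parallel> \<le> R"
proof -
  have S: "{s} \<subseteq> P" using s by auto
  have Zc: "Z \<in> carrier A" using sp_carrier[OF S Z] .
  \<comment> \<open>Passing to \<open>Z\<star> \<otimes> Z\<close> makes
    \<open>cnorm_power_selfadj\<close> applicable. The extra factor
    \<open>\<parallel>Z\<parallel>\<close> in \<open>R'\<close> cancels at the end.\<close>
  define W where "W = Z\<star> \<otimes> Z"
  define R' where "R' = \<parallel>Z\<parallel> * R"
  have R': "0 \<le> R'" unfolding R'_def using R cnorm_nonneg Zc by simp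
  have W: "W \<in> core {s}" unfolding W_def by (rule core_mult[OF S core_adj[OF S Z] Z])
  have Wc: "W \<in> carrier A" "W\<star> = W" unfolding W_def using Zc by (auto simp: adj_mult)
  have Wle: "\<parallel>W \<otimes> \<xi>\<parallel> \<le> R' * \<parallel>\<xi>\<parallel>" if \<xi>: "\<xi> \<in> H s" for \<xi>
  proof -
    have \<xi>c: "\<xi> \<in> carrier A" using \<xi> s by auto
    have "W \<otimes> \<xi> = Z\<star> \<otimes> (Z \<otimes> \<xi>)" unfolding W_def using Zc \<xi>c by (simp add: m_assoc)
    then show ?thesis using cnorm_mult_le[of "Z\<star>" "Z \<otimes> \<xi>" "\<parallel>Z\<parallel>" "R * \<parallel>\<xi>\<parallel>"] Zc \<xi>c le[OF \<xi>]
      unfolding R'_def by (simp add: mult.assoc)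
  qed
  have "\<exists>C. \<forall>n::nat. \<parallel>W [^] n \<otimes> w\<parallel> \<le> C * R' ^ n" if "w \<in> core {s}" for w
    using that unfolding sp_def
  proof (induction rule: addspan.induct)
    case zero
    then show ?case using Wc by (intro exI[of _ 0]) auto
  next
    case (add z w)
    then obtain C where C: "\<And>n::nat. \<parallel>W [^] n \<otimes> w\<parallel> \<le> C * R' ^ n" by blast
    obtain x y where z: "z = x \<otimes> y\<star>" "x \<in> H s" "y \<in> H s"
      using add(1) unfolding gens_def by blast
    have car: "x \<in> carrier A" "y \<in> carrier A" "w \<in> carrier A"
      using z s addspan_carrier[OF gens_carrier[OF S]] add by auto
    have "\<parallel>W [^] n \<otimes> (z \<oplus> w)\<parallel> \<le> (\<parallel>x\<parallel> * \<parallel>y\<parallel> + C) * R' ^ n" for n :: nat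
    proof -
      have "W [^] n \<otimes> (z \<oplus> w) = (W [^] n \<otimes> x) \<otimes> y\<star> \<oplus> W [^] n \<otimes> w"
        using car Wc z by (simp add: r_distr m_assoc)
      moreover have "\<parallel>(W [^] n \<otimes> x) \<otimes> y\<star>\<parallel> \<le> (R' ^ n * \<parallel>x\<parallel>) * \<parallel>y\<parallel>"
        using core_power_act_le[OF S s _ W R' Wle z(2), of n] s car Wc by (intro cnorm_mult_le[of "W [^] n \<otimes> x"]) auto
      moreover have "\<parallel>(W [^] n \<otimes> x) \<otimes> y\<star> \<oplus> W [^] n \<otimes> w\<parallel> \<le> \<parallel>(W [^] n \<otimes> x) \<otimes> y\<star>\<parallel> + \<parallel>W [^] n \<otimes> w\<parallel>"
        using car Wc by (intro cnorm_triangle) auto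
      ultimately show ?thesis using C[of n] by (simp add: algebra_simps)
    qed
    then show ?case by blast
  qed
  then obtain C where C: "\<And>n::nat. \<parallel>W [^] n \<otimes> W\<parallel> \<le> C * R' ^ n" using W by blast
  have "\<parallel>W\<parallel> \<le> R'"
  proof (rule le_of_power_bound'[OF cnorm_nonneg[OF Wc(1)] R'])
    fix k
    obtain m where m: "(2::nat) ^ k = Suc m" by (metis Suc_pred zero_less_numeral zero_less_power)
    then show "\<parallel>W\<parallel> ^ 2 ^ k \<le> C * R' ^ (2 ^ k - 1)"
      using cnorm_power_selfadj[OF Wc, of k] C[of m] by simp
  qed
  then have "\<parallel>Z\<parallel>\<^sup>2 \<le> \<parallel>Z\<parallel> * R" unfolding W_def R'_def using cstar_identity[OF Zc] by simp
  then show ?thesis using cnorm_nonneg[OF Zc] R by (cases "\<parallel>Z\<parallel> = 0") (auto simp: power2_eq_square)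
qed

lemma core_split:
  assumes T: "T \<subseteq> P" and s: "s \<in> T" and y: "y \<in> core T"
  shows "\<exists>Z\<in>core {s}. \<exists>y'\<in>core (T - {s}). y = Z \<oplus> y'"
proof -
  have T': "{s} \<subseteq> P" "T - {s} \<subseteq> P" using T s by auto
  show ?thesis using y unfolding sp_def[of T]
  proof (induction rule: addspan.induct)
    case zero
    show ?case by (rule bexI[OF _ sp_zero], rule bexI[OF _ sp_zero]) simp
  next
    case (add z w)
    then obtain Z y' where w: "Z \<in> core {s}" "y' \<in> core (T - {s})" "w = Z \<oplus> y'" by blast
    have c: "Z \<in> carrier A" "y' \<in> carrier A" "z \<in> carrier A"
      using sp_carrier[OF T'(1) w(1)] sp_carrier[OF T'(2) w(2)] gens_carrier[OF T] add(1) by auto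
    obtain u x y where z: "z = x \<otimes> y\<star>" "u \<in> T" "x \<in> H u" "y \<in> H u"
      using add(1) unfolding gens_def by blast
    show ?case
    proof (cases "u = s")
      case True
      then have "z \<oplus> Z \<in> core {s}" using z w(1) T' by (auto intro!: sp_plus spI)
      moreover have "z \<oplus> w = (z \<oplus> Z) \<oplus> y'" using c w by (simp add: a_assoc)
      ultimately show ?thesis using w(2) by blast
    next
      case False
      then have "z \<oplus> y' \<in> core (T - {s})"
        unfolding z(1) using z w(2) T' by (intro sp_plus spI[of _ u u]) auto
      moreover have "z \<oplus> w = Z \<oplus> (z \<oplus> y')" using c w by (simp add: a_lcomm)
      ultimately show ?thesis using w(1) by blast
    qed
  qed
qed

text \<open>A monomial of level \<open>u\<close> annihilates \<open>\<xi> \<otimes> v\<close> once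
  \<open>y\<star> \<otimes> \<xi> \<otimes> v = (\<xi>\<star> \<otimes> y)\<star> \<otimes>
  v\<close> vanishes, and \<open>\<xi>\<star> \<otimes> y\<close> is a vector because
  \<open>s\<close> lies below \<open>u\<close>. The set \<open>M\<close> of these vectors is in the
  form that \<open>generic_isometry\<close> accepts.\<close>

lemma core_kill:
  assumes s: "s \<in> P" and T: "T \<subseteq> P" "\<forall>u\<in>T. s \<preceq> u \<and> u \<noteq> s" and \<xi>: "\<xi> \<in> H s" and y: "y \<in> core T"
  shows "\<exists>M. finite M \<and> (\<forall>(u, m)\<in>M. (\<exists>t\<in>T. u = inv\<^sub>G s \<cdot> t) \<and> m \<in> H u) \<and>
    (\<forall>v\<in>carrier A. (\<forall>(u, m)\<in>M. m\<star> \<otimes> v = \<zero>) \<longrightarrow> y \<otimes> (\<xi> \<otimes> v) = \<zero>)"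
  using y unfolding sp_def
proof (induction rule: addspan.induct)
  case zero
  show ?case using \<xi> s by (intro exI[of _ "{}"]) auto
next
  case (add z w)
  then obtain M where M: "finite M" "\<forall>(u, m)\<in>M. (\<exists>t\<in>T. u = inv\<^sub>G s \<cdot> t) \<and> m \<in> H u"
    "\<forall>v\<in>carrier A. (\<forall>(u, m)\<in>M. m\<star> \<otimes> v = \<zero>) \<longrightarrow> w \<otimes> (\<xi> \<otimes> v) = \<zero>" by blast
  obtain u x y where z: "z = x \<otimes> y\<star>" "u \<in> T" "x \<in> H u" "y \<in> H u"
    using add(1) unfolding gens_def by blast
  have u: "u \<in> P" "s \<preceq> u" using z T by auto
  have c: "x \<in> carrier A" "y \<in> carrier A" "\<xi> \<in> carrier A" "w \<in> carrier A"
    using z u \<xi> s addspan_carrier[OF gens_carrier[OF T(1)] add(2)] by auto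
  define M' where "M' = insert (inv\<^sub>G s \<cdot> u, \<xi>\<star> \<otimes> y) M"
  have "(z \<oplus> w) \<otimes> (\<xi> \<otimes> v) = \<zero>" if v: "v \<in> carrier A" "\<forall>(u, m)\<in>M'. m\<star> \<otimes> v = \<zero>" for v
  proof -
    have "(\<xi>\<star> \<otimes> y)\<star> \<otimes> v = \<zero>" and w0: "w \<otimes> (\<xi> \<otimes> v) = \<zero>" using v M(3) unfolding M'_def by auto
    then have "y\<star> \<otimes> (\<xi> \<otimes> v) = \<zero>" using c v by (simp add: adj_mult m_assoc)
    then show ?thesis using c v z w0 by (simp add: l_distr m_assoc)
  qed
  moreover have "finite M'" "\<forall>(u, m)\<in>M'. (\<exists>t\<in>T. u = inv\<^sub>G s \<cdot> t) \<and> m \<in> H u"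
    using M z H_divide'[OF s u \<xi> z(4)] unfolding M'_def by auto
  ultimately show ?case by blast
qed

lemma norm_bound_nonneg:
  assumes "t \<in> P" "y \<in> carrier A" "\<And>\<xi>. \<xi> \<in> H t \<Longrightarrow> \<parallel>y \<otimes> \<xi>\<parallel> \<le> R * \<parallel>\<xi>\<parallel>"
  shows "0 \<le> R"
proof -
  obtain \<xi> where \<xi>: "\<xi> \<in> H t" "\<xi>\<star> \<otimes> \<xi> = \<one>" using H_unit[OF assms(1)] by blast
  then have c: "\<xi> \<in> carrier A" using assms by auto
  then have "\<parallel>\<xi>\<parallel>\<^sup>2 = 1" using cstar_identity[OF c] \<xi> by simp
  then have "\<parallel>\<xi>\<parallel> = 1" using cnorm_nonneg[OF c] by (simp add: power2_eq_1_iff)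
  then show ?thesis using assms(3)[OF \<xi>(1)] cnorm_nonneg[of "y \<otimes> \<xi>"] c assms(2) by simp
qed

text \<open>Peel off the lowest level \<open>s\<close>: a generic isometry annihilates the other levels of \<open>y\<close> on \<open>\<xi> \<otimes> v\<close>,
  so the lowest component has norm at most \<open>R\<close>.\<close>

lemma core_norm_le_crude:
  assumes "finite T" "T \<subseteq> P" "t \<in> P" "\<And>s. s \<in> T \<Longrightarrow> s \<preceq> t" "y \<in> core T"
    and "\<And>\<xi>. \<xi> \<in> H t \<Longrightarrow> \<parallel>y \<otimes> \<xi>\<parallel> \<le> R * \<parallel>\<xi>\<parallel>"
  shows "\<parallel>y\<parallel> \<le> 3 ^ card T * R"
  using assms
proof (induction "card T" arbitrary: T y R)
  case 0
  then have "gens T (=) = {}" unfolding gens_def by auto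
  with 0 have "y = \<zero>" unfolding sp_def by (auto elim: addspan.cases)
  then show ?case using norm_bound_nonneg[OF \<open>t \<in> P\<close> _ 0(7)] by simp
next
  case (Suc n)
  have yc: "y \<in> carrier A" using sp_carrier Suc.prems by blast
  have R: "0 \<le> R" by (rule norm_bound_nonneg[OF Suc.prems(3) yc Suc.prems(6)])
  have "T \<noteq> {}" using Suc.hyps(2) by auto
  then obtain s where s: "s \<in> T" "\<And>u. u \<in> T \<Longrightarrow> s \<preceq> u"
    using G.below_minimum[OF Suc.prems(1) _ Suc.prems(2)] by blast
  have sP: "s \<in> P" "s \<preceq> t" using s Suc.prems by auto
  obtain Z y' where Z: "Z \<in> core {s}" and y': "y' \<in> core (T - {s})" and e: "y = Z \<oplus> y'"
    using core_split[OF Suc.prems(2) s(1) Suc.prems(5)] by blast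
  have T': "T - {s} \<subseteq> P" using Suc.prems by auto
  have c: "Z \<in> carrier A" "y' \<in> carrier A" using sp_carrier[OF _ Z] sp_carrier[OF T' y'] sP by auto
  have low: "\<forall>u\<in>T - {s}. s \<preceq> u \<and> u \<noteq> s" using s by auto
  have "\<parallel>Z\<parallel> \<le> R"
  proof (rule core_level_norm_le[OF sP(1) Z R])
    fix \<xi> assume \<xi>: "\<xi> \<in> H s"
    obtain M where M: "finite M" "\<forall>(u, m)\<in>M. (\<exists>t\<in>T - {s}. u = inv\<^sub>G s \<cdot> t) \<and> m \<in> H u"
      "\<forall>v\<in>carrier A. (\<forall>(u, m)\<in>M. m\<star> \<otimes> v = \<zero>) \<longrightarrow> y' \<otimes> (\<xi> \<otimes> v) = \<zero>"
      using core_kill[OF sP(1) T' low \<xi> y'] by (elim exE conjE) (rule that)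
    have tP: "inv\<^sub>G s \<cdot> t \<in> P" using sP unfolding G.below_def by auto
    have "\<exists>v\<in>H (inv\<^sub>G s \<cdot> t). v\<star> \<otimes> v = \<one> \<and> (\<forall>(u, m)\<in>M. m\<star> \<otimes> v = \<zero>)"
    proof (rule generic_isometry[OF M(1) _ tP])
      fix u m assume "(u, m) \<in> M"
      then obtain r where r: "r \<in> T - {s}" "u = inv\<^sub>G s \<cdot> r" "m \<in> H u" using M(2) by blast
      then have "r \<in> P" "s \<preceq> r" "r \<preceq> t" using s Suc.prems by auto
      then show "u \<in> P \<and> u \<noteq> \<e> \<and> m \<in> H u \<and> u \<preceq> inv\<^sub>G s \<cdot> t"
        using r sP Suc.prems(3) G.diff_ne_one[of s r] G.below_shift[of s r t] by (auto simp: G.below_def)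
    qed
    then obtain v where v: "v \<in> H (inv\<^sub>G s \<cdot> t)" "v\<star> \<otimes> v = \<one>" "\<forall>(u, m)\<in>M. m\<star> \<otimes> v = \<zero>" by blast
    have vc: "v \<in> carrier A" "\<xi> \<in> carrier A" using v tP \<xi> sP by auto
    have "Z \<otimes> \<xi> \<in> H s" by (rule core_act[OF _ sP(1) _ \<xi> Z]) (use sP in auto)
    then have "\<parallel>Z \<otimes> \<xi>\<parallel> = \<parallel>Z \<otimes> \<xi> \<otimes> v\<parallel>" using H_mult_isometry_norm[OF sP(1) _ vc(1) v(2)] by simp
    also have "Z \<otimes> \<xi> \<otimes> v = y \<otimes> (\<xi> \<otimes> v)"
      using M(3) v(3) vc c unfolding e by (simp add: l_distr m_assoc)
    also have "\<parallel>y \<otimes> (\<xi> \<otimes> v)\<parallel> \<le> R * \<parallel>\<xi> \<otimes> v\<parallel>"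
      using Suc.prems(6)[of "\<xi> \<otimes> v"] H_mult[OF sP(1) tP \<xi> v(1)] sP Suc.prems(3) by simp
    also have "\<parallel>\<xi> \<otimes> v\<parallel> = \<parallel>\<xi>\<parallel>" using H_mult_isometry_norm[OF sP(1) \<xi> vc(1) v(2)] .
    finally show "\<parallel>Z \<otimes> \<xi>\<parallel> \<le> R * \<parallel>\<xi>\<parallel>" .
  qed
  \<comment> \<open>On \<open>H t\<close> the remainder \<open>y' = y - Z\<close> is bounded by
    \<open>2 * R\<close>, so each level costs a factor \<open>3 = 1 + 2\<close>.\<close>
  have "\<parallel>y'\<parallel> \<le> 3 ^ card (T - {s}) * (2 * R)"
  proof (rule Suc.hyps(1))
    show "n = card (T - {s})" using Suc.hyps(2) s Suc.prems by simp
    fix \<xi> assume \<xi>: "\<xi> \<in> H t"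
    have \<xi>c: "\<xi> \<in> carrier A" using \<xi> Suc.prems by auto
    have "y \<otimes> \<xi> = y' \<otimes> \<xi> \<oplus> Z \<otimes> \<xi>" using c \<xi>c unfolding e by (simp add: l_distr a_comm)
    then have "y' \<otimes> \<xi> = y \<otimes> \<xi> \<ominus> Z \<otimes> \<xi>" using c \<xi>c by (simp add: minus_eq a_assoc r_neg)
    then have "\<parallel>y' \<otimes> \<xi>\<parallel> \<le> \<parallel>y \<otimes> \<xi>\<parallel> + \<parallel>Z \<otimes> \<xi>\<parallel>" using cnorm_diff_le yc c \<xi>c by simp
    moreover have "\<parallel>Z \<otimes> \<xi>\<parallel> \<le> R * \<parallel>\<xi>\<parallel>" by (rule cnorm_mult_le) (use c \<xi>c \<open>\<parallel>Z\<parallel> \<le> R\<close> in auto)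
    ultimately show "\<parallel>y' \<otimes> \<xi>\<parallel> \<le> 2 * R * \<parallel>\<xi>\<parallel>" using Suc.prems(6)[OF \<xi>] by simp
  qed (use Suc.prems y' in auto)
  moreover have "card (T - {s}) = n" using Suc.hyps(2) s(1) Suc.prems(1) by simp
  ultimately have "\<parallel>y\<parallel> \<le> R + 3 ^ n * (2 * R)"
    using \<open>\<parallel>Z\<parallel> \<le> R\<close> cnorm_triangle[OF c] unfolding e by simp
  also have "\<dots> \<le> 3 ^ n * R + 3 ^ n * (2 * R)" using mult_right_mono[OF one_le_power[of 3 n] R] by (simp add: mult.commute)
  also have "\<dots> = 3 ^ card T * R" using Suc.hyps(2)[symmetric] by simp
  finally show ?case .
qed

text \<open>Powers of \<open>y\<close> stay in \<open>core T\<close>, so the factor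
  \<open>3 ^ card T\<close> of the crude bound is the same for all of them and is lost in the root.
  Thus the action on \<open>H t\<close> determines the norm of a self-adjoint core element.\<close>

lemma core_norm_le:
  assumes T: "finite T" "T \<subseteq> P" and t: "t \<in> P" "\<And>s. s \<in> T \<Longrightarrow> s \<preceq> t"
    and y: "y \<in> core T" "y\<star> = y"
    and le: "\<And>\<xi>. \<xi> \<in> H t \<Longrightarrow> \<parallel>y \<otimes> \<xi>\<parallel> \<le> R * \<parallel>\<xi>\<parallel>"
  shows "\<parallel>y\<parallel> \<le> R"
proof -
  have yc: "y \<in> carrier A" using sp_carrier[OF T(2) y(1)] .
  have R: "0 \<le> R" by (rule norm_bound_nonneg[OF t(1) yc le])
  show ?thesis
  proof (rule le_of_power_bound[OF cnorm_nonneg[OF yc] R])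
    fix k
    obtain m where m: "(2::nat) ^ k = Suc m" by (metis Suc_pred zero_less_numeral zero_less_power)
    have "\<parallel>y [^] (2 ^ k :: nat)\<parallel> \<le> 3 ^ card T * R ^ 2 ^ k"
    proof (rule core_norm_le_crude[OF T t])
      show "y [^] (2 ^ k :: nat) \<in> core T" unfolding m by (rule core_power[OF T(2) y(1)])
      show "\<parallel>y [^] (2 ^ k :: nat) \<otimes> \<xi>\<parallel> \<le> R ^ 2 ^ k * \<parallel>\<xi>\<parallel>" if "\<xi> \<in> H t" for \<xi>
        using core_power_act_le[OF T(2) t y(1) R le that] by blast
    qed
    then show "\<parallel>y\<parallel> ^ 2 ^ k \<le> 3 ^ card T * R ^ 2 ^ k" using cnorm_power_selfadj[OF yc y(2)] by simp
  qed
qed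

text \<open>If no unit vector of \<open>H t\<close> worked, \<open>core_norm_le\<close> would give
  \<open>\<parallel>y\<parallel> \<le> \<parallel>y\<parallel> / 2\<close>. The norm need not be
  attained, hence a factor below \<open>1\<close>.\<close>

lemma core_norming_vector:
  assumes T: "finite T" "T \<subseteq> P" and t: "t \<in> P" "\<And>s. s \<in> T \<Longrightarrow> s \<preceq> t"
    and y: "y \<in> core T" "y\<star> = y"
  shows "\<exists>v\<in>H t. v\<star> \<otimes> v = \<one> \<and> \<parallel>y\<parallel> / 2 \<le> \<parallel>y \<otimes> v\<parallel>"
proof (cases "y = \<zero>")
  case True
  obtain v where "v \<in> H t" "v\<star> \<otimes> v = \<one>" using H_unit[OF t(1)] by blast
  moreover from this have "v \<in> carrier A" using t(1) by auto
  ultimately show ?thesis using True by (intro bexI[of _ v]) auto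
next
  case False
  have yc: "y \<in> carrier A" using sp_carrier[OF T(2) y(1)] .
  have "\<not> (\<forall>\<xi>\<in>H t. \<parallel>y \<otimes> \<xi>\<parallel> \<le> \<parallel>y\<parallel> / 2 * \<parallel>\<xi>\<parallel>)"
  proof
    assume "\<forall>\<xi>\<in>H t. \<parallel>y \<otimes> \<xi>\<parallel> \<le> \<parallel>y\<parallel> / 2 * \<parallel>\<xi>\<parallel>"
    then have "\<parallel>y\<parallel> \<le> \<parallel>y\<parallel> / 2" by (intro core_norm_le[OF T t y]) blast+
    then show False using False cnorm_nonneg[OF yc] cnorm_eq_0[OF yc] by simp
  qed
  then obtain \<xi> where \<xi>: "\<xi> \<in> H t" "\<parallel>y\<parallel> / 2 * \<parallel>\<xi>\<parallel> < \<parallel>y \<otimes> \<xi>\<parallel>" by (meson not_le)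
  then have "\<xi> \<noteq> \<zero>" using yc by auto
  then obtain v where v: "v \<in> H t" "v\<star> \<otimes> v = \<one>" "\<xi> = complex_of_real \<parallel>\<xi>\<parallel> \<odot> v"
    using H_normalize[OF t(1) \<xi>(1)] by blast
  have c: "v \<in> carrier A" "\<xi> \<in> carrier A" using v \<xi> t by auto
  have "y \<otimes> \<xi> = complex_of_real \<parallel>\<xi>\<parallel> \<odot> (y \<otimes> v)" using yc c by (subst v(3)) simp
  then have "\<parallel>y \<otimes> \<xi>\<parallel> = \<parallel>y \<otimes> v\<parallel> * \<parallel>\<xi>\<parallel>" using yc c cnorm_nonneg[OF c(2)] by (simp add: cnorm_smult)
  then have "\<parallel>y\<parallel> / 2 * \<parallel>\<xi>\<parallel> < \<parallel>y \<otimes> v\<parallel> * \<parallel>\<xi>\<parallel>" using \<xi>(2) by simp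
  then have "\<parallel>y\<parallel> / 2 < \<parallel>y \<otimes> v\<parallel>" using cnorm_nonneg[OF c(2)] by (rule mult_right_less_imp_less)
  then show ?thesis using v by (intro bexI[of _ v]) auto
qed

text \<open>Compressing \<open>x \<otimes> y\<star>\<close> by \<open>\<xi>\<close> gives
  \<open>a\<star> \<otimes> b\<close> with \<open>a\<close> and \<open>b\<close> of different levels
  \<open>p\<close> and \<open>q\<close>. By totality \<open>a\<star> \<otimes> b\<close> or its
  adjoint is a vector \<open>m\<close> of a level different from \<open>\<e>\<close>, and
  \<open>m\<star> \<otimes> v = \<zero>\<close> kills the compression by \<open>v\<close> in either
  case.\<close>

lemma offdiag_kill:
  assumes T: "T \<subseteq> P" and t: "t \<in> P" "\<And>s. s \<in> T \<Longrightarrow> s \<preceq> t" and \<xi>: "\<xi> \<in> H t" and z: "z \<in> offdiag T"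
  shows "\<exists>M. finite M \<and> (\<forall>(u, m)\<in>M. u \<in> P \<and> u \<noteq> \<e> \<and> m \<in> H u) \<and>
    (\<forall>v\<in>carrier A. (\<forall>(u, m)\<in>M. m\<star> \<otimes> v = \<zero>) \<longrightarrow> (\<xi> \<otimes> v)\<star> \<otimes> z \<otimes> (\<xi> \<otimes> v) = \<zero>)"
  using z unfolding sp_def
proof (induction rule: addspan.induct)
  case zero
  show ?case using \<xi> t by (intro exI[of _ "{}"]) auto
next
  case (add z w)
  then obtain M where M: "finite M" "\<forall>(u, m)\<in>M. u \<in> P \<and> u \<noteq> \<e> \<and> m \<in> H u"
    "\<forall>v\<in>carrier A. (\<forall>(u, m)\<in>M. m\<star> \<otimes> v = \<zero>) \<longrightarrow> (\<xi> \<otimes> v)\<star> \<otimes> w \<otimes> (\<xi> \<otimes> v) = \<zero>" by blast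
  obtain s r x y where z: "z = x \<otimes> y\<star>" "s \<in> T" "r \<in> T" "s \<noteq> r" "x \<in> H s" "y \<in> H r"
    using add(1) unfolding gens_def by blast
  have P: "s \<in> P" "r \<in> P" "s \<preceq> t" "r \<preceq> t" using z T t by auto
  have c: "x \<in> carrier A" "y \<in> carrier A" "\<xi> \<in> carrier A" "w \<in> carrier A"
    using z P \<xi> t addspan_carrier[OF gens_carrier[OF T(1)] add(2)] by auto
  define p where "p = inv\<^sub>G s \<cdot> t"
  define q where "q = inv\<^sub>G r \<cdot> t"
  define a where "a = x\<star> \<otimes> \<xi>"
  define b where "b = y\<star> \<otimes> \<xi>"
  have pq: "p \<in> P" "q \<in> P" using P unfolding p_def q_def G.below_def by auto
  \<comment> \<open>Distinct levels \<open>s\<close> and \<open>r\<close> stay distinct after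
    passing to \<open>t\<close>; otherwise \<open>u\<close> below would be \<open>\<e>\<close> and
    no isometry could be orthogonal to every \<open>m\<close>.\<close>
  have ne: "p \<noteq> q" unfolding p_def q_def using z(4) P t by (metis G.P_carrier G.inv_closed G.inv_inv G.right_cancel)
  have ab: "a \<in> H p" "b \<in> H q" unfolding a_def b_def p_def q_def
    using H_divide'[OF P(1) t(1) P(3) z(5) \<xi>] H_divide'[OF P(2) t(1) P(4) z(6) \<xi>] by auto
  have abc: "a \<in> carrier A" "b \<in> carrier A" using ab pq by auto
  have zz: "(\<xi> \<otimes> v)\<star> \<otimes> z \<otimes> (\<xi> \<otimes> v) = v\<star> \<otimes> (a\<star> \<otimes> b) \<otimes> v" if "v \<in> carrier A" for v
    unfolding a_def b_def z(1) using c that by (simp add: adj_mult m_assoc)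
  have "\<exists>u m. u \<in> P \<and> u \<noteq> \<e> \<and> m \<in> H u \<and> (\<forall>v\<in>carrier A. m\<star> \<otimes> v = \<zero> \<longrightarrow> v\<star> \<otimes> (a\<star> \<otimes> b) \<otimes> v = \<zero>)"
    using G.below_total[OF pq]
  proof
    assume l: "p \<preceq> q"
    have "v\<star> \<otimes> (a\<star> \<otimes> b) \<otimes> v = \<zero>" if v: "v \<in> carrier A" "(a\<star> \<otimes> b)\<star> \<otimes> v = \<zero>" for v
    proof -
      have "v\<star> \<otimes> (a\<star> \<otimes> b) = ((a\<star> \<otimes> b)\<star> \<otimes> v)\<star>" using v(1) abc by (simp add: adj_mult)
      then show ?thesis using v by simp
    qed
    then show ?thesis using H_divide'[OF pq l ab] G.diff_ne_one[OF pq ne] l unfolding G.below_def by blast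
  next
    assume l: "q \<preceq> p"
    have "v\<star> \<otimes> (a\<star> \<otimes> b) \<otimes> v = \<zero>" if v: "v \<in> carrier A" "(b\<star> \<otimes> a)\<star> \<otimes> v = \<zero>" for v
      using v abc by (simp add: adj_mult m_assoc)
    then show ?thesis using H_divide'[OF pq(2,1) l ab(2,1)] G.diff_ne_one[OF pq(2,1) ne[symmetric]] l
      unfolding G.below_def by blast
  qed
  then obtain u m where um: "u \<in> P" "u \<noteq> \<e>" "m \<in> H u"
    "\<And>v. v \<in> carrier A \<Longrightarrow> m\<star> \<otimes> v = \<zero> \<Longrightarrow> v\<star> \<otimes> (a\<star> \<otimes> b) \<otimes> v = \<zero>" by blast
  have "(\<xi> \<otimes> v)\<star> \<otimes> (z \<oplus> w) \<otimes> (\<xi> \<otimes> v) = \<zero>" if v: "v \<in> carrier A" "\<forall>(u, m)\<in>insert (u, m) M. m\<star> \<otimes> v = \<zero>" for v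
  proof -
    have zc: "z \<in> carrier A" using z c by simp
    have "(\<xi> \<otimes> v)\<star> \<otimes> z \<otimes> (\<xi> \<otimes> v) = \<zero>" unfolding zz[OF v(1)] using um(4) v by auto
    moreover have "(\<xi> \<otimes> v)\<star> \<otimes> w \<otimes> (\<xi> \<otimes> v) = \<zero>" using M(3) v by auto
    moreover have "(\<xi> \<otimes> v)\<star> \<otimes> (z \<oplus> w) \<otimes> (\<xi> \<otimes> v) =
      (\<xi> \<otimes> v)\<star> \<otimes> z \<otimes> (\<xi> \<otimes> v) \<oplus> (\<xi> \<otimes> v)\<star> \<otimes> w \<otimes> (\<xi> \<otimes> v)"
      using c v(1) zc by (simp add: l_distr r_distr)
    ultimately show ?thesis by simp
  qed
  then show ?case using M um by (intro exI[of _ "insert (u, m) M"]) auto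
qed

text \<open>The isometry is a product \<open>\<xi> \<otimes> v\<close>. First \<open>\<xi>\<close>
  is chosen where \<open>y\<close> is large, then a generic \<open>v\<close> removes the
  compressions of \<open>Z\<close>. The second factor does no harm to \<open>y\<close>:
  \<open>\<xi>\<star> \<otimes> (y \<otimes> \<xi>)\<close> is already a scalar, and
  \<open>y \<otimes> \<xi>\<close> is a vector, whose norm an isometry on the right
  preserves.\<close>

lemma core_compression:
  assumes y: "y \<in> core P" "y\<star> = y" and Z: "finite Z" "Z \<subseteq> offdiag P"
  shows "\<exists>v\<in>carrier A. v\<star> \<otimes> v = \<one> \<and> \<parallel>y\<parallel> / 2 \<le> \<parallel>y \<otimes> v\<parallel> \<and> (\<exists>c. v\<star> \<otimes> y \<otimes> v = c \<odot> \<one>) \<and>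
    (\<forall>z\<in>Z. v\<star> \<otimes> z \<otimes> v = \<zero>)"
proof -
  obtain T0 where T0: "finite T0" "T0 \<subseteq> P" "y \<in> core T0" using sp_finite_levels[OF y(1)] by blast
  have "\<forall>z\<in>Z. \<exists>T. finite T \<and> T \<subseteq> P \<and> z \<in> offdiag T" using sp_finite_levels Z by blast
  then obtain \<tau> where \<tau>: "\<And>z. z \<in> Z \<Longrightarrow> finite (\<tau> z) \<and> \<tau> z \<subseteq> P \<and> z \<in> offdiag (\<tau> z)" by metis
  define T where "T = T0 \<union> (\<Union>z\<in>Z. \<tau> z)"
  have T: "finite T" "T \<subseteq> P" unfolding T_def using T0 Z \<tau> by auto
  have yT: "y \<in> core T" by (rule sp_mono[OF _ _ T0(3)]) (auto simp: T_def)
  have ZT: "z \<in> offdiag T" if "z \<in> Z" for z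
    by (rule sp_mono[of "\<tau> z" T "(\<noteq>)" "(\<noteq>)"]) (use \<tau> that in \<open>auto simp: T_def\<close>)
  obtain t where t: "t \<in> P" "\<And>s. s \<in> T \<Longrightarrow> s \<preceq> t" using G.below_upper_bound[OF T] by blast
  obtain \<xi> where \<xi>: "\<xi> \<in> H t" "\<xi>\<star> \<otimes> \<xi> = \<one>" "\<parallel>y\<parallel> / 2 \<le> \<parallel>y \<otimes> \<xi>\<parallel>"
    using core_norming_vector[OF T t yT y(2)] by blast
  have "\<forall>z\<in>Z. \<exists>M. finite M \<and> (\<forall>(u, m)\<in>M. u \<in> P \<and> u \<noteq> \<e> \<and> m \<in> H u) \<and>
    (\<forall>v\<in>carrier A. (\<forall>(u, m)\<in>M. m\<star> \<otimes> v = \<zero>) \<longrightarrow> (\<xi> \<otimes> v)\<star> \<otimes> z \<otimes> (\<xi> \<otimes> v) = \<zero>)"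
    using offdiag_kill[OF T(2) t \<xi>(1) ZT] by blast
  from bchoice[OF this] obtain \<mu> where \<mu>: "\<forall>z\<in>Z. finite (\<mu> z) \<and> (\<forall>(u, m)\<in>\<mu> z. u \<in> P \<and> u \<noteq> \<e> \<and> m \<in> H u) \<and>
    (\<forall>v\<in>carrier A. (\<forall>(u, m)\<in>\<mu> z. m\<star> \<otimes> v = \<zero>) \<longrightarrow> (\<xi> \<otimes> v)\<star> \<otimes> z \<otimes> (\<xi> \<otimes> v) = \<zero>)" ..
  define M where "M = (\<Union>z\<in>Z. \<mu> z)"
  have M1: "finite M" unfolding M_def by (rule finite_UN_I[OF Z(1)]) (use \<mu> in simp)
  have M2: "u \<in> P \<and> u \<noteq> \<e> \<and> m \<in> H u" if um: "(u, m) \<in> M" for u m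
  proof -
    obtain z where z: "z \<in> Z" "(u, m) \<in> \<mu> z" using um unfolding M_def by blast
    have "\<forall>(u, m)\<in>\<mu> z. u \<in> P \<and> u \<noteq> \<e> \<and> m \<in> H u" using bspec[OF \<mu> z(1)] by (elim conjE)
    from bspec[OF this z(2)] show ?thesis by simp
  qed
  note M = M1 M2
  have "fst ` M \<subseteq> P"
  proof
    fix u assume "u \<in> fst ` M"
    then obtain m where um: "(u, m) \<in> M" by force
    show "u \<in> P" using M2[OF um] by (rule conjunct1)
  qed
  then obtain r where r: "r \<in> P" "\<And>u. u \<in> fst ` M \<Longrightarrow> u \<preceq> r"
    using G.below_upper_bound[OF finite_imageI[OF M(1)]] by blast
  have "\<exists>v\<in>H r. v\<star> \<otimes> v = \<one> \<and> (\<forall>(u, m)\<in>M. m\<star> \<otimes> v = \<zero>)"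
  proof (rule generic_isometry[OF M(1) _ r(1)])
    fix u m assume "(u, m) \<in> M"
    moreover from this have "u \<in> fst ` M" by force
    ultimately show "u \<in> P \<and> u \<noteq> \<e> \<and> m \<in> H u \<and> u \<preceq> r" using M2[of u m] r(2)[of u] by blast
  qed
  then obtain v where v: "v \<in> H r" "v\<star> \<otimes> v = \<one>" "\<forall>(u, m)\<in>M. m\<star> \<otimes> v = \<zero>" by blast
  have c: "v \<in> carrier A" "\<xi> \<in> carrier A" "y \<in> carrier A" using v \<xi> r t sp_carrier[OF T(2) yT] by auto
  have yH: "y \<otimes> \<xi> \<in> H t" by (rule core_act[OF T(2) t \<xi>(1) yT])
  obtain k where k: "\<xi>\<star> \<otimes> (y \<otimes> \<xi>) = k \<odot> \<one>" using H_scalar[OF t(1) \<xi>(1) yH] by blast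
  show ?thesis
  proof (intro bexI[of _ "\<xi> \<otimes> v"] conjI exI[of _ k] ballI)
    show "(\<xi> \<otimes> v)\<star> \<otimes> (\<xi> \<otimes> v) = \<one>" using isometry_mult_left[OF c(2) \<xi>(2) c(1)] v by simp
    show "\<parallel>y\<parallel> / 2 \<le> \<parallel>y \<otimes> (\<xi> \<otimes> v)\<parallel>"
      using H_mult_isometry_norm[OF t(1) yH c(1) v(2)] \<xi>(3) c by (simp add: m_assoc)
    have "(\<xi> \<otimes> v)\<star> \<otimes> y \<otimes> (\<xi> \<otimes> v) = v\<star> \<otimes> (\<xi>\<star> \<otimes> (y \<otimes> \<xi>)) \<otimes> v"
      using c by (simp add: adj_mult m_assoc)
    then show "(\<xi> \<otimes> v)\<star> \<otimes> y \<otimes> (\<xi> \<otimes> v) = k \<odot> \<one>" unfolding k using c v by simp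
    show "(\<xi> \<otimes> v)\<star> \<otimes> z \<otimes> (\<xi> \<otimes> v) = \<zero>" if "z \<in> Z" for z
    proof -
      have "\<forall>v\<in>carrier A. (\<forall>(u, m)\<in>\<mu> z. m\<star> \<otimes> v = \<zero>) \<longrightarrow> (\<xi> \<otimes> v)\<star> \<otimes> z \<otimes> (\<xi> \<otimes> v) = \<zero>"
        using bspec[OF \<mu> that] by (elim conjE)
      moreover have "\<forall>(u, m)\<in>\<mu> z. m\<star> \<otimes> v = \<zero>" using v(3) that unfolding M_def by blast
      ultimately show ?thesis using c(1) by simp
    qed
  qed (use c in simp)
qed

end

context isometric_fibres begin

subsection \<open>Powers of a selfadjoint sum of homogeneous elements\<close>

abbreviation hom_part :: "'g \<Rightarrow> 'a set" where
  "hom_part g \<equiv> sp P (\<lambda>s t. s \<cdot> inv\<^sub>G t = g)"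

lemma hom_part_carrier: "x \<in> hom_part g \<Longrightarrow> x \<in> carrier A"
  by (rule sp_carrier[OF subset_refl])

lemma hom_part_mult:
  assumes "x \<in> hom_part g" "y \<in> hom_part h"
  shows "x \<otimes> y \<in> hom_part (g \<cdot> h)"
proof (rule sp_mult[OF subset_refl _ _ assms])
  fix s t s' t' assume *: "s \<in> P" "t \<in> P" "s' \<in> P" "t' \<in> P"
    "s \<cdot> inv\<^sub>G t = g" "s' \<cdot> inv\<^sub>G t' = h"
  show "s \<cdot> (inv\<^sub>G t \<cdot> s') \<in> P \<and> s \<cdot> (inv\<^sub>G t \<cdot> s') \<cdot> inv\<^sub>G t' = g \<cdot> h" if "t \<preceq> s'"
    using * that G.P_closed unfolding G.below_def by (auto simp: G.m_assoc)
  show "t' \<cdot> (inv\<^sub>G s' \<cdot> t) \<in> P \<and> s \<cdot> inv\<^sub>G (t' \<cdot> (inv\<^sub>G s' \<cdot> t)) = g \<cdot> h" if "s' \<preceq> t"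
    using * that G.P_closed unfolding G.below_def by (auto simp: G.m_assoc G.inv_mult_group)
qed

lemma hom_part_adj: "g \<in> carrier G \<Longrightarrow> x \<in> hom_part g \<Longrightarrow> x\<star> \<in> hom_part (inv\<^sub>G g)"
  by (erule sp_adj[OF subset_refl, rotated]) (auto simp: G.inv_mult_group)

lemma one_hom_part: "\<one> \<in> hom_part \<e>"
  using spI[of P "\<e>" "\<e>" "\<lambda>s t. s \<cdot> inv\<^sub>G t = \<e>" \<one> \<one>] H_one by simp

lemma hom_part_one_core: "x \<in> hom_part \<e> \<Longrightarrow> x \<in> core P"
  by (erule sp_mono[OF subset_refl, rotated]) (metis G.P_carrier G.inv_closed G.inv_equality G.inv_inv)

lemma hom_part_offdiag: "g \<noteq> \<e> \<Longrightarrow> x \<in> hom_part g \<Longrightarrow> x \<in> offdiag P"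
  by (erule sp_mono[OF subset_refl, rotated]) auto

text \<open>These isometries play the part of the unit vectors of \<open>\<ell>\<^sup>2(G)\<close>
  in a matrix algebra over \<open>A\<close>. They are an orthonormal system in one fibre of level
  different from \<open>\<e>\<close>; if there is no such level, \<open>G\<close> is trivial and
  \<open>D\<close> has at most one element.\<close>

lemma orthonormal_isometries:
  assumes "finite D" "D \<subseteq> carrier G"
  shows "\<exists>S. (\<forall>g\<in>D. S g \<in> carrier A) \<and> (\<forall>g\<in>D. \<forall>h\<in>D. (S g)\<star> \<otimes> S h = (if g = h then \<one> else \<zero>))"
proof (cases "P = {\<e>}")
  case True
  then have "carrier G = {\<e>}" using G.P_Un_inverse by auto
  then show ?thesis using assms by (intro exI[of _ "\<lambda>_. \<one>"]) auto
next
  case False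
  then obtain s where s: "s \<in> P" "s \<noteq> \<e>" using G.one_in_P by blast
  have "\<exists>S. (\<forall>g\<in>D. S g \<in> H s) \<and> (\<forall>g\<in>D. \<forall>h\<in>D. (S g)\<star> \<otimes> S h = (if g = h then \<one> else \<zero>))"
    using assms
  proof (induction D)
    case (insert g D)
    then obtain S where S: "\<forall>g\<in>D. S g \<in> H s" "\<forall>g\<in>D. \<forall>h\<in>D. (S g)\<star> \<otimes> S h = (if g = h then \<one> else \<zero>)" by auto
    obtain x where x: "x \<in> H s" "x\<star> \<otimes> x = \<one>" "\<forall>m\<in>S ` D. m\<star> \<otimes> x = \<zero>"
      using H_infinite[OF s, of "S ` D"] insert S by auto
    have "x\<star> \<otimes> m = \<zero>" if "m \<in> S ` D" for m
    proof -
      have m: "m \<in> carrier A" "x \<in> carrier A" using S that s x by auto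
      then have "x\<star> \<otimes> m = (m\<star> \<otimes> x)\<star>" by (simp add: adj_mult)
      then show ?thesis using x that by simp
    qed
    then show ?case using S x insert by (intro exI[of _ "S(g := x)"]) auto
  qed auto
  then show ?thesis using s by blast
qed

end

text \<open>The decomposition into homogeneous parts is data, since it is not shown to be determined
  by the sum. \<open>\<beta>\<close> extends by zero beyond \<open>F\<close> so that every matrix
  entry \<open>\<beta> (h \<cdot> inv\<^sub>G g)\<close> makes sense. \<open>F\<close> is symmetric
  and contains \<open>\<e>\<close> to suit \<open>almost_invariant_vector\<close>.\<close>

locale selfadjoint_family = isometric_fibres A G P H
  for A :: "'a cstar" (structure) and G :: "('g, 'm) monoid_scheme" and P H +
  fixes F :: "'g set" and \<beta> :: "'g \<Rightarrow> 'a"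
  assumes F: "finite F" "F \<subseteq> carrier G" "\<And>f. f \<in> F \<Longrightarrow> inv\<^sub>G f \<in> F" "\<e> \<in> F"
    and \<beta>_hom: "\<And>g. g \<in> carrier G \<Longrightarrow> \<beta> g \<in> hom_part g"
    and \<beta>_adj: "\<And>g. g \<in> carrier G \<Longrightarrow> \<beta> (inv\<^sub>G g) = (\<beta> g)\<star>"
    and \<beta>_outside: "\<And>g. g \<in> carrier G \<Longrightarrow> g \<notin> F \<Longrightarrow> \<beta> g = \<zero>"
begin

definition b :: 'a where "b = (\<Oplus>f\<in>F. \<beta> f)"

lemma \<beta>_carrier [simp]: "g \<in> carrier G \<Longrightarrow> \<beta> g \<in> carrier A" using \<beta>_hom hom_part_carrier by blast

lemma F_carrier [simp]: "f \<in> F \<Longrightarrow> f \<in> carrier G" using F by auto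

lemma b_carrier [simp]: "b \<in> carrier A" unfolding b_def by (rule finsum_closed) auto

definition words :: "nat \<Rightarrow> 'g list set" where "words n = {w. set w \<subseteq> F \<and> length w = n}"

primrec wprod :: "'g list \<Rightarrow> 'g" where
  "wprod [] = \<e>" | "wprod (f # w) = f \<cdot> wprod w"

primrec wcoeff :: "'g list \<Rightarrow> 'a" where
  "wcoeff [] = \<one>" | "wcoeff (f # w) = \<beta> f \<otimes> wcoeff w"

lemma finite_words [simp]: "finite (words n)"
  unfolding words_def by (rule finite_lists_length_eq[OF F(1)])

lemma words_0: "words 0 = {[]}" unfolding words_def by auto

lemma words_Suc: "words (Suc n) = (\<Union>w\<in>words n. (\<lambda>f. f # w) ` F)"
  unfolding words_def by (auto simp: length_Suc_conv image_iff)

lemma wprod_carrier [simp]: "set w \<subseteq> F \<Longrightarrow> wprod w \<in> carrier G" by (induction w) auto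

lemma wcoeff_hom: "set w \<subseteq> F \<Longrightarrow> wcoeff w \<in> hom_part (wprod w)"
proof (induction w)
  case (Cons f w)
  then show ?case using hom_part_mult[OF \<beta>_hom[of f], of "wcoeff w" "wprod w"] by simp
qed (simp add: one_hom_part)

lemma wcoeff_carrier [simp]: "set w \<subseteq> F \<Longrightarrow> wcoeff w \<in> carrier A"
  using wcoeff_hom hom_part_carrier by blast

lemma words_set: "w \<in> words n \<Longrightarrow> set w \<subseteq> F" unfolding words_def by auto

lemma words_wcoeff [simp]: "w \<in> words n \<Longrightarrow> wcoeff w \<in> carrier A"
  by (rule wcoeff_carrier[OF words_set])

lemma sum_words_Suc:
  assumes "\<And>w. w \<in> words (Suc n) \<Longrightarrow> h w \<in> carrier A"
  shows "(\<Oplus>w\<in>words (Suc n). h w) = (\<Oplus>w\<in>words n. \<Oplus>f\<in>F. h (f # w))"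
proof -
  have hc: "h (f # w) \<in> carrier A" if "w \<in> words n" "f \<in> F" for f w
    by (rule assms) (use that in \<open>auto simp: words_def\<close>)
  have "(\<Oplus>w\<in>words (Suc n). h w) = (\<Oplus>w\<in>words n. \<Oplus>v\<in>(\<lambda>f. f # w) ` F. h v)"
    unfolding words_Suc
    by (rule add.finprod_UN_disjoint) (auto simp: pairwise_def disjnt_def hc F(1))
  also have "\<dots> = (\<Oplus>w\<in>words n. \<Oplus>f\<in>F. h (f # w))"
  proof (rule finsum_cong'[OF refl])
    show "(\<lambda>w. \<Oplus>f\<in>F. h (f # w)) \<in> words n \<rightarrow> carrier A"
      by (auto intro!: finsum_closed hc)
    show "(\<Oplus>v\<in>(\<lambda>f. f # w) ` F. h v) = (\<Oplus>f\<in>F. h (f # w))" if "w \<in> words n" for w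
      using hc[OF that] by (subst finsum_reindex) (auto simp: inj_on_def)
  qed
  finally show ?thesis .
qed

lemma b_power: "b [^] n = (\<Oplus>w\<in>words n. wcoeff w)"
proof (induction n)
  case 0
  show ?case by (simp add: words_0 finsum_insert)
next
  case (Suc n)
  have "b [^] Suc n = b \<otimes> (\<Oplus>w\<in>words n. wcoeff w)" using Suc by (simp only: power_Suc2[OF b_carrier])
  also have "\<dots> = (\<Oplus>w\<in>words n. b \<otimes> wcoeff w)"
    by (rule finsum_rdistr) (auto dest: words_set)
  also have "\<dots> = (\<Oplus>w\<in>words n. \<Oplus>f\<in>F. wcoeff (f # w))"
  proof (rule finsum_cong'[OF refl])
    show "(\<lambda>w. \<Oplus>f\<in>F. wcoeff (f # w)) \<in> words n \<rightarrow> carrier A"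
      by (auto intro!: finsum_closed dest!: words_set)
    show "b \<otimes> wcoeff w = (\<Oplus>f\<in>F. wcoeff (f # w))" if "w \<in> words n" for w
      unfolding b_def using words_set[OF that] by (subst finsum_ldistr) (auto simp: F(1))
  qed
  also have "\<dots> = (\<Oplus>w\<in>words (Suc n). wcoeff w)"
    by (rule sum_words_Suc[symmetric]) (auto dest: words_set)
  finally show ?case .
qed

text \<open>This is \<open>\<Phi>(b\<^sup>n)\<close>, taken from the expansion of
  \<open>b [^] n\<close> into words and not from the element \<open>b [^] n\<close> itself.\<close>

definition diag :: "nat \<Rightarrow> 'a" where "diag n = (\<Oplus>w\<in>{w \<in> words n. wprod w = \<e>}. wcoeff w)"
definition off :: "nat \<Rightarrow> 'a" where "off n = (\<Oplus>w\<in>{w \<in> words n. wprod w \<noteq> \<e>}. wcoeff w)"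

lemma diag_core: "diag n \<in> core P"
  unfolding diag_def sp_def
proof (rule addspan_finsum[OF gens_carrier[OF subset_refl]])
  fix w assume "w \<in> {w \<in> words n. wprod w = \<e>}"
  then show "wcoeff w \<in> addspan (gens P (=))"
    using hom_part_one_core[of "wcoeff w"] wcoeff_hom[OF words_set, of w n] by (simp add: sp_def)
qed simp

lemma off_offdiag: "off n \<in> offdiag P"
  unfolding off_def sp_def
proof (rule addspan_finsum[OF gens_carrier[OF subset_refl]])
  fix w assume "w \<in> {w \<in> words n. wprod w \<noteq> \<e>}"
  then show "wcoeff w \<in> addspan (gens P (\<noteq>))"
    using hom_part_offdiag[of "wprod w" "wcoeff w"] wcoeff_hom[OF words_set, of w n] by (simp add: sp_def)
qed simp

lemma diag_carrier [simp]: "diag n \<in> carrier A" by (rule sp_carrier[OF subset_refl diag_core])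
lemma off_carrier [simp]: "off n \<in> carrier A" by (rule sp_carrier[OF subset_refl off_offdiag])

lemma b_power_split: "b [^] n = diag n \<oplus> off n"
proof -
  have "words n = {w \<in> words n. wprod w = \<e>} \<union> {w \<in> words n. wprod w \<noteq> \<e>}" by auto
  then have "b [^] n = (\<Oplus>w\<in>{w \<in> words n. wprod w = \<e>} \<union> {w \<in> words n. wprod w \<noteq> \<e>}. wcoeff w)"
    using b_power by simp
  also have "\<dots> = diag n \<oplus> off n"
    unfolding diag_def off_def by (rule finsum_Un_disjoint) (auto dest!: words_set)
  finally show ?thesis .
qed

lemma b_selfadj: "b\<star> = b"
proof -
  have "b\<star> = (\<Oplus>f\<in>F. \<beta> (inv\<^sub>G f))"
    unfolding b_def using F \<beta>_adj by (subst adj_finsum) (auto intro!: finsum_cong')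
  also have "\<dots> = (\<Oplus>f\<in>(\<lambda>f. inv\<^sub>G f) ` F. \<beta> f)"
    by (rule finsum_reindex[symmetric]) (auto simp: inj_on_def F(3) dest!: G.inv_inj[THEN inj_onD])
  also have "(\<lambda>f. inv\<^sub>G f) ` F = F"
  proof
    show "F \<subseteq> (\<lambda>f. inv\<^sub>G f) ` F" using F by (metis (no_types, lifting) F_carrier G.inv_inv image_eqI subsetI)
  qed (use F in auto)
  finally show ?thesis unfolding b_def .
qed

text \<open>\<open>M\<close> is a finite section of the matrix \<open>(\<beta>(g h\<^sup>-\<^sup>1))\<close>, realised inside \<open>A\<close> by means of isometries with
  orthogonal ranges; the section is large enough for its first \<open>N\<close> powers to act on \<open>S k\<close> like those of the
  full matrix.\<close>

lemma walk_operator: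
  assumes X: "finite X" "X \<subseteq> carrier G" and N: "1 \<le> N"
  shows "\<exists>M S D. M \<in> carrier A \<and> M\<star> = M \<and> X \<subseteq> D \<and> D \<subseteq> carrier G \<and> (\<forall>k\<in>D. S k \<in> carrier A) \<and>
    (\<forall>g\<in>D. \<forall>h\<in>D. (S g)\<star> \<otimes> S h = (if g = h then \<one> else \<zero>)) \<and>
    (\<forall>k\<in>X. \<forall>f\<in>F. f \<cdot> k \<in> D) \<and>
    (\<forall>k\<in>X. M \<otimes> S k = (\<Oplus>f\<in>F. S (f \<cdot> k) \<otimes> \<beta> f)) \<and>
    (\<forall>k\<in>X. \<forall>n\<le>N. (S k)\<star> \<otimes> (M [^] n \<otimes> S k) = diag n)"
proof -
  \<comment> \<open>Starting in \<open>X\<close>, fewer than \<open>N + 1\<close> steps never leave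
    \<open>D\<close>, so truncation to \<open>D\<close> is invisible to the first \<open>N\<close>
    powers of \<open>M\<close>.\<close>
  define D where "D = (\<lambda>(w, k). wprod w \<cdot> k) ` ((\<Union>n\<le>N. words n) \<times> X)"
  have D: "finite D" "D \<subseteq> carrier G" unfolding D_def using X by (auto dest!: words_set)
  have inD: "wprod w \<cdot> k \<in> D" if "w \<in> words n" "n \<le> N" "k \<in> X" for w n k
    unfolding D_def using that by force
  have XD: "k \<in> D" if "k \<in> X" for k using inD[of "[]" 0 k] that X by (auto simp: words_0)
  have FD: "f \<cdot> k \<in> D" if "f \<in> F" "k \<in> X" for f k
    using inD[of "[f]" 1 k] that X N by (auto simp: words_def)
  obtain S where S: "\<And>g. g \<in> D \<Longrightarrow> S g \<in> carrier A"
    "\<And>g h. g \<in> D \<Longrightarrow> h \<in> D \<Longrightarrow> (S g)\<star> \<otimes> S h = (if g = h then \<one> else \<zero>)"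
    using orthonormal_isometries[OF D] by blast
  define m where "m = (\<lambda>(h, g). S h \<otimes> \<beta> (h \<cdot> inv\<^sub>G g) \<otimes> (S g)\<star>)"
  define M where "M = (\<Oplus>p\<in>D \<times> D. m p)"
  have mc: "m p \<in> carrier A" if "p \<in> D \<times> D" for p
    using that S(1) D unfolding m_def by (auto simp: subset_iff)
  have Mc: "M \<in> carrier A" unfolding M_def using mc by (auto intro!: finsum_closed)
  have Msa: "M\<star> = M"
  proof -
    have "M\<star> = (\<Oplus>p\<in>D \<times> D. m (prod.swap p))"
      unfolding M_def
    proof (subst adj_finsum)
      show "(\<Oplus>p\<in>D \<times> D. (m p)\<star>) = (\<Oplus>p\<in>D \<times> D. m (prod.swap p))"
      proof (rule finsum_cong'[OF refl])
        fix p assume "p \<in> D \<times> D"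
        then obtain h g where p: "p = (h, g)" "h \<in> D" "g \<in> D" by auto
        then have c: "h \<in> carrier G" "g \<in> carrier G" using D by auto
        then have "(\<beta> (h \<cdot> inv\<^sub>G g))\<star> = \<beta> (g \<cdot> inv\<^sub>G h)"
          using \<beta>_adj[of "h \<cdot> inv\<^sub>G g"] by (simp add: G.inv_mult_group)
        then show "(m p)\<star> = m (prod.swap p)" unfolding p(1) m_def using S(1) p c
          by (simp add: adj_mult m_assoc)
      qed (use mc in auto)
    qed (use D mc in auto)
    also have "\<dots> = (\<Oplus>p\<in>prod.swap ` (D \<times> D). m p)"
      by (rule finsum_reindex[symmetric]) (use mc in \<open>auto simp: inj_on_def\<close>)
    also have "prod.swap ` (D \<times> D) = D \<times> D" by force
    finally show ?thesis unfolding M_def .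
  qed
  have MS: "M \<otimes> S k = (\<Oplus>f\<in>F. S (f \<cdot> k) \<otimes> \<beta> f)" if k: "k \<in> D" and Fk: "\<And>f. f \<in> F \<Longrightarrow> f \<cdot> k \<in> D" for k
  proof -
    have kc: "k \<in> carrier G" and Sk: "S k \<in> carrier A" using k D S by auto
    have mS: "m (h, g) \<otimes> S k = (if g = k then S h \<otimes> \<beta> (h \<cdot> inv\<^sub>G k) else \<zero>)" if hg: "h \<in> D" "g \<in> D" for h g
    proof -
      have c: "h \<in> carrier G" "g \<in> carrier G" using hg D by auto
      have "m (h, g) \<otimes> S k = S h \<otimes> \<beta> (h \<cdot> inv\<^sub>G g) \<otimes> ((S g)\<star> \<otimes> S k)"
        unfolding m_def using c hg S(1) Sk by (simp add: m_assoc)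
      then show ?thesis using S(2)[OF hg(2) k] S(1) hg c by auto
    qed
    have "M \<otimes> S k = (\<Oplus>p\<in>D \<times> D. m p \<otimes> S k)"
      unfolding M_def by (rule finsum_ldistr) (use D Sk mc in auto)
    \<comment> \<open>Column \<open>k\<close> of the matrix is nonzero only in rows \<open>h\<close>
      with \<open>h \<cdot> inv\<^sub>G k \<in> F\<close>, because \<open>\<beta>\<close> vanishes
      elsewhere.\<close>
    also have "\<dots> = (\<Oplus>p\<in>(\<lambda>f. (f \<cdot> k, k)) ` F. m p \<otimes> S k)"
    proof (rule add.finprod_mono_neutral_cong_right)
      fix p assume p: "p \<in> D \<times> D - (\<lambda>f. (f \<cdot> k, k)) ` F"
      then obtain h g where hg: "p = (h, g)" "h \<in> D" "g \<in> D" by auto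
      have hc: "h \<in> carrier G" using hg D by auto
      have "\<beta> (h \<cdot> inv\<^sub>G k) = \<zero>" if "g = k"
      proof (rule \<beta>_outside)
        show "h \<cdot> inv\<^sub>G k \<notin> F"
        proof
          assume "h \<cdot> inv\<^sub>G k \<in> F"
          moreover have "h = h \<cdot> inv\<^sub>G k \<cdot> k" using hc kc by (simp add: G.m_assoc)
          ultimately show False using p hg that by blast
        qed
      qed (use hc kc in auto)
      then show "m p \<otimes> S k = \<zero>" unfolding hg(1) mS[OF hg(2,3)] using S(1) hg by simp
    qed (use D k Fk mc Sk in auto)
    also have "\<dots> = (\<Oplus>f\<in>F. m (f \<cdot> k, k) \<otimes> S k)"
      by (rule finsum_reindex) (use Fk k kc mc Sk in \<open>auto simp: inj_on_def\<close>)
    also have "\<dots> = (\<Oplus>f\<in>F. S (f \<cdot> k) \<otimes> \<beta> f)"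
      by (rule finsum_cong'[OF refl]) (use Fk k kc S(1) in \<open>auto simp: mS G.m_assoc\<close>)
    finally show ?thesis .
  qed
  \<comment> \<open>Each application of \<open>M\<close> prepends a letter to the word.
    \<open>MS\<close> needs all neighbours of the current point in \<open>D\<close>, which holds for
    words shorter than \<open>N\<close>.\<close>
  have pow: "M [^] n \<otimes> S k = (\<Oplus>w\<in>words n. S (wprod w \<cdot> k) \<otimes> wcoeff w)" if k: "k \<in> X" and "n \<le> N" for n k
    using that(2)
  proof (induction n)
    case 0
    have "k \<in> carrier G" "S k \<in> carrier A" using k X XD S by auto
    then show ?case by (simp add: words_0 finsum_insert)
  next
    case (Suc n)
    have kc: "k \<in> carrier G" and Sk: "S k \<in> carrier A" using k X XD S by auto
    have Sw: "S (wprod w \<cdot> k) \<in> carrier A" if "w \<in> words i" "i \<le> Suc n" for w i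
      using S(1) inD[OF that(1) _ k] that Suc.prems by auto
    have "M [^] Suc n \<otimes> S k = M \<otimes> (M [^] n \<otimes> S k)"
      using Mc Sk by (simp only: power_Suc2) (simp add: m_assoc)
    also have "\<dots> = M \<otimes> (\<Oplus>w\<in>words n. S (wprod w \<cdot> k) \<otimes> wcoeff w)" using Suc by simp
    also have "\<dots> = (\<Oplus>w\<in>words n. M \<otimes> (S (wprod w \<cdot> k) \<otimes> wcoeff w))"
      by (rule finsum_rdistr) (use Mc Sw in \<open>auto dest: words_set\<close>)
    also have "\<dots> = (\<Oplus>w\<in>words n. \<Oplus>f\<in>F. S (wprod (f # w) \<cdot> k) \<otimes> wcoeff (f # w))"
    proof (rule finsum_cong'[OF refl])
      have "S (wprod (f # w) \<cdot> k) \<otimes> wcoeff (f # w) \<in> carrier A" if "w \<in> words n" "f \<in> F" for w f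
        by (rule m_closed[OF Sw[of _ "Suc n"] wcoeff_carrier]) (use that in \<open>auto simp: words_def\<close>)
      then show "(\<lambda>w. \<Oplus>f\<in>F. S (wprod (f # w) \<cdot> k) \<otimes> wcoeff (f # w)) \<in> words n \<rightarrow> carrier A"
        by (auto intro!: finsum_closed simp del: wprod.simps wcoeff.simps)
      fix w assume w: "w \<in> words n"
      have ww: "set w \<subseteq> F" using words_set[OF w] .
      have wk: "wprod w \<cdot> k \<in> D" using inD[OF w _ k] Suc.prems by simp
      have fwk: "f \<cdot> (wprod w \<cdot> k) \<in> D" if f: "f \<in> F" for f
        using inD[of "f # w" "Suc n" k] Suc.prems k kc ww w f by (auto simp: words_def G.m_assoc)
      have "M \<otimes> (S (wprod w \<cdot> k) \<otimes> wcoeff w) = M \<otimes> S (wprod w \<cdot> k) \<otimes> wcoeff w"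
        using Mc S(1)[OF wk] ww by (simp add: m_assoc)
      also have "\<dots> = (\<Oplus>f\<in>F. S (f \<cdot> (wprod w \<cdot> k)) \<otimes> \<beta> f) \<otimes> wcoeff w"
        by (simp only: MS[OF wk fwk])
      also have "\<dots> = (\<Oplus>f\<in>F. S (f \<cdot> (wprod w \<cdot> k)) \<otimes> \<beta> f \<otimes> wcoeff w)"
        by (rule finsum_ldistr) (use F(1) S(1) fwk ww in auto)
      also have "\<dots> = (\<Oplus>f\<in>F. S (wprod (f # w) \<cdot> k) \<otimes> wcoeff (f # w))"
        by (rule finsum_cong'[OF refl]) (use S(1) fwk ww kc in \<open>auto simp: m_assoc G.m_assoc\<close>)
      finally show "M \<otimes> (S (wprod w \<cdot> k) \<otimes> wcoeff w) = (\<Oplus>f\<in>F. S (wprod (f # w) \<cdot> k) \<otimes> wcoeff (f # w))" .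
    qed
    also have "\<dots> = (\<Oplus>w\<in>words (Suc n). S (wprod w \<cdot> k) \<otimes> wcoeff w)"
      by (rule sum_words_Suc[symmetric, where h = "\<lambda>w. S (wprod w \<cdot> k) \<otimes> wcoeff w"])
         (intro m_closed Sw wcoeff_carrier, auto dest: words_set)
    finally show ?case .
  qed
  have "(S k)\<star> \<otimes> (M [^] n \<otimes> S k) = diag n" if k: "k \<in> X" and n: "n \<le> N" for k n
  proof -
    have kc: "k \<in> carrier G" and Sk: "S k \<in> carrier A" using k X XD S by auto
    have Sw: "S (wprod w \<cdot> k) \<in> carrier A" if "w \<in> words n" for w
      using S(1) inD[OF that n k] by auto
    have t: "(S k)\<star> \<otimes> (S (wprod w \<cdot> k) \<otimes> wcoeff w) = (if wprod w = \<e> then wcoeff w else \<zero>)" if w: "w \<in> words n" for w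
    proof -
      have "(S k)\<star> \<otimes> (S (wprod w \<cdot> k) \<otimes> wcoeff w) = (S k)\<star> \<otimes> S (wprod w \<cdot> k) \<otimes> wcoeff w"
        using Sk Sw[OF w] words_set[OF w] by (simp add: m_assoc)
      \<comment> \<open>Orthogonality of the ranges keeps exactly the words with trivial product.
        This is how a diagonal entry of the matrix power becomes \<open>diag n\<close>.\<close>
      moreover have "k = wprod w \<cdot> k \<longleftrightarrow> wprod w = \<e>"
        using kc words_set[OF w] by (metis G.l_one G.right_cancel G.one_closed wprod_carrier)
      ultimately show ?thesis using S(2)[OF XD[OF k] inD[OF w n k]] words_set[OF w] by auto
    qed
    have "(S k)\<star> \<otimes> (M [^] n \<otimes> S k) = (\<Oplus>w\<in>words n. (S k)\<star> \<otimes> (S (wprod w \<cdot> k) \<otimes> wcoeff w))"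
      unfolding pow[OF k n] by (rule finsum_rdistr) (use Sk Sw in auto)
    also have "\<dots> = diag n"
      unfolding diag_def
    proof (rule add.finprod_mono_neutral_cong_right)
      show "(S k)\<star> \<otimes> (S (wprod w \<cdot> k) \<otimes> wcoeff w) = \<zero>"
        if "w \<in> words n - {w \<in> words n. wprod w = \<e>}" for w
        using t[of w] that by simp
      show "(S k)\<star> \<otimes> (S (wprod w \<cdot> k) \<otimes> wcoeff w) = wcoeff w"
        if "w \<in> {w \<in> words n. wprod w = \<e>}" for w
        using t[of w] that by simp
    qed (use Sk Sw in auto)
    finally show ?thesis .
  qed
  then show ?thesis using Mc Msa XD D(2) S FD MS by (intro exI[of _ M] exI[of _ S] exI[of _ D]) auto
qed

end

section \<open>The norm of \<open>b\<close> against the norms of its diagonal parts\<close>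

context selfadjoint_family begin

lemma power_star_power:
  assumes "M \<in> carrier A" "M\<star> = M" "x \<in> carrier A"
  shows "(M [^] j \<otimes> x)\<star> \<otimes> (M [^] j \<otimes> x) = x\<star> \<otimes> (M [^] (2 * j :: nat) \<otimes> x)"
proof -
  have "(M [^] j \<otimes> x)\<star> \<otimes> (M [^] j \<otimes> x) = x\<star> \<otimes> ((M [^] j \<otimes> M [^] j) \<otimes> x)"
    using assms by (simp add: adj_mult power_selfadj m_assoc)
  then show ?thesis using assms by (simp add: nat_pow_mult mult_2)
qed

lemma diag_0: "diag 0 = \<one>"
proof -
  have "{w \<in> words 0. wprod w = \<e>} = {[]}" by (auto simp: words_0)
  then show ?thesis unfolding diag_def by (simp add: finsum_insert)
qed

text \<open>Positivity of the even diagonal parts. With no positive map \<open>\<Phi>\<close> at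
  hand it comes from the matrix picture, where \<open>diag (2 * j)\<close> is a diagonal entry of
  the square of the self-adjoint \<open>M [^] j\<close>.\<close>

lemma diag_even_square: "\<exists>Y\<in>carrier A. diag (2 * j) = Y\<star> \<otimes> Y"
proof -
  \<comment> \<open>The bound \<open>2 * j + 1\<close> is used because \<open>walk_operator\<close>
    asks for \<open>1 \<le> N\<close> and \<open>j\<close> may be \<open>0\<close>.\<close>
  obtain M S D where M: "M \<in> carrier A" "M\<star> = M" "\<e> \<in> D" "\<forall>k\<in>D. S k \<in> carrier A"
    "\<forall>k\<in>{\<e>}. \<forall>n\<le>2 * j + 1. (S k)\<star> \<otimes> (M [^] n \<otimes> S k) = diag n"
    using walk_operator[of "{\<e>}" "2 * j + 1"] by auto
  then show ?thesis
    using power_star_power[of M "S \<e>" j] by (intro bexI[of _ "M [^] j \<otimes> S \<e>"]) auto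
qed

text \<open>Each squaring uses \<open>\<parallel>V\<star> \<otimes> (M [^] n \<otimes>
  V)\<parallel>\<^sup>2 \<le> \<parallel>M [^] n \<otimes> V\<parallel>\<^sup>2 =
  \<parallel>V\<star> \<otimes> (M [^] (2 * n) \<otimes> V)\<parallel>\<close>, the Cauchy-Schwarz
  inequality for a compression followed by the C*-identity.\<close>

lemma compress_power_bound:
  assumes M: "M \<in> carrier A" "M\<star> = M" and V: "V \<in> carrier A" "V\<star> \<otimes> V = \<one>"
  shows "\<parallel>V\<star> \<otimes> (M \<otimes> V)\<parallel> ^ 2 ^ k \<le> \<parallel>V\<star> \<otimes> (M [^] (2 ^ k :: nat) \<otimes> V)\<parallel>"
proof (induction k)
  case (Suc k)
  have c: "M [^] (2 ^ k :: nat) \<otimes> V \<in> carrier A" using M V by simp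
  have "\<parallel>V\<star> \<otimes> (M \<otimes> V)\<parallel> ^ 2 ^ Suc k = (\<parallel>V\<star> \<otimes> (M \<otimes> V)\<parallel> ^ 2 ^ k)\<^sup>2"
    by (simp add: power_mult[symmetric] mult.commute)
  also have "\<dots> \<le> \<parallel>V\<star> \<otimes> (M [^] (2 ^ k :: nat) \<otimes> V)\<parallel>\<^sup>2"
    using Suc M V by (intro power_mono) (auto simp: cnorm_nonneg)
  also have "\<dots> \<le> \<parallel>M [^] (2 ^ k :: nat) \<otimes> V\<parallel>\<^sup>2"
  proof (rule power_mono)
    have "\<parallel>V\<star>\<parallel> \<le> 1" using isometry_cnorm_le[OF V] V by simp
    then show "\<parallel>V\<star> \<otimes> (M [^] (2 ^ k :: nat) \<otimes> V)\<parallel> \<le> \<parallel>M [^] (2 ^ k :: nat) \<otimes> V\<parallel>"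
      using cnorm_mult_le[of "V\<star>" _ 1 "\<parallel>M [^] (2 ^ k :: nat) \<otimes> V\<parallel>", OF _ c] V by simp
  qed (use c V in \<open>simp add: cnorm_nonneg\<close>)
  also have "\<dots> = \<parallel>V\<star> \<otimes> (M [^] (2 ^ Suc k :: nat) \<otimes> V)\<parallel>"
    using cstar_identity[OF c] power_star_power[OF M V(1), of "2 ^ k"] by simp
  finally show ?case .
qed (use M in simp)

text \<open>A normalised almost invariant vector \<open>\<xi>\<close> turns \<open>M\<close> into an approximation of \<open>b\<close>, while
  \<open>\<parallel>M\<^sup>j S k\<parallel>\<^sup>2 = \<parallel>diag (2 j)\<parallel>\<close> for every \<open>k\<close> in the support of \<open>\<xi>\<close>.\<close>

lemma norm_power_le_diag:
  shows "\<exists>C. \<forall>k\<ge>1. (3 / 4 * \<parallel>b\<parallel>) ^ 2 ^ k \<le> C * \<parallel>diag (2 ^ k)\<parallel>"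
proof (cases "\<parallel>b\<parallel> = 0")
  case True
  then show ?thesis by (intro exI[of _ 0]) (simp add: power_0_left)
next
  case False
  then have b0: "0 < \<parallel>b\<parallel>" using cnorm_nonneg[of b] by simp
  define B where "B = (\<Sum>f\<in>F. \<parallel>\<beta> f\<parallel>)"
  have B0: "0 \<le> B" unfolding B_def by (intro sum_nonneg cnorm_nonneg) auto
  \<comment> \<open>An error \<open>e\<close> in every coefficient moves \<open>b\<close> by at most
    \<open>e * B \<le> \<parallel>b\<parallel> / 4\<close>, which leaves the \<open>3 / 4\<close> of
    the statement. The summand \<open>1\<close> spares a proof that \<open>B\<close> is
    positive.\<close>
  define e where "e = \<parallel>b\<parallel> / (4 * (B + 1))"
  have e0: "0 < e" unfolding e_def using b0 B0 by simp
  have eB: "e * B \<le> \<parallel>b\<parallel> / 4" unfolding e_def using b0 B0 by (simp add: field_simps)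
  have "countable (carrier G)"
    unfolding G.P_Un_inverse[symmetric] using G.P_countable by simp
  then have "\<exists>X \<xi>. finite X \<and> X \<subseteq> carrier G \<and> (\<forall>x\<in>carrier G - X. \<xi> x = 0) \<and>
      (\<Sum>x\<in>X. (\<xi> x)\<^sup>2) = (1::real) \<and> (\<forall>f\<in>F. \<bar>(\<Sum>x\<in>X. \<xi> x * \<xi> (f \<cdot> x)) - 1\<bar> \<le> e)"
    by (rule G.almost_invariant_vector[OF G.amenable _ F(1,2) _ F(4) e0]) (rule F(3))
  then obtain X \<xi> where X: "finite X" "X \<subseteq> carrier G"
    and \<xi>0: "\<forall>x\<in>carrier G - X. \<xi> x = (0::real)" and \<xi>1: "(\<Sum>x\<in>X. (\<xi> x)\<^sup>2) = 1"
    and \<xi>e: "\<forall>f\<in>F. \<bar>(\<Sum>x\<in>X. \<xi> x * \<xi> (f \<cdot> x)) - 1\<bar> \<le> e"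
    by (elim exE conjE) (rule that)
  \<comment> \<open>The square of the \<open>\<ell>\<^sup>1\<close> norm of \<open>\<xi>\<close>,
    from the triangle inequality for \<open>M [^] j \<otimes> V\<close>. \<open>X\<close> and
    \<open>\<xi>\<close> are fixed before \<open>k\<close>, so \<open>C\<close> does not depend on
    \<open>k\<close>, although \<open>M\<close>, \<open>S\<close> and \<open>D\<close> do.\<close>
  define C where "C = (\<Sum>x\<in>X. \<bar>\<xi> x\<bar>)\<^sup>2"
  have "(3 / 4 * \<parallel>b\<parallel>) ^ 2 ^ k \<le> C * \<parallel>diag (2 ^ k)\<parallel>" if k: "1 \<le> k" for k
  proof -
    have N: "1 \<le> (2::nat) ^ k" by simp
    obtain M S D where M: "M \<in> carrier A" "M\<star> = M" and D: "X \<subseteq> D" "D \<subseteq> carrier G"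
      and S1: "\<forall>g\<in>D. S g \<in> carrier A"
      and S2: "\<forall>g\<in>D. \<forall>h\<in>D. (S g)\<star> \<otimes> S h = (if g = h then \<one> else \<zero>)"
      and FD0: "\<forall>g\<in>X. \<forall>f\<in>F. f \<cdot> g \<in> D"
      and MS0: "\<forall>g\<in>X. M \<otimes> S g = (\<Oplus>f\<in>F. S (f \<cdot> g) \<otimes> \<beta> f)"
      and dg0: "\<forall>g\<in>X. \<forall>n\<le>2 ^ k. (S g)\<star> \<otimes> (M [^] n \<otimes> S g) = diag n"
      using walk_operator[OF X N] by (elim exE conjE) (rule that)
    note S = bspec[OF S1] bspec[OF bspec[OF S2]]
    note FD = bspec[OF bspec[OF FD0]]
    note MS = bspec[OF MS0]
    have dg: "(S g)\<star> \<otimes> (M [^] n \<otimes> S g) = diag n" if "g \<in> X" "n \<le> 2 ^ k" for g and n :: nat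
      using dg0 that by simp
    have SX: "S g \<in> carrier A" if "g \<in> X" for g using S(1) D that by auto
    define V where "V = (\<Oplus>g\<in>X. of_real (\<xi> g) \<odot> S g)"
    have Vc: "V \<in> carrier A" unfolding V_def using SX by (auto intro!: finsum_closed)
    have Vstar: "V\<star> \<otimes> x = (\<Oplus>g\<in>X. of_real (\<xi> g) \<odot> ((S g)\<star> \<otimes> x))" if x: "x \<in> carrier A" for x
    proof -
      have "V\<star> = (\<Oplus>g\<in>X. of_real (\<xi> g) \<odot> (S g)\<star>)"
        unfolding V_def using SX X by (subst adj_finsum) (auto simp: adj_smult intro!: finsum_cong')
      then have "V\<star> \<otimes> x = (\<Oplus>g\<in>X. (of_real (\<xi> g) \<odot> (S g)\<star>) \<otimes> x)"
        using SX X x by (simp add: finsum_ldistr)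
      also have "\<dots> = (\<Oplus>g\<in>X. of_real (\<xi> g) \<odot> ((S g)\<star> \<otimes> x))"
        by (rule finsum_cong'[OF refl]) (use SX x in auto)
      finally show ?thesis .
    qed
    have VS: "V\<star> \<otimes> S h = of_real (\<xi> h) \<odot> \<one>" if h: "h \<in> D" for h
    proof -
      have "V\<star> \<otimes> S h = (\<Oplus>g\<in>X. if g = h then of_real (\<xi> g) \<odot> \<one> else \<zero>)"
        unfolding Vstar[OF S(1)[OF h]] by (rule finsum_cong'[OF refl]) (use S(2)[OF _ h] D in auto)
      also have "\<dots> = of_real (\<xi> h) \<odot> \<one>"
      proof (cases "h \<in> X")
        case True
        then show ?thesis
          using add.finprod_singleton_swap[of h X "\<lambda>g. of_real (\<xi> g) \<odot> \<one>"] X by simp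
      next
        case False
        then have "(\<Oplus>g\<in>X. if g = h then of_real (\<xi> g) \<odot> \<one> else \<zero>) = (\<Oplus>g\<in>X. \<zero>)"
          by (intro finsum_cong'[OF refl]) auto
        then show ?thesis using \<xi>0 False h D by auto
      qed
      finally show ?thesis .
    qed
    have scal: "(\<Oplus>g\<in>Y. c g \<odot> x) = (\<Sum>g\<in>Y. c g) \<odot> x" if "finite Y" "x \<in> carrier A" for Y :: "'g set" and c x
      using that by (induction Y) (auto simp: finsum_insert smult_add_left)
    have VV: "V\<star> \<otimes> V = \<one>"
    proof -
      have "V\<star> \<otimes> V = (\<Oplus>g\<in>X. V\<star> \<otimes> (of_real (\<xi> g) \<odot> S g))"
        by (subst (2) V_def, rule finsum_rdistr) (use X Vc SX in auto)
      also have "\<dots> = (\<Oplus>g\<in>X. of_real ((\<xi> g)\<^sup>2) \<odot> \<one>)"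
        by (rule finsum_cong'[OF refl]) (use VS D Vc SX in \<open>auto simp: power2_eq_square\<close>)
      also have "\<dots> = \<one>" using scal[OF X(1), of \<one> "\<lambda>g. of_real ((\<xi> g)\<^sup>2)"] \<xi>1
        by (simp flip: of_real_sum of_real_power)
      finally show ?thesis .
    qed
    \<comment> \<open>Compression by \<open>V\<close> multiplies the part of \<open>b\<close> of
      degree \<open>f\<close> by the correlation of \<open>\<xi>\<close> with its translate by
      \<open>f\<close>, which almost invariance keeps within \<open>e\<close> of
      \<open>1\<close>.\<close>
    define c where "c f = (\<Sum>g\<in>X. \<xi> g * \<xi> (f \<cdot> g))" for f
    have VMV: "V\<star> \<otimes> (M \<otimes> V) = (\<Oplus>f\<in>F. of_real (c f) \<odot> \<beta> f)"
    proof -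
      have t: "V\<star> \<otimes> (M \<otimes> (of_real (\<xi> g) \<odot> S g)) = (\<Oplus>f\<in>F. of_real (\<xi> g * \<xi> (f \<cdot> g)) \<odot> \<beta> f)"
        if g: "g \<in> X" for g
      proof -
        have "V\<star> \<otimes> (M \<otimes> (of_real (\<xi> g) \<odot> S g)) = of_real (\<xi> g) \<odot> (V\<star> \<otimes> (M \<otimes> S g))"
          using Vc M SX g by simp
        also have "V\<star> \<otimes> (M \<otimes> S g) = (\<Oplus>f\<in>F. V\<star> \<otimes> (S (f \<cdot> g) \<otimes> \<beta> f))"
          unfolding MS[OF g] by (rule finsum_rdistr) (use F Vc S(1) FD g in auto)
        also have "\<dots> = (\<Oplus>f\<in>F. of_real (\<xi> (f \<cdot> g)) \<odot> \<beta> f)"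
        proof (rule finsum_cong'[OF refl])
          fix f assume f: "f \<in> F"
          have "V\<star> \<otimes> (S (f \<cdot> g) \<otimes> \<beta> f) = (V\<star> \<otimes> S (f \<cdot> g)) \<otimes> \<beta> f"
            using Vc S(1)[OF FD[OF g f]] f by (simp add: m_assoc)
          then show "V\<star> \<otimes> (S (f \<cdot> g) \<otimes> \<beta> f) = of_real (\<xi> (f \<cdot> g)) \<odot> \<beta> f"
            using VS[OF FD[OF g f]] f by simp
        qed auto
        also have "of_real (\<xi> g) \<odot> (\<Oplus>f\<in>F. of_real (\<xi> (f \<cdot> g)) \<odot> \<beta> f) =
            (\<Oplus>f\<in>F. of_real (\<xi> g) \<odot> (of_real (\<xi> (f \<cdot> g)) \<odot> \<beta> f))"
          by (rule smult_finsum[OF F(1)]) auto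
        also have "\<dots> = (\<Oplus>f\<in>F. of_real (\<xi> g * \<xi> (f \<cdot> g)) \<odot> \<beta> f)"
          by (rule finsum_cong'[OF refl]) auto
        finally show ?thesis .
      qed
      have "(\<Oplus>g\<in>Y. \<Oplus>f\<in>F. of_real (\<xi> g * \<xi> (f \<cdot> g)) \<odot> \<beta> f) =
        (\<Oplus>f\<in>F. of_real (\<Sum>g\<in>Y. \<xi> g * \<xi> (f \<cdot> g)) \<odot> \<beta> f)" if "finite Y" for Y
        using that
      proof (induction Y)
        case (insert g Y)
        have "(\<Oplus>h\<in>insert g Y. \<Oplus>f\<in>F. of_real (\<xi> h * \<xi> (f \<cdot> h)) \<odot> \<beta> f) =
            (\<Oplus>f\<in>F. of_real (\<xi> g * \<xi> (f \<cdot> g)) \<odot> \<beta> f) \<oplus>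
            (\<Oplus>h\<in>Y. \<Oplus>f\<in>F. of_real (\<xi> h * \<xi> (f \<cdot> h)) \<odot> \<beta> f)"
          by (rule finsum_insert) (use insert.hyps in \<open>auto intro!: finsum_closed\<close>)
        also have "\<dots> = (\<Oplus>f\<in>F. of_real (\<xi> g * \<xi> (f \<cdot> g)) \<odot> \<beta> f \<oplus>
            of_real (\<Sum>h\<in>Y. \<xi> h * \<xi> (f \<cdot> h)) \<odot> \<beta> f)"
          unfolding insert.IH by (rule finsum_addf[symmetric]) auto
        also have "\<dots> = (\<Oplus>f\<in>F. of_real (\<Sum>h\<in>insert g Y. \<xi> h * \<xi> (f \<cdot> h)) \<odot> \<beta> f)"
          by (rule finsum_cong'[OF refl]) (use insert.hyps in \<open>auto simp: smult_add_left\<close>)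
        finally show ?case .
      next
        case empty
        have "(\<Oplus>f\<in>F. of_real (\<Sum>g\<in>{}. \<xi> g * \<xi> (f \<cdot> g)) \<odot> \<beta> f) = (\<Oplus>f\<in>F. \<zero>)"
          by (rule finsum_cong'[OF refl]) auto
        then show ?case by simp
      qed
      note sw = this[OF X(1)]
      have "M \<otimes> V = (\<Oplus>g\<in>X. M \<otimes> (of_real (\<xi> g) \<odot> S g))"
        unfolding V_def by (rule finsum_rdistr) (use X M SX in auto)
      then have "V\<star> \<otimes> (M \<otimes> V) = (\<Oplus>g\<in>X. V\<star> \<otimes> (M \<otimes> (of_real (\<xi> g) \<odot> S g)))"
        using X M SX Vc by (simp add: finsum_rdistr Pi_def)
      also have "\<dots> = (\<Oplus>g\<in>X. \<Oplus>f\<in>F. of_real (\<xi> g * \<xi> (f \<cdot> g)) \<odot> \<beta> f)"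
        by (rule finsum_cong'[OF refl]) (use t in \<open>auto intro!: finsum_closed\<close>)
      finally show ?thesis unfolding sw c_def .
    qed
    have "\<parallel>b\<parallel> \<le> \<parallel>V\<star> \<otimes> (M \<otimes> V)\<parallel> + \<parallel>b\<parallel> / 4"
    proof -
      define r where "r = (\<Oplus>f\<in>F. of_real (1 - c f) \<odot> \<beta> f)"
      have rc: "r \<in> carrier A" unfolding r_def by (auto intro!: finsum_closed)
      have "\<parallel>r\<parallel> \<le> (\<Sum>f\<in>F. \<parallel>of_real (1 - c f) \<odot> \<beta> f\<parallel>)"
        unfolding r_def by (rule cnorm_finsum_le) (auto simp: F(1))
      also have "\<dots> \<le> (\<Sum>f\<in>F. e * \<parallel>\<beta> f\<parallel>)"
      proof (rule sum_mono)
        fix f assume f: "f \<in> F"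
        have "cmod (of_real (1 - c f)) \<le> e"
          using bspec[OF \<xi>e f] unfolding c_def norm_of_real by (simp add: abs_minus_commute)
        then show "\<parallel>of_real (1 - c f) \<odot> \<beta> f\<parallel> \<le> e * \<parallel>\<beta> f\<parallel>"
          using f cnorm_nonneg[of "\<beta> f"] by (simp only: cnorm_smult \<beta>_carrier F_carrier) (simp add: mult_right_mono)
      qed
      also have "\<dots> = e * B" unfolding B_def by (simp add: sum_distrib_left)
      finally have "\<parallel>r\<parallel> \<le> \<parallel>b\<parallel> / 4" using eB by simp
      moreover have "b = V\<star> \<otimes> (M \<otimes> V) \<oplus> r"
      proof -
        have "V\<star> \<otimes> (M \<otimes> V) \<oplus> r = (\<Oplus>f\<in>F. of_real (c f) \<odot> \<beta> f \<oplus> of_real (1 - c f) \<odot> \<beta> f)"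
          unfolding VMV r_def by (rule finsum_addf[symmetric]) auto
        also have "\<dots> = (\<Oplus>f\<in>F. \<beta> f)"
          by (rule finsum_cong'[OF refl]) (auto simp: smult_add_left[symmetric])
        finally show ?thesis unfolding b_def by simp
      qed
      then have "\<parallel>b\<parallel> \<le> \<parallel>V\<star> \<otimes> (M \<otimes> V)\<parallel> + \<parallel>r\<parallel>" using cnorm_triangle[of "V\<star> \<otimes> (M \<otimes> V)" r] rc Vc M by simp
      ultimately show ?thesis by linarith
    qed
    then have "(3 / 4 * \<parallel>b\<parallel>) ^ 2 ^ k \<le> \<parallel>V\<star> \<otimes> (M \<otimes> V)\<parallel> ^ 2 ^ k"
      using b0 by (intro power_mono) auto
    also have "\<dots> \<le> \<parallel>V\<star> \<otimes> (M [^] (2 ^ k :: nat) \<otimes> V)\<parallel>" by (rule compress_power_bound[OF M Vc VV])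
    also have "\<dots> \<le> C * \<parallel>diag (2 ^ k)\<parallel>"
    proof -
      \<comment> \<open>As \<open>k \<ge> 1\<close> the exponent is even, so the compressed power is
        \<open>(M [^] j \<otimes> V)\<star> \<otimes> (M [^] j \<otimes> V)\<close> with half the
        exponent.\<close>
      obtain k' where k': "k = Suc k'" using k by (cases k) auto
      define j where "j = (2::nat) ^ k'"
      have j: "2 ^ k = 2 * j" unfolding j_def k' by simp
      have "\<parallel>M [^] j \<otimes> S g\<parallel> = sqrt \<parallel>diag (2 * j)\<parallel>" if g: "g \<in> X" for g
      proof -
        have "\<parallel>M [^] j \<otimes> S g\<parallel>\<^sup>2 = \<parallel>diag (2 * j)\<parallel>"
          using cstar_identity[of "M [^] j \<otimes> S g"] power_star_power[OF M SX[OF g], of j] dg[OF g, of "2 * j"] j M SX[OF g] by simp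
        then show ?thesis using cnorm_nonneg[of "M [^] j \<otimes> S g"] M SX[OF g] by (simp add: real_sqrt_unique)
      qed
      note Sg = this
      have "M [^] j \<otimes> V = (\<Oplus>g\<in>X. of_real (\<xi> g) \<odot> (M [^] j \<otimes> S g))"
        unfolding V_def using X M SX by (subst finsum_rdistr) (auto intro!: finsum_cong')
      then have "\<parallel>M [^] j \<otimes> V\<parallel> \<le> (\<Sum>g\<in>X. \<parallel>of_real (\<xi> g) \<odot> (M [^] j \<otimes> S g)\<parallel>)"
        using cnorm_finsum_le[OF X(1), of "\<lambda>g. of_real (\<xi> g) \<odot> (M [^] j \<otimes> S g)"] M SX by simp
      also have "\<dots> = (\<Sum>g\<in>X. \<bar>\<xi> g\<bar> * sqrt \<parallel>diag (2 * j)\<parallel>)"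
        by (rule sum.cong[OF refl]) (use M SX Sg in \<open>simp add: cnorm_smult\<close>)
      finally have "\<parallel>M [^] j \<otimes> V\<parallel>\<^sup>2 \<le> ((\<Sum>g\<in>X. \<bar>\<xi> g\<bar>) * sqrt \<parallel>diag (2 * j)\<parallel>)\<^sup>2"
        using cnorm_nonneg[of "M [^] j \<otimes> V"] M Vc by (intro power_mono) (auto simp: sum_distrib_right)
      also have "\<dots> = C * \<parallel>diag (2 * j)\<parallel>" unfolding C_def by (simp add: power_mult_distrib cnorm_nonneg)
      finally show ?thesis
        using cstar_identity[of "M [^] j \<otimes> V"] power_star_power[OF M Vc, of j] M Vc unfolding j by simp
    qed
    finally show ?thesis .
  qed
  then show ?thesis by blast
qed

text \<open>If the even diagonal norms always grew by at most the factor
  \<open>(\<parallel>b\<parallel> / 2)\<^sup>2\<close>, then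
  \<open>\<parallel>diag (2 ^ k)\<parallel>\<close> would be at most
  \<open>(\<parallel>b\<parallel> / 2) ^ 2 ^ k\<close> for \<open>k \<ge> 1\<close>, and taking
  roots in \<open>norm_power_le_diag\<close> would give \<open>3 / 4 \<le> 1 / 2\<close>.\<close>

lemma diag_growth:
  assumes "b \<noteq> \<zero>"
  shows "\<exists>j. (\<parallel>b\<parallel> / 2)\<^sup>2 * \<parallel>diag (2 * j)\<parallel> < \<parallel>diag (2 * Suc j)\<parallel>"
proof (rule ccontr)
  assume "\<not> ?thesis"
  then have dec: "\<parallel>diag (2 * Suc j)\<parallel> \<le> (\<parallel>b\<parallel> / 2)\<^sup>2 * \<parallel>diag (2 * j)\<parallel>" for j by (meson not_le)
  have b0: "0 < \<parallel>b\<parallel>" using assms cnorm_nonneg[of b] cnorm_eq_0[of b] by (simp add: less_le)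
  have dj: "\<parallel>diag (2 * j)\<parallel> \<le> (\<parallel>b\<parallel> / 2) ^ (2 * j)" for j
  proof (induction j)
    case (Suc j)
    have "\<parallel>diag (2 * Suc j)\<parallel> \<le> (\<parallel>b\<parallel> / 2)\<^sup>2 * (\<parallel>b\<parallel> / 2) ^ (2 * j)"
      using dec[of j] mult_left_mono[OF Suc, of "(\<parallel>b\<parallel> / 2)\<^sup>2"] by simp
    then show ?case by (simp add: power_add[symmetric])
  qed (simp add: diag_0)
  obtain C where C: "\<And>k. 1 \<le> k \<Longrightarrow> (3 / 4 * \<parallel>b\<parallel>) ^ 2 ^ k \<le> C * \<parallel>diag (2 ^ k)\<parallel>" using norm_power_le_diag by blast
  have "3 / 4 * \<parallel>b\<parallel> \<le> \<parallel>b\<parallel> / 2"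
  proof (rule le_of_power_bound)
    fix k
    \<comment> \<open>\<open>norm_power_le_diag\<close> starts at \<open>k = 1\<close>. Raising the
      constant to at least \<open>2\<close> covers \<open>k = 0\<close>.\<close>
    show "(3 / 4 * \<parallel>b\<parallel>) ^ 2 ^ k \<le> max \<bar>C\<bar> 2 * (\<parallel>b\<parallel> / 2) ^ 2 ^ k"
    proof (cases k)
      case 0
      have "2 * (\<parallel>b\<parallel> / 2) \<le> max \<bar>C\<bar> 2 * (\<parallel>b\<parallel> / 2)" using b0 by (intro mult_right_mono) auto
      then show ?thesis using 0 b0 by simp
    next
      case (Suc k')
      have "(3 / 4 * \<parallel>b\<parallel>) ^ 2 ^ k \<le> C * \<parallel>diag (2 * 2 ^ k')\<parallel>" using C[of k] Suc by simp
      also have "\<dots> \<le> max \<bar>C\<bar> 2 * \<parallel>diag (2 * 2 ^ k')\<parallel>" by (rule mult_right_mono) (auto simp: cnorm_nonneg)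
      also have "\<dots> \<le> max \<bar>C\<bar> 2 * (\<parallel>b\<parallel> / 2) ^ (2 * 2 ^ k')" using dj by (intro mult_left_mono) auto
      finally show ?thesis using Suc by simp
    qed
  qed (use b0 in auto)
  then show False using b0 by simp
qed

end

section \<open>Self-adjoint approximants and the ideal argument\<close>

context isometric_fibres begin

lemma homogeneous_decomposition:
  assumes "d \<in> sp P (\<lambda>_ _. True)"
  shows "\<exists>F \<beta>. finite F \<and> F \<subseteq> carrier G \<and> (\<forall>g\<in>carrier G. \<beta> g \<in> hom_part g) \<and>
    (\<forall>g\<in>carrier G - F. \<beta> g = \<zero>) \<and> d = (\<Oplus>g\<in>F. \<beta> g)"
  using assms unfolding sp_def[of P "\<lambda>_ _. True"]
proof (induction rule: addspan.induct)
  case zero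
  show ?case by (intro exI[of _ "{}"] exI[of _ "\<lambda>_. \<zero>"]) (auto simp: sp_zero)
next
  case (add z w)
  then obtain F \<beta> where F: "finite F" "F \<subseteq> carrier G" and \<beta>: "\<And>g. g \<in> carrier G \<Longrightarrow> \<beta> g \<in> hom_part g"
    "\<And>g. g \<in> carrier G - F \<Longrightarrow> \<beta> g = \<zero>" and w: "w = (\<Oplus>g\<in>F. \<beta> g)" by blast
  obtain s t x y where z: "z = x \<otimes> y\<star>" "s \<in> P" "t \<in> P" "x \<in> H s" "y \<in> H t"
    using add(1) unfolding gens_def by blast
  define g where "g = s \<cdot> inv\<^sub>G t"
  have gc: "g \<in> carrier G" unfolding g_def using z by simp
  have zg: "z \<in> hom_part g" unfolding z(1) g_def by (rule spI) (use z in auto)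
  have \<beta>c: "\<And>g. g \<in> carrier G \<Longrightarrow> \<beta> g \<in> carrier A" using \<beta>(1) hom_part_carrier by blast
  have zc: "z \<in> carrier A" using zg hom_part_carrier by blast
  have w': "w = \<beta> g \<oplus> (\<Oplus>h\<in>F - {g}. \<beta> h)"
  proof -
    have "w = (\<Oplus>h\<in>insert g F. \<beta> h)" unfolding w
      by (rule add.finprod_mono_neutral_cong_left) (use F \<beta> \<beta>c gc in auto)
    also have "insert g F = insert g (F - {g})" by auto
    also have "(\<Oplus>h\<in>insert g (F - {g}). \<beta> h) = \<beta> g \<oplus> (\<Oplus>h\<in>F - {g}. \<beta> h)"
      by (rule finsum_insert) (use F \<beta>c gc in auto)
    finally show ?thesis .
  qed
  have rest: "(\<Oplus>h\<in>F - {g}. \<beta> h) \<in> carrier A" using F \<beta>c by (auto intro!: finsum_closed)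
  have "z \<oplus> w = (z \<oplus> \<beta> g) \<oplus> (\<Oplus>h\<in>F - {g}. \<beta> h)"
    unfolding w' using zc \<beta>c[OF gc] rest by (simp add: a_assoc)
  also have "(\<Oplus>h\<in>F - {g}. \<beta> h) = (\<Oplus>h\<in>F - {g}. (\<beta>(g := z \<oplus> \<beta> g)) h)"
    by (rule finsum_cong'[OF refl]) (use F \<beta>c in \<open>auto simp: subset_iff\<close>)
  also have "(z \<oplus> \<beta> g) \<oplus> (\<Oplus>h\<in>F - {g}. (\<beta>(g := z \<oplus> \<beta> g)) h) = (\<Oplus>h\<in>insert g (F - {g}). (\<beta>(g := z \<oplus> \<beta> g)) h)"
    using F \<beta>c gc zc by (subst finsum_insert) (auto simp: subset_iff)
  finally show ?case
    using F gc \<beta> sp_plus[OF subset_refl zg \<beta>(1)[OF gc]]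
    by (intro exI[of _ "insert g (F - {g})"] exI[of _ "\<beta>(g := z \<oplus> \<beta> g)"]) auto
qed

text \<open>Passing to the real part of \<open>d\<close> does not increase the distance to a
  self-adjoint element, and symmetrising the family degree by degree gives the relation between
  \<open>\<beta> g\<close> and \<open>\<beta> (inv\<^sub>G g)\<close>.\<close>

lemma selfadjoint_approximation:
  assumes d: "d \<in> sp P (\<lambda>_ _. True)"
  shows "\<exists>F \<beta>. selfadjoint_family A G P H F \<beta> \<and> (\<Oplus>g\<in>F. \<beta> g) = (1 / 2) \<odot> (d \<oplus> d\<star>)"
proof -
  obtain F0 \<beta>0 where F0: "finite F0" "F0 \<subseteq> carrier G" and \<beta>0: "\<And>g. g \<in> carrier G \<Longrightarrow> \<beta>0 g \<in> hom_part g"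
    "\<And>g. g \<in> carrier G \<Longrightarrow> g \<notin> F0 \<Longrightarrow> \<beta>0 g = \<zero>" and d: "d = (\<Oplus>g\<in>F0. \<beta>0 g)"
    using homogeneous_decomposition[OF d] by (metis DiffI)
  have c: "\<And>g. g \<in> carrier G \<Longrightarrow> \<beta>0 g \<in> carrier A" using \<beta>0(1) hom_part_carrier by blast
  define F where "F = insert \<e> (F0 \<union> (\<lambda>g. inv\<^sub>G g) ` F0)"
  define \<beta> where "\<beta> g = (1 / 2) \<odot> (\<beta>0 g \<oplus> (\<beta>0 (inv\<^sub>G g))\<star>)" for g
  have F: "finite F" "F \<subseteq> carrier G" "\<e> \<in> F" "\<And>f. f \<in> F \<Longrightarrow> inv\<^sub>G f \<in> F"
    unfolding F_def using F0 by (auto simp: subset_iff)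
  have "selfadjoint_family A G P H F \<beta>"
  proof (unfold_locales; (rule F | assumption)?)
    fix g assume g: "g \<in> carrier G"
    have "(\<beta>0 (inv\<^sub>G g))\<star> \<in> hom_part g" using hom_part_adj[OF _ \<beta>0(1)[of "inv\<^sub>G g"]] g by simp
    then show "\<beta> g \<in> hom_part g" unfolding \<beta>_def using \<beta>0(1)[OF g]
      by (intro sp_smult sp_plus subset_refl)
    show "\<beta> (inv\<^sub>G g) = (\<beta> g)\<star>" unfolding \<beta>_def using g c by (simp add: adj_smult adj_add a_comm)
    assume "g \<notin> F"
    then have "g \<notin> F0" "inv\<^sub>G g \<notin> F0" using g G.inv_inv unfolding F_def by (auto simp: image_iff)
    then show "\<beta> g = \<zero>" unfolding \<beta>_def using \<beta>0(2) g by simp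
  qed
  moreover have "(\<Oplus>g\<in>F. \<beta> g) = (1 / 2) \<odot> (d \<oplus> d\<star>)"
  proof -
    have d1: "d = (\<Oplus>g\<in>F. \<beta>0 g)" unfolding d
    proof (rule add.finprod_mono_neutral_cong_left)
      show "F0 \<subseteq> F" unfolding F_def by blast
      show "\<beta>0 g = \<zero>" if "g \<in> F - F0" for g using \<beta>0(2) F(2) that by blast
      show "\<beta>0 \<in> F \<rightarrow> carrier A" using F(2) c by blast
    qed (use F(1) in auto)
    have img: "(\<lambda>g. inv\<^sub>G g) ` F = F"
    proof
      show "F \<subseteq> (\<lambda>g. inv\<^sub>G g) ` F"
      proof
        fix g assume g: "g \<in> F"
        then have "g = inv\<^sub>G (inv\<^sub>G g)" using F(2) by auto
        then show "g \<in> (\<lambda>g. inv\<^sub>G g) ` F" using F(4)[OF g] by blast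
      qed
      show "(\<lambda>g. inv\<^sub>G g) ` F \<subseteq> F" using F(4) by blast
    qed
    have "d\<star> = (\<Oplus>g\<in>F. (\<beta>0 g)\<star>)" unfolding d1 using F(1,2) c by (intro adj_finsum) auto
    also have "\<dots> = (\<Oplus>g\<in>(\<lambda>g. inv\<^sub>G g) ` F. (\<beta>0 g)\<star>)" unfolding img ..
    also have "\<dots> = (\<Oplus>g\<in>F. (\<beta>0 (inv\<^sub>G g))\<star>)"
    proof (rule finsum_reindex)
      show "(\<lambda>g. (\<beta>0 g)\<star>) \<in> (\<lambda>g. inv\<^sub>G g) ` F \<rightarrow> carrier A" unfolding img using F(2) c by blast
      show "inj_on (\<lambda>g. inv\<^sub>G g) F" using F(2) by (intro inj_onI) (metis G.inv_inv subsetD)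
    qed
    finally have d2: "d\<star> = (\<Oplus>g\<in>F. (\<beta>0 (inv\<^sub>G g))\<star>)" .
    have "d \<oplus> d\<star> = (\<Oplus>g\<in>F. \<beta>0 g \<oplus> (\<beta>0 (inv\<^sub>G g))\<star>)"
      unfolding d2 by (subst d1, rule finsum_addf[symmetric]) (use F(2) c in auto)
    moreover have "(\<Oplus>g\<in>F. \<beta> g) = (1 / 2) \<odot> (\<Oplus>g\<in>F. \<beta>0 g \<oplus> (\<beta>0 (inv\<^sub>G g))\<star>)"
      unfolding \<beta>_def by (rule smult_finsum[symmetric, OF F(1)]) (use F(2) c in auto)
    ultimately show ?thesis by simp
  qed
  ultimately show ?thesis by blast
qed

subsection \<open>Simplicity\<close>

theorem closed_ideal_trivial:
  assumes dense: "carrier A \<subseteq> norm_closure (sp P (\<lambda>_ _. True))"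
    and I: "ideal I A" and cl: "closedin (norm_topology A (cnorm A)) I" and ne: "I \<noteq> {\<zero>}"
  shows "I = carrier A"
proof -
  interpret I: ideal I A by (rule I)
  obtain c where c: "c \<in> I" "c \<noteq> \<zero>" using ne I.zero_closed by auto
  have cc: "c \<in> carrier A" using c I.a_subset by auto
  define a where "a = c\<star> \<otimes> c"
  have a: "a \<in> I" "a \<in> carrier A" "a\<star> = a"
    unfolding a_def using I.I_l_closed[OF c(1)] cc by (auto simp: adj_mult)
  define \<kappa> where "\<kappa> = \<parallel>a\<parallel>"
  have \<kappa>: "0 < \<kappa>" unfolding \<kappa>_def a_def using cstar_identity[OF cc] cnorm_eq_0[OF cc] c(2) by simp
  obtain d where d: "d \<in> sp P (\<lambda>_ _. True)" "\<parallel>a \<ominus> d\<parallel> < \<kappa> / 100"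
    using dense a(2) \<kappa> unfolding norm_closure_def by (auto dest!: subsetD[of "carrier A"] spec[of _ "\<kappa> / 100"])
  have dc: "d \<in> carrier A" using sp_carrier[OF subset_refl d(1)] .
  obtain F \<beta> where fam: "selfadjoint_family A G P H F \<beta>" and sum: "(\<Oplus>g\<in>F. \<beta> g) = (1 / 2) \<odot> (d \<oplus> d\<star>)"
    using selfadjoint_approximation[OF d(1)] by blast
  interpret F: selfadjoint_family A G P H F \<beta> by (rule fam)
  define b where "b = F.b"
  have bc: "b \<in> carrier A" "b\<star> = b" unfolding b_def using F.b_selfadj by auto
  have ab: "\<parallel>a \<ominus> b\<parallel> \<le> \<kappa> / 100"
  proof -
    have "a = (1 / 2) \<odot> (a \<oplus> a)" using smult_add_left[OF a(2), of "1/2" "1/2"] a by (simp add: smult_add_right)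
    then have "a \<ominus> b = (1 / 2) \<odot> ((a \<oplus> a) \<ominus> (d \<oplus> d\<star>))"
      unfolding b_def F.b_def sum using a dc by (simp add: smult_diff_right)
    also have "(a \<oplus> a) \<ominus> (d \<oplus> d\<star>) = (a \<ominus> d) \<oplus> (a \<ominus> d)\<star>"
      using a dc by (simp add: adj_uminus adj_add minus_eq minus_add a_ac)
    finally have "\<parallel>a \<ominus> b\<parallel> = \<parallel>(a \<ominus> d) \<oplus> (a \<ominus> d)\<star>\<parallel> / 2" using a dc by (simp add: cnorm_smult)
    moreover have "\<parallel>(a \<ominus> d) \<oplus> (a \<ominus> d)\<star>\<parallel> \<le> \<parallel>a \<ominus> d\<parallel> + \<parallel>a \<ominus> d\<parallel>"
      using cnorm_triangle[of "a \<ominus> d" "(a \<ominus> d)\<star>"] a dc by simp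
    ultimately show ?thesis using d(2) by simp
  qed
  have b_ge: "99 / 100 * \<kappa> \<le> \<parallel>b\<parallel>" using cnorm_le_diff_add[OF a(2) bc(1)] ab unfolding \<kappa>_def by simp
  have b_le: "\<parallel>b\<parallel> \<le> 101 / 100 * \<kappa>"
    using cnorm_le_diff_add[OF bc(1) a(2)] ab cnorm_diff_commute[OF a(2) bc(1)] unfolding \<kappa>_def by simp
  \<comment> \<open>\<open>1 / 16\<close> is the product of the factor \<open>1 / 4\<close> in
    \<open>diag_growth\<close> and the loss \<open>1 / 4\<close> in \<open>l_ge\<close>; the
    tolerance \<open>\<kappa> / 100\<close> for \<open>d\<close> is small enough for it.\<close>
  have sq: "\<parallel>a \<otimes> a \<ominus> b \<otimes> b\<parallel> \<le> \<parallel>b\<parallel>\<^sup>2 / 16"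
  proof -
    have "a \<otimes> a \<ominus> b \<otimes> b = a \<otimes> (a \<ominus> b) \<oplus> (a \<ominus> b) \<otimes> b"
      using a(2) bc(1) by (simp add: minus_eq r_distr l_distr r_minus l_minus a_assoc r_neg1)
    then have "\<parallel>a \<otimes> a \<ominus> b \<otimes> b\<parallel> \<le> \<parallel>a \<otimes> (a \<ominus> b)\<parallel> + \<parallel>(a \<ominus> b) \<otimes> b\<parallel>"
      using cnorm_triangle a bc by simp
    also have "\<dots> \<le> \<kappa> * (\<kappa> / 100) + (\<kappa> / 100) * (101 / 100 * \<kappa>)"
      by (intro add_mono cnorm_mult_le) (use a bc ab b_le in \<open>auto simp: \<kappa>_def\<close>)
    also have "\<dots> \<le> (99 / 100 * \<kappa>)\<^sup>2 / 16" by (simp add: power2_eq_square)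
    also have "\<dots> \<le> \<parallel>b\<parallel>\<^sup>2 / 16" using b_ge \<kappa> by (intro divide_right_mono power_mono) auto
    finally show ?thesis .
  qed
  have "F.b \<noteq> \<zero>" using b_ge \<kappa> unfolding b_def by auto
  then obtain j where j: "(\<parallel>b\<parallel> / 2)\<^sup>2 * \<parallel>F.diag (2 * j)\<parallel> < \<parallel>F.diag (2 * Suc j)\<parallel>"
    using F.diag_growth unfolding b_def by blast
  define y where "y = F.diag (2 * Suc j)"
  obtain Y where Y: "Y \<in> carrier A" "y = Y\<star> \<otimes> Y" using F.diag_even_square[of "Suc j"] unfolding y_def by blast
  have "y \<in> core P" unfolding y_def by (rule F.diag_core)
  moreover have "y \<in> carrier A" "y\<star> = y" using Y by (auto simp: adj_mult)
  ultimately have y: "y \<in> core P" "y \<in> carrier A" "y\<star> = y" .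
  \<comment> \<open>Two off-diagonal parts have to disappear: that of
    \<open>b [^] (2 * Suc j)\<close> so that its compression is a scalar, and that of
    \<open>b [^] (2 * j)\<close> for the bound on \<open>\<parallel>x\<parallel>\<close>.\<close>
  obtain v l where v: "v \<in> carrier A" "v\<star> \<otimes> v = \<one>" "\<parallel>y\<parallel> / 2 \<le> \<parallel>y \<otimes> v\<parallel>" and l: "v\<star> \<otimes> y \<otimes> v = l \<odot> \<one>"
    and off: "v\<star> \<otimes> F.off (2 * Suc j) \<otimes> v = \<zero>" "v\<star> \<otimes> F.off (2 * j) \<otimes> v = \<zero>"
    using core_compression[OF y(1,3), of "{F.off (2 * Suc j), F.off (2 * j)}"] F.off_offdiag by auto
  have y0: "0 < \<parallel>y\<parallel>" using j cnorm_nonneg[of "F.diag (2 * j)"] unfolding y_def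
    by (meson F.diag_carrier le_less_trans mult_nonneg_nonneg zero_le_power2)
  \<comment> \<open>A large \<open>y \<otimes> v\<close> does not by itself make
    \<open>v\<star> \<otimes> y \<otimes> v\<close> large. Positivity does: \<open>\<parallel>y
    \<otimes> v\<parallel>\<^sup>2 \<le> \<parallel>Y\<parallel>\<^sup>2 * \<parallel>Y \<otimes>
    v\<parallel>\<^sup>2 = \<parallel>y\<parallel> * cmod l\<close>.\<close>
  have l_ge: "\<parallel>y\<parallel> / 4 \<le> cmod l"
  proof -
    have "y \<otimes> v = Y\<star> \<otimes> (Y \<otimes> v)" using Y v by (simp add: m_assoc)
    then have "\<parallel>y \<otimes> v\<parallel> \<le> \<parallel>Y\<parallel> * \<parallel>Y \<otimes> v\<parallel>" using cnorm_mult[of "Y\<star>" "Y \<otimes> v"] Y v by simp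
    then have "\<parallel>y\<parallel> / 2 \<le> \<parallel>Y\<parallel> * \<parallel>Y \<otimes> v\<parallel>" using v by simp
    then have "(\<parallel>y\<parallel> / 2)\<^sup>2 \<le> (\<parallel>Y\<parallel> * \<parallel>Y \<otimes> v\<parallel>)\<^sup>2" using y0 by (intro power_mono) auto
    also have "\<dots> = \<parallel>y\<parallel> * \<parallel>Y \<otimes> v\<parallel>\<^sup>2" using cstar_identity[OF Y(1)] Y(2) by (simp add: power_mult_distrib)
    also have "\<parallel>Y \<otimes> v\<parallel>\<^sup>2 = \<parallel>(Y \<otimes> v)\<star> \<otimes> (Y \<otimes> v)\<parallel>" using cstar_identity[of "Y \<otimes> v"] Y v by simp
    also have "(Y \<otimes> v)\<star> \<otimes> (Y \<otimes> v) = l \<odot> \<one>" unfolding l[symmetric] using Y v by (simp add: adj_mult m_assoc)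
    finally have "\<parallel>y\<parallel> * (\<parallel>y\<parallel> / 4) \<le> \<parallel>y\<parallel> * cmod l" by (simp add: power2_eq_square)
    then show ?thesis using y0 by (simp only: mult_le_cancel_left_pos)
  qed
  \<comment> \<open>Only the two innermost factors \<open>b\<close> are replaced by
    \<open>a\<close>. The error \<open>a \<otimes> a \<ominus> b \<otimes> b\<close> is then
    weighted by \<open>\<parallel>x\<parallel>\<^sup>2 \<le> \<parallel>F.diag (2 *
    j)\<parallel>\<close> and not by a power of \<open>\<parallel>b\<parallel>\<close>.\<close>
  define x where "x = b [^] j \<otimes> v"
  have xc: "x \<in> carrier A" unfolding x_def using bc v by simp
  have xnorm: "\<parallel>x\<parallel>\<^sup>2 \<le> \<parallel>F.diag (2 * j)\<parallel>"
  proof -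
    have "x\<star> \<otimes> x = v\<star> \<otimes> (b [^] (2 * j) \<otimes> v)" unfolding x_def by (rule F.power_star_power[OF bc v(1)])
    also have "\<dots> = v\<star> \<otimes> (F.diag (2 * j) \<oplus> F.off (2 * j)) \<otimes> v"
      using F.b_power_split v bc by (simp add: b_def m_assoc)
    also have "\<dots> = v\<star> \<otimes> F.diag (2 * j) \<otimes> v" using v off(2) by (simp add: r_distr l_distr)
    finally have "\<parallel>x\<parallel>\<^sup>2 = \<parallel>v\<star> \<otimes> F.diag (2 * j) \<otimes> v\<parallel>" using cstar_identity[OF xc] by simp
    then show ?thesis using isometry_compress_le[OF v(1,2), of "F.diag (2 * j)"] by simp
  qed
  have xbx: "x\<star> \<otimes> (b \<otimes> b) \<otimes> x = l \<odot> \<one>"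
  proof -
    have "x\<star> \<otimes> (b \<otimes> b) \<otimes> x = (b [^] Suc j \<otimes> v)\<star> \<otimes> (b [^] Suc j \<otimes> v)"
      unfolding x_def using bc v
      by (simp only: power_Suc2) (simp add: adj_mult power_selfadj m_assoc)
    also have "\<dots> = v\<star> \<otimes> (b [^] (2 * Suc j) \<otimes> v)" by (rule F.power_star_power[OF bc v(1)])
    also have "b [^] (2 * Suc j) = y \<oplus> F.off (2 * Suc j)" unfolding b_def y_def by (rule F.b_power_split)
    also have "v\<star> \<otimes> ((y \<oplus> F.off (2 * Suc j)) \<otimes> v) = v\<star> \<otimes> y \<otimes> v \<oplus> v\<star> \<otimes> F.off (2 * Suc j) \<otimes> v"
      using v y F.off_carrier by (simp add: r_distr l_distr m_assoc del: mult_Suc_right)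
    finally show ?thesis using l off(1) by simp
  qed
  define z where "z = x\<star> \<otimes> (a \<otimes> a) \<otimes> x"
  have zI: "z \<in> I" unfolding z_def using I.I_l_closed I.I_r_closed a xc by auto
  have zc: "z \<in> carrier A" unfolding z_def using a xc by auto
  have "z \<ominus> l \<odot> \<one> = x\<star> \<otimes> (a \<otimes> a \<ominus> b \<otimes> b) \<otimes> x"
    unfolding z_def xbx[symmetric] using a xc bc by (simp add: minus_eq r_distr l_distr r_minus l_minus)
  also have "\<parallel>\<dots>\<parallel> \<le> (\<parallel>x\<parallel> * (\<parallel>b\<parallel>\<^sup>2 / 16)) * \<parallel>x\<parallel>"
    by (intro cnorm_mult_le) (use a bc xc sq in auto)
  also have "\<dots> = (\<parallel>b\<parallel>\<^sup>2 / 16) * \<parallel>x\<parallel>\<^sup>2" by (simp add: power2_eq_square)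
  also have "\<dots> \<le> (\<parallel>b\<parallel>\<^sup>2 / 16) * \<parallel>F.diag (2 * j)\<parallel>" using xnorm by (intro mult_left_mono) auto
  also have "\<dots> < \<parallel>y\<parallel> / 4" using j unfolding y_def by (simp add: power_divide)
  also have "\<dots> \<le> cmod l" by (rule l_ge)
  finally show ?thesis by (rule closed_ideal_near_scalar[OF I cl zI])
qed

end

section \<open>Representations of product systems\<close>

context hilbert_space begin

lemma complex_scalar [simp]: "c \<in> carrier complex_ring" by (simp add: complex_ring_def)

lemma hsmult_closed [simp, intro]: "x \<in> carrier H \<Longrightarrow> c \<odot> x \<in> carrier H"
  by (rule smult_closed) auto

lemma hsmult_minus_one: "x \<in> carrier H \<Longrightarrow> \<ominus> x = (- 1) \<odot> x"
proof -
  assume x: "x \<in> carrier H"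
  have "(- 1 + 1) \<odot> x = (- 1) \<odot> x \<oplus> 1 \<odot> x"
    using smult_l_distr[of "-1" 1 x] x by (simp add: complex_ring_def)
  moreover have "1 \<odot> x = x" "0 \<odot> x = \<zero>"
    using smult_one[of x] smult_l_null[of x] x by (simp_all add: complex_ring_def)
  ultimately have "(- 1) \<odot> x \<oplus> x = \<zero>" by simp
  then show ?thesis using M.minus_equality[of "(- 1) \<odot> x" x] x by simp
qed

lemma cinner_smult_right:
  "\<lbrakk>x \<in> carrier H; y \<in> carrier H\<rbrakk> \<Longrightarrow> cinner H y (c \<odot> x) = cnj c * cinner H y x"
  using cinner_commute[of "c \<odot> x" y] cinner_commute[of x y] cinner_smult_left[of x y c] by simp

lemma cinner_self: "x \<in> carrier H \<Longrightarrow> cinner H x x = of_real ((hnorm H x)\<^sup>2)"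
proof -
  assume x: "x \<in> carrier H"
  have "cinner H x x = cnj (cinner H x x)" by (rule cinner_commute[OF x x])
  then have "Im (cinner H x x) = 0" by (metis complex_cnj_cancel_iff Reals_cnj_iff complex_is_Real_iff)
  then show ?thesis using cinner_nonneg[OF x] by (simp add: hnorm_def complex_eq_iff)
qed

lemma cspan_carrier: "S \<subseteq> carrier H \<Longrightarrow> cspan H S \<subseteq> carrier H"
  unfolding cspan_def using carrier_is_submodule by blast

lemma cspan_minimal: "submodule V complex_ring H \<Longrightarrow> S \<subseteq> V \<Longrightarrow> cspan H S \<subseteq> V"
  unfolding cspan_def by blast

lemma cspan_singleton:
  assumes u: "u \<in> carrier H"
  shows "cspan H {u} \<subseteq> {c \<odot> u | c. True}"
proof (rule cspan_minimal)
  show "submodule {c \<odot> u | c. True} complex_ring H"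
  proof (rule submoduleI)
    show "\<zero> \<in> {c \<odot> u | c. True}"
      using smult_l_null[OF u] by (auto simp: complex_ring_def intro!: exI[of _ 0])
  next
    fix a assume "a \<in> {c \<odot> u | c. True}"
    then obtain c where "a = c \<odot> u" by blast
    then have "\<ominus> a = (- c) \<odot> u"
      using hsmult_minus_one[of a] smult_assoc1[of "-1" c u] u by (simp add: complex_ring_def)
    then show "\<ominus> a \<in> {c \<odot> u | c. True}" by blast
  next
    fix a b assume "a \<in> {c \<odot> u | c. True}" "b \<in> {c \<odot> u | c. True}"
    then obtain c d where "a = c \<odot> u" "b = d \<odot> u" by blast
    then have "a \<oplus> b = (c + d) \<odot> u"
      using smult_l_distr[of c d u] u by (simp add: complex_ring_def)
    then show "a \<oplus> b \<in> {c \<odot> u | c. True}" by blast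
  next
    fix k :: complex and a assume "a \<in> {c \<odot> u | c. True}"
    then obtain c where "a = c \<odot> u" by blast
    then have "k \<odot> a = (k * c) \<odot> u"
      using smult_assoc1[of k c u] u by (simp add: complex_ring_def)
    then show "k \<odot> a \<in> {c \<odot> u | c. True}" by blast
  qed (use u in auto)
  have "u = 1 \<odot> u" using smult_one[OF u] by (simp add: complex_ring_def)
  then show "{u} \<subseteq> {c \<odot> u | c. True}" by auto
qed

lemma unit_vector:
  assumes x: "x \<in> carrier H" "x \<noteq> \<zero>"
  shows "\<exists>c. cinner H (c \<odot> x) (c \<odot> x) = 1"
proof -
  have n: "hnorm H x \<noteq> 0" using cinner_self[OF x(1)] cinner_definite[OF x(1)] x(2) by auto
  define c :: complex where "c = of_real (inverse (hnorm H x))"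
  have "cinner H (c \<odot> x) (c \<odot> x) = c * (cnj c * cinner H x x)"
    using x by (simp add: cinner_smult_left cinner_smult_right)
  also have "\<dots> = of_real (inverse (hnorm H x) * (inverse (hnorm H x) * (hnorm H x)\<^sup>2))"
    unfolding c_def cinner_self[OF x(1)] by simp
  also have "inverse (hnorm H x) * (inverse (hnorm H x) * (hnorm H x)\<^sup>2) = 1"
    using n by (simp add: power2_eq_square field_simps)
  finally show ?thesis by auto
qed

text \<open>Only finite codimension is claimed; \<open>z\<close> need not be orthogonal to
  \<open>y\<close>. For a new vector \<open>n\<close>, either it is orthogonal to everything
  orthogonal to \<open>N\<close>, or one vector \<open>w\<close> from there with
  \<open>cinner H w n \<noteq> 0\<close>, added to \<open>B\<close>, is enough to correct every
  \<open>y\<close>.\<close>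

lemma orthogonal_decomposition:
  assumes "finite N" "N \<subseteq> carrier H"
  shows "\<exists>B. finite B \<and> B \<subseteq> carrier H \<and>
    (\<forall>x\<in>carrier H. \<exists>y\<in>carrier H. \<exists>z\<in>cspan H B. x = y \<oplus> z \<and> (\<forall>n\<in>N. cinner H y n = 0))"
  using assms
proof (induction N)
  case empty
  have "\<zero> \<in> cspan H {}" unfolding cspan_def
    using submoduleE(2,4) submodule.smult_closed by (auto simp: submodule_def subgroup_def)
  then show ?case by (intro exI[of _ "{}"]) force
next
  case (insert n N)
  then obtain B where B: "finite B" "B \<subseteq> carrier H"
    "\<forall>x\<in>carrier H. \<exists>y\<in>carrier H. \<exists>z\<in>cspan H B. x = y \<oplus> z \<and> (\<forall>n\<in>N. cinner H y n = 0)" by auto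
  have n: "n \<in> carrier H" and N: "N \<subseteq> carrier H" using insert by auto
  show ?case
  proof (cases "\<exists>w\<in>carrier H. (\<forall>n\<in>N. cinner H w n = 0) \<and> cinner H w n \<noteq> 0")
    case False
    then show ?thesis using B by (intro exI[of _ B]) blast
  next
    case True
    then obtain w where w: "w \<in> carrier H" "\<forall>n\<in>N. cinner H w n = 0" "cinner H w n \<noteq> 0" by blast
    show ?thesis
    proof (intro exI[of _ "insert w B"] conjI ballI)
      fix x assume "x \<in> carrier H"
      then obtain y z where yz: "y \<in> carrier H" "z \<in> cspan H B" "x = y \<oplus> z" "\<forall>n\<in>N. cinner H y n = 0" using B by blast
      have z: "z \<in> carrier H" using cspan_carrier[OF B(2)] yz by blast
      define c where "c = cinner H y n / cinner H w n"
      have "y \<oplus> (- c) \<odot> w \<in> carrier H" using yz w by simp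
      moreover have "c \<odot> w \<oplus> z \<in> cspan H (insert w B)"
        unfolding cspan_def
      proof (intro InterI, clarify)
        fix V assume V: "submodule V complex_ring H" "insert w B \<subseteq> V"
        then have "z \<in> V" using yz(2) unfolding cspan_def by blast
        then show "c \<odot> w \<oplus> z \<in> V" using V submoduleE(4)[OF V(1), of c w] submoduleE(5)[OF V(1)] by simp
      qed
      moreover have "x = (y \<oplus> (- c) \<odot> w) \<oplus> (c \<odot> w \<oplus> z)"
      proof -
        have "(- c) \<odot> w \<oplus> c \<odot> w = \<zero>"
          using smult_l_distr[of "- c" c w] smult_l_null[of w] w by (simp add: complex_ring_def)
        then have "y \<oplus> ((- c) \<odot> w \<oplus> c \<odot> w) \<oplus> z = x" using yz by simp
        then show ?thesis using yz(1) w z by (simp add: M.a_assoc)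
      qed
      moreover have "cinner H (y \<oplus> (- c) \<odot> w) m = 0" if "m \<in> insert n N" for m
        using that yz w n N by (auto simp: cinner_add_left cinner_smult_left c_def subset_iff)
      ultimately show "\<exists>y\<in>carrier H. \<exists>z\<in>cspan H (insert w B). x = y \<oplus> z \<and> (\<forall>n\<in>insert n N. cinner H y n = 0)"
        by blast
    qed (use B w in auto)
  qed
qed

text \<open>A vector outside the span of the finite set \<open>B\<close> has a nonzero component
  \<open>y\<close>, which only needs to be normalised.\<close>

lemma orthogonal_unit_vector:
  assumes inf: "\<not> finite_dimensional H" and N: "finite N" "N \<subseteq> carrier H"
  shows "\<exists>x\<in>carrier H. cinner H x x = 1 \<and> (\<forall>n\<in>N. cinner H x n = 0)"
proof -
  obtain B where B: "finite B" "B \<subseteq> carrier H"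
    "\<forall>x\<in>carrier H. \<exists>y\<in>carrier H. \<exists>z\<in>cspan H B. x = y \<oplus> z \<and> (\<forall>n\<in>N. cinner H y n = 0)"
    using orthogonal_decomposition[OF N] by blast
  have "cspan H B \<noteq> carrier H" using inf B unfolding finite_dimensional_def by blast
  then obtain x where x: "x \<in> carrier H" "x \<notin> cspan H B" using cspan_carrier[OF B(2)] by blast
  obtain y z where yz: "y \<in> carrier H" "z \<in> cspan H B" "x = y \<oplus> z" "\<forall>n\<in>N. cinner H y n = 0" using B x by blast
  have "y \<noteq> \<zero>" using x yz cspan_carrier[OF B(2)] by auto
  then obtain c where c: "cinner H (c \<odot> y) (c \<odot> y) = 1" using unit_vector yz(1) by blast
  show ?thesis
    by (rule bexI[of _ "c \<odot> y"]) (use c yz N in \<open>auto simp: cinner_smult_left subset_iff\<close>)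
qed

end

section \<open>Isometric embeddings and norm closures\<close>

context unital_cstar begin

text \<open>An isometric linear map into \<open>A\<close> transfers the triangle inequality to the Hilbert space.\<close>

lemma embedded_metric:
  assumes K: "hilbert_space K" and jc: "\<And>x. x \<in> carrier K \<Longrightarrow> j x \<in> carrier A"
    and add: "\<And>x y. x \<in> carrier K \<Longrightarrow> y \<in> carrier K \<Longrightarrow> j (x \<oplus>\<^bsub>K\<^esub> y) = j x \<oplus> j y"
    and nrm: "\<And>x. x \<in> carrier K \<Longrightarrow> \<parallel>j x\<parallel> = hnorm K x"
  shows "Metric_space (carrier K) (norm_dist K (hnorm K))"
    and "\<And>x y. x \<in> carrier K \<Longrightarrow> y \<in> carrier K \<Longrightarrow> norm_dist K (hnorm K) x y = \<parallel>j x \<ominus> j y\<parallel>"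
proof -
  interpret K: hilbert_space K by (rule K)
  have diff: "j (x \<ominus>\<^bsub>K\<^esub> y) = j x \<ominus> j y" if "x \<in> carrier K" "y \<in> carrier K" for x y
  proof -
    have "j (x \<ominus>\<^bsub>K\<^esub> y) \<oplus> j y = j ((x \<ominus>\<^bsub>K\<^esub> y) \<oplus>\<^bsub>K\<^esub> y)" using add[of "x \<ominus>\<^bsub>K\<^esub> y" y] that by simp
    also have "(x \<ominus>\<^bsub>K\<^esub> y) \<oplus>\<^bsub>K\<^esub> y = x" using that by (simp add: K.M.minus_eq K.M.a_assoc K.M.l_neg)
    finally have e: "j x = j (x \<ominus>\<^bsub>K\<^esub> y) \<oplus> j y" by simp
    show ?thesis unfolding e using that jc by (simp add: minus_eq a_assoc r_neg)
  qed
  show d: "\<And>x y. x \<in> carrier K \<Longrightarrow> y \<in> carrier K \<Longrightarrow> norm_dist K (hnorm K) x y = \<parallel>j x \<ominus> j y\<parallel>"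
    unfolding norm_dist_def using diff nrm by (simp flip: nrm)
  show "Metric_space (carrier K) (norm_dist K (hnorm K))"
  proof
    fix x y z
    show "0 \<le> norm_dist K (hnorm K) x y"
    proof (cases "x \<in> carrier K \<and> y \<in> carrier K")
      case True
      then show ?thesis using d jc by (simp add: cnorm_nonneg)
    qed (auto simp: norm_dist_def)
    show "norm_dist K (hnorm K) x y = norm_dist K (hnorm K) y x"
      by (cases "x \<in> carrier K \<and> y \<in> carrier K")
         (use d jc cnorm_diff_commute[of "j x" "j y"] in \<open>auto, auto simp: norm_dist_def\<close>)
    show "norm_dist K (hnorm K) x z \<le> norm_dist K (hnorm K) x y + norm_dist K (hnorm K) y z"
      if "x \<in> carrier K" "y \<in> carrier K" "z \<in> carrier K" using that d jc cnorm_diff_triangle by simp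
    show "norm_dist K (hnorm K) x y = 0 \<longleftrightarrow> x = y" if xy: "x \<in> carrier K" "y \<in> carrier K"
    proof
      assume "norm_dist K (hnorm K) x y = 0"
      then have "hnorm K (x \<ominus>\<^bsub>K\<^esub> y) = 0" using xy unfolding norm_dist_def by simp
      then have "x \<ominus>\<^bsub>K\<^esub> y = \<zero>\<^bsub>K\<^esub>" using K.cinner_self[of "x \<ominus>\<^bsub>K\<^esub> y"] K.cinner_definite[of "x \<ominus>\<^bsub>K\<^esub> y"] xy by simp
      then have "(x \<ominus>\<^bsub>K\<^esub> y) \<oplus>\<^bsub>K\<^esub> y = \<zero>\<^bsub>K\<^esub> \<oplus>\<^bsub>K\<^esub> y" by simp
      then show "x = y" using xy by (simp add: K.M.minus_eq K.M.a_assoc K.M.l_neg)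
    next
      assume "x = y"
      then show "norm_dist K (hnorm K) x y = 0" using d[OF xy] jc xy by (simp add: minus_eq r_neg)
    qed
  qed
qed

lemma norm_closure_subalgebra:
  assumes S: "S \<subseteq> carrier A" "\<one> \<in> S" and add: "\<And>x y. x \<in> S \<Longrightarrow> y \<in> S \<Longrightarrow> x \<oplus> y \<in> S"
    and mul: "\<And>x y. x \<in> S \<Longrightarrow> y \<in> S \<Longrightarrow> x \<otimes> y \<in> S" and sm: "\<And>c x. x \<in> S \<Longrightarrow> c \<odot> x \<in> S"
    and adj: "\<And>x. x \<in> S \<Longrightarrow> x\<star> \<in> S"
  shows "unital_cstar_subalgebra (norm_closure S) A"
proof -
  let ?C = "norm_closure S"
  have C: "?C \<subseteq> carrier A" unfolding norm_closure_def by auto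
  have ex: "\<exists>y\<in>S. y \<in> carrier A \<and> \<parallel>x \<ominus> y\<parallel> < e" if "x \<in> ?C" "0 < e" for x e
    using that S unfolding norm_closure_def by blast
  have inC: "x \<in> ?C" if xc: "x \<in> carrier A" and ap: "\<And>e. 0 < e \<Longrightarrow> \<exists>y\<in>S. \<parallel>x \<ominus> y\<parallel> \<le> e" for x
    unfolding norm_closure_def
  proof (clarify, intro conjI allI impI xc)
    fix e :: real assume e: "0 < e"
    then obtain y where "y \<in> S" "\<parallel>x \<ominus> y\<parallel> \<le> e / 2" using ap[of "e / 2"] half_gt_zero by blast
    moreover from this have "\<parallel>x \<ominus> y\<parallel> < e" using e by simp
    ultimately show "\<exists>y\<in>S. \<parallel>x \<ominus> y\<parallel> < e" by blast
  qed
  have addC: "x \<oplus> y \<in> ?C" if xy: "x \<in> ?C" "y \<in> ?C" for x y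
  proof (rule inC)
    fix e :: real assume "0 < e"
    then obtain x' y' where x': "x' \<in> S" "x' \<in> carrier A" "\<parallel>x \<ominus> x'\<parallel> < e / 2"
      and y': "y' \<in> S" "y' \<in> carrier A" "\<parallel>y \<ominus> y'\<parallel> < e / 2"
      using ex[OF xy(1), of "e / 2"] ex[OF xy(2), of "e / 2"] by auto
    have c: "x \<in> carrier A" "y \<in> carrier A" using xy C by auto
    have "(x \<oplus> y) \<ominus> (x' \<oplus> y') = (x \<ominus> x') \<oplus> (y \<ominus> y')" using c x' y' by (simp add: minus_eq minus_add a_ac)
    then have "\<parallel>(x \<oplus> y) \<ominus> (x' \<oplus> y')\<parallel> \<le> e" using cnorm_triangle[of "x \<ominus> x'" "y \<ominus> y'"] c x' y' by simp
    then show "\<exists>z\<in>S. \<parallel>(x \<oplus> y) \<ominus> z\<parallel> \<le> e" using add x' y' by blast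
  qed (use xy C in auto)
  have smC: "k \<odot> x \<in> ?C" if x: "x \<in> ?C" for k x
  proof (rule inC)
    fix e :: real assume e: "0 < e"
    have "0 < e / (cmod k + 1)" using e by (simp add: add_nonneg_pos)
    then obtain x' where x': "x' \<in> S" "x' \<in> carrier A" "\<parallel>x \<ominus> x'\<parallel> < e / (cmod k + 1)" using ex[OF x] by blast
    have c: "x \<in> carrier A" using x C by auto
    have "\<parallel>k \<odot> x \<ominus> k \<odot> x'\<parallel> = cmod k * \<parallel>x \<ominus> x'\<parallel>" using c x' by (simp add: smult_diff_right[symmetric] cnorm_smult)
    also have "\<dots> \<le> (cmod k + 1) * (e / (cmod k + 1))"
      using x' c by (intro mult_mono) (auto simp: cnorm_nonneg add_nonneg_nonneg)
    also have "\<dots> = e" by (metis add_nonneg_eq_0_iff nonzero_mult_div_cancel_left norm_ge_zero times_divide_eq_right zero_le_one zero_neq_one)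
    finally show "\<exists>z\<in>S. \<parallel>k \<odot> x \<ominus> z\<parallel> \<le> e" using sm x' by blast
  qed (use x C in auto)
  have mulC: "x \<otimes> y \<in> ?C" if xy: "x \<in> ?C" "y \<in> ?C" for x y
  proof (rule inC)
    have c: "x \<in> carrier A" "y \<in> carrier A" using xy C by auto
    fix e :: real assume e: "0 < e"
    \<comment> \<open>\<open>n\<close> bounds \<open>\<parallel>x\<parallel>\<close> and, because
      \<open>\<delta> \<le> 1\<close>, also \<open>\<parallel>y'\<parallel>\<close>. Each of the two
      error terms is then at most \<open>e / 2\<close>.\<close>
    define n where "n = \<parallel>x\<parallel> + \<parallel>y\<parallel> + 1"
    have n: "1 \<le> n" "\<parallel>x\<parallel> \<le> n" "\<parallel>y\<parallel> + 1 \<le> n" unfolding n_def using cnorm_nonneg c by auto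
    define \<delta> where "\<delta> = min 1 (e / (2 * n))"
    have \<delta>: "0 < \<delta>" "\<delta> \<le> 1" "\<delta> \<le> e / (2 * n)" unfolding \<delta>_def using e n by auto
    obtain x' y' where x': "x' \<in> S" "x' \<in> carrier A" "\<parallel>x \<ominus> x'\<parallel> < \<delta>"
      and y': "y' \<in> S" "y' \<in> carrier A" "\<parallel>y \<ominus> y'\<parallel> < \<delta>"
      using ex[OF xy(1) \<delta>(1)] ex[OF xy(2) \<delta>(1)] by auto
    have y'n: "\<parallel>y'\<parallel> \<le> n"
      using cnorm_le_diff_add[of y' y] cnorm_diff_commute[of y y'] c y' \<delta> n by simp
    have "x \<otimes> y \<ominus> x' \<otimes> y' = x \<otimes> (y \<ominus> y') \<oplus> (x \<ominus> x') \<otimes> y'"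
      using c x' y' by (simp add: minus_eq r_distr l_distr r_minus l_minus a_assoc r_neg1)
    then have "\<parallel>x \<otimes> y \<ominus> x' \<otimes> y'\<parallel> \<le> \<parallel>x \<otimes> (y \<ominus> y')\<parallel> + \<parallel>(x \<ominus> x') \<otimes> y'\<parallel>"
      using cnorm_triangle c x' y' by simp
    also have "\<dots> \<le> n * \<delta> + \<delta> * n" by (intro add_mono cnorm_mult_le) (use c x' y' n y'n in auto)
    also have "\<dots> \<le> e" using \<delta>(3) n by (simp add: field_simps)
    finally show "\<exists>z\<in>S. \<parallel>x \<otimes> y \<ominus> z\<parallel> \<le> e" using mul x' y' by blast
  qed (use xy C in auto)
  have adjC: "x\<star> \<in> ?C" if x: "x \<in> ?C" for x
  proof (rule inC)
    fix e :: real assume e: "0 < e"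
    obtain x' where x': "x' \<in> S" "x' \<in> carrier A" "\<parallel>x \<ominus> x'\<parallel> < e" using ex[OF x e] by blast
    have "x \<in> carrier A" using x C by auto
    then have "\<parallel>x\<star> \<ominus> x'\<star>\<parallel> = \<parallel>x \<ominus> x'\<parallel>" using x' by (simp add: adj_diff[symmetric])
    then show "\<exists>z\<in>S. \<parallel>x\<star> \<ominus> z\<parallel> \<le> e" using adj x' by (intro bexI[of _ "x'\<star>"]) auto
  qed (use x C in auto)
  have negC: "\<ominus> x \<in> ?C" if "x \<in> ?C" for x using smC[OF that, of "-1"] smult_minus_one[of x] that C by auto
  have SC: "S \<subseteq> ?C" by (rule norm_closure_superset[OF S(1)])
  have "\<zero> \<in> ?C" using smC[of \<one> 0] S(2) SC by auto
  then have "submodule ?C complex_ring A"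
    by (intro module.submoduleI[OF module]) (use C negC addC smC in auto)
  moreover have "subring ?C A" by (rule subringI) (use C negC addC mulC S SC in auto)
  ultimately show ?thesis
    unfolding unital_cstar_subalgebra_def using adjC closedin_norm_closure[OF S(1)] by blast
qed

end

section \<open>Verification of \<open>isometric_fibres\<close> for a represented product
  system\<close>

locale represented_product_system = unital_cstar A + G: totally_ordered_amenable_group G P +
    PS: product_system G P E p F pmult
  for A :: "'a cstar" (structure) and G :: "('g, 'm) monoid_scheme" and P :: "'g set"
    and E :: "'e set" and p :: "'e \<Rightarrow> 'g" and F :: "'g \<Rightarrow> 'e hilbert" and pmult :: "'e \<Rightarrow> 'e \<Rightarrow> 'e" +
  fixes i :: "'e \<Rightarrow> 'a"
  assumes rep: "ps_representation E p F pmult A i"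
    and one_not_zero: "\<one> \<noteq> \<zero>"
    and infinite_dim: "\<And>s. s \<in> P \<Longrightarrow> s \<noteq> \<one>\<^bsub>G\<^esub> \<Longrightarrow> \<not> finite_dimensional (F s)"
begin

lemma fibre_in: "t \<in> P \<Longrightarrow> x \<in> carrier (F t) \<Longrightarrow> x \<in> E \<and> p x = t"
  using PS.carrier_fibre by auto

lemma i_carrier [simp]: "t \<in> P \<Longrightarrow> x \<in> carrier (F t) \<Longrightarrow> i x \<in> carrier A"
  using rep fibre_in unfolding ps_representation_def by blast

lemma i_inner: "\<lbrakk>t \<in> P; x \<in> carrier (F t); y \<in> carrier (F t)\<rbrakk> \<Longrightarrow> (i y)\<star> \<otimes> i x = cinner (F t) x y \<odot> \<one>"
  using rep fibre_in[of t x] fibre_in[of t y] unfolding ps_representation_def by auto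

lemma i_mult: "\<lbrakk>s \<in> P; t \<in> P; x \<in> carrier (F s); y \<in> carrier (F t)\<rbrakk> \<Longrightarrow> i (pmult x y) = i x \<otimes> i y"
  using rep fibre_in unfolding ps_representation_def by blast

lemma pmult_fibre: "\<lbrakk>s \<in> P; t \<in> P; x \<in> carrier (F s); y \<in> carrier (F t)\<rbrakk> \<Longrightarrow> pmult x y \<in> carrier (F (s \<otimes>\<^bsub>G\<^esub> t))"
  using fibre_in[of s x] fibre_in[of t y] PS.carrier_fibre[of "s \<otimes>\<^bsub>G\<^esub> t"] G.P_closed PS.pmult_closed PS.proj_mult by auto

lemma i_norm: assumes "t \<in> P" "x \<in> carrier (F t)" shows "\<parallel>i x\<parallel> = hnorm (F t) x"
proof -
  interpret F: hilbert_space "F t" by (rule PS.fibre_hilbert[OF assms(1)])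
  have "\<parallel>i x\<parallel>\<^sup>2 = cmod (cinner (F t) x x)" using cstar_identity[of "i x"] i_inner[OF assms assms(2)] assms cnorm_one_cases one_not_zero cnorm_eq_0[of \<one>] by (auto simp: cnorm_smult)
  also have "\<dots> = (hnorm (F t) x)\<^sup>2" using F.cinner_self[OF assms(2)] by (simp add: norm_power)
  finally have "\<parallel>i x\<parallel>\<^sup>2 = (hnorm (F t) x)\<^sup>2" .
  moreover have "0 \<le> hnorm (F t) x" unfolding hnorm_def using F.cinner_nonneg[OF assms(2)] by simp
  ultimately show ?thesis using cnorm_nonneg[of "i x"] assms by (simp only: power2_eq_iff_nonneg i_carrier)
qed

lemma null_of_star_square: "z \<in> carrier A \<Longrightarrow> z\<star> \<otimes> z = \<zero> \<Longrightarrow> z = \<zero>"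
  using cstar_identity[of z] cnorm_eq_0[of z] by simp

text \<open>Linearity is not part of the notion of a representation; it follows from the inner
  products. The defect \<open>z\<close> satisfies \<open>(i w)\<star> \<otimes> z = \<zero>\<close>
  for every \<open>w\<close> in the fibre, and \<open>z\<close> is itself a combination of such
  \<open>i w\<close>, so \<open>z\<star> \<otimes> z = \<zero>\<close>.\<close>

lemma i_add: assumes t: "t \<in> P" and xy: "x \<in> carrier (F t)" "y \<in> carrier (F t)"
  shows "i (x \<oplus>\<^bsub>F t\<^esub> y) = i x \<oplus> i y"
proof -
  interpret F: hilbert_space "F t" by (rule PS.fibre_hilbert[OF t])
  let ?s = "x \<oplus>\<^bsub>F t\<^esub> y"
  define z where "z = i ?s \<ominus> (i x \<oplus> i y)"
  have s: "?s \<in> carrier (F t)" using xy by simp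
  have c: "i ?s \<in> carrier A" "i x \<in> carrier A" "i y \<in> carrier A" using s xy t by auto
  have zc: "z \<in> carrier A" unfolding z_def using c by simp
  have o: "(i w)\<star> \<otimes> z = \<zero>" if w: "w \<in> carrier (F t)" for w
  proof -
    have "(i w)\<star> \<otimes> z = cinner (F t) ?s w \<odot> \<one> \<ominus> (cinner (F t) x w \<odot> \<one> \<oplus> cinner (F t) y w \<odot> \<one>)"
      unfolding z_def using c w t xy s by (simp add: minus_eq r_distr r_minus i_inner)
    then show ?thesis using F.cinner_add_left[OF xy w] by (simp add: smult_add_left minus_eq r_neg)
  qed
  have "z\<star> \<otimes> z = (i ?s)\<star> \<otimes> z \<ominus> ((i x)\<star> \<otimes> z \<oplus> (i y)\<star> \<otimes> z)"
    by (subst (1) z_def) (use c zc in \<open>simp add: adj_uminus adj_add minus_eq minus_add l_distr l_minus\<close>)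
  also have "\<dots> = \<zero>" using o s xy by (simp add: minus_eq)
  finally have "z = \<zero>" using null_of_star_square zc by blast
  then show ?thesis unfolding z_def using c by (simp add: r_right_minus_eq)
qed

lemma i_smult: assumes t: "t \<in> P" and x: "x \<in> carrier (F t)"
  shows "i (c \<odot>\<^bsub>F t\<^esub> x) = c \<odot> i x"
proof -
  interpret F: hilbert_space "F t" by (rule PS.fibre_hilbert[OF t])
  let ?s = "c \<odot>\<^bsub>F t\<^esub> x"
  define z where "z = i ?s \<ominus> c \<odot> i x"
  have s: "?s \<in> carrier (F t)" using x by simp
  have c: "i ?s \<in> carrier A" "i x \<in> carrier A" using s x t by auto
  have zc: "z \<in> carrier A" unfolding z_def using c by simp
  have o: "(i w)\<star> \<otimes> z = \<zero>" if w: "w \<in> carrier (F t)" for w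
  proof -
    have "(i w)\<star> \<otimes> z = cinner (F t) ?s w \<odot> \<one> \<ominus> c \<odot> (cinner (F t) x w \<odot> \<one>)"
      unfolding z_def using c w t x s by (simp add: minus_eq r_distr r_minus i_inner)
    then show ?thesis using F.cinner_smult_left[OF x w] by (simp add: minus_eq r_neg)
  qed
  have "z\<star> \<otimes> z = (i ?s)\<star> \<otimes> z \<ominus> cnj c \<odot> ((i x)\<star> \<otimes> z)"
    by (subst (1) z_def) (use c zc in \<open>simp add: adj_uminus adj_add adj_smult minus_eq l_distr l_minus\<close>)
  also have "\<dots> = \<zero>" using o s x by (simp add: minus_eq)
  finally have "z = \<zero>" using null_of_star_square zc by blast
  then show ?thesis unfolding z_def using c by (simp add: r_right_minus_eq)
qed

text \<open>\<open>i\<close> is isometric on a complete fibre, so a sequence whose image converges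
  is Cauchy in the fibre. This lets \<open>i_divide\<close> pass from a dense subspace to the whole
  fibre.\<close>

lemma fibre_image_closed:
  assumes t: "t \<in> P" and w: "w \<in> carrier A" and ap: "\<And>e. 0 < e \<Longrightarrow> \<exists>z\<in>carrier (F t). \<parallel>w \<ominus> i z\<parallel> < e"
  shows "\<exists>z\<in>carrier (F t). w = i z"
proof -
  interpret F: hilbert_space "F t" by (rule PS.fibre_hilbert[OF t])
  interpret MS: Metric_space "carrier (F t)" "norm_dist (F t) (hnorm (F t))"
    by (rule embedded_metric(1)[OF PS.fibre_hilbert[OF t], of i]) (use t i_add i_norm in auto)
  have d: "norm_dist (F t) (hnorm (F t)) x y = \<parallel>i x \<ominus> i y\<parallel>" if "x \<in> carrier (F t)" "y \<in> carrier (F t)" for x y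
    by (rule embedded_metric(2)[OF PS.fibre_hilbert[OF t], of i]) (use that t i_add i_norm in auto)
  have "\<forall>n. \<exists>z\<in>carrier (F t). \<parallel>w \<ominus> i z\<parallel> < inverse (real (Suc n))" using ap by simp
  then obtain z where z: "\<And>n. z n \<in> carrier (F t)" "\<And>n. \<parallel>w \<ominus> i (z n)\<parallel> < inverse (real (Suc n))" by metis
  have close: "\<exists>N. \<forall>n\<ge>N. \<parallel>w \<ominus> i (z n)\<parallel> < e" if e: "0 < e" for e
  proof -
    obtain N where N: "inverse (real (Suc N)) < e" using reals_Archimedean[OF e] by blast
    have "\<parallel>w \<ominus> i (z n)\<parallel> < e" if "N \<le> n" for n
    proof -
      have "inverse (real (Suc n)) \<le> inverse (real (Suc N))" using that by (simp add: le_imp_inverse_le)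
      then show ?thesis using z(2)[of n] N by linarith
    qed
    then show ?thesis by blast
  qed
  have "MS.MCauchy z" unfolding MS.MCauchy_def
  proof (intro conjI allI impI)
    show "range z \<subseteq> carrier (F t)" using z by auto
    fix e :: real assume "0 < e"
    then obtain N where N: "\<And>n. N \<le> n \<Longrightarrow> \<parallel>w \<ominus> i (z n)\<parallel> < e / 2" using close[of "e / 2"] by auto
    have "norm_dist (F t) (hnorm (F t)) (z n) (z m) < e" if "N \<le> n" "N \<le> m" for n m
      using N[OF that(1)] N[OF that(2)] cnorm_diff_triangle[of "i (z n)" w "i (z m)"]
        cnorm_diff_commute[of w "i (z n)"] w z(1) t by (simp add: d)
    then show "\<exists>N. \<forall>n m. N \<le> n \<longrightarrow> N \<le> m \<longrightarrow> norm_dist (F t) (hnorm (F t)) (z n) (z m) < e" by blast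
  qed
  then obtain x where x: "limitin MS.mtopology z x sequentially"
    using F.hilbert_complete unfolding norm_complete_def MS.mcomplete_def by blast
  then have xc: "x \<in> carrier (F t)" unfolding MS.limitin_metric by blast
  have "\<parallel>w \<ominus> i x\<parallel> \<le> e" if e: "0 < e" for e
  proof -
    obtain N where N: "\<And>n. N \<le> n \<Longrightarrow> \<parallel>w \<ominus> i (z n)\<parallel> < e / 2" using close[of "e / 2"] e by auto
    obtain N' where N': "\<And>n. N' \<le> n \<Longrightarrow> norm_dist (F t) (hnorm (F t)) (z n) x < e / 2"
      using x e unfolding MS.limitin_metric eventually_sequentially by (meson half_gt_zero)
    have "\<parallel>w \<ominus> i x\<parallel> \<le> \<parallel>w \<ominus> i (z (max N N'))\<parallel> + \<parallel>i (z (max N N')) \<ominus> i x\<parallel>"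
      by (rule cnorm_diff_triangle) (use w z(1) xc t in auto)
    then show ?thesis using N[of "max N N'"] N'[of "max N N'"] d[OF z(1) xc, of "max N N'"] by simp
  qed
  then have "\<parallel>w \<ominus> i x\<parallel> \<le> 0" using field_le_epsilon[of "\<parallel>w \<ominus> i x\<parallel>" 0] by simp
  then have "w \<ominus> i x = \<zero>" using cnorm_nonneg[of "w \<ominus> i x"] cnorm_eq_0[of "w \<ominus> i x"] w xc t by simp
  then show ?thesis using w xc t by (auto simp: r_right_minus_eq)
qed

text \<open>The claim is clear for products \<open>y' z\<close> with \<open>y' \<in> E\<^sub>s\<close>, \<open>z \<in> E\<^sub>t\<close>; these have dense span.\<close>

lemma i_divide:
  assumes s: "s \<in> P" and t: "t \<in> P" and x: "x \<in> carrier (F s)" and y: "y \<in> carrier (F (s \<otimes>\<^bsub>G\<^esub> t))"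
  shows "\<exists>z\<in>carrier (F t). (i x)\<star> \<otimes> i y = i z"
proof -
  have st: "s \<otimes>\<^bsub>G\<^esub> t \<in> P" using s t by (rule G.P_closed)
  obtain T :: "('e \<times> 'e \<Rightarrow> complex) hilbert" and \<tau> U where tp: "hilbert_tensor_product (F s) (F t) T \<tau>"
    and U: "unitary_iso T (F (s \<otimes>\<^bsub>G\<^esub> t)) U"
    and U\<tau>: "\<forall>x\<in>carrier (F s). \<forall>y\<in>carrier (F t). U (\<tau> x y) = pmult x y"
    using PS.pmult_unitary[OF s t] by blast
  have T: "hilbert_space T" using tp unfolding hilbert_tensor_product_def by blast
  interpret T: hilbert_space T by (rule T)
  interpret Ft: hilbert_space "F t" by (rule PS.fibre_hilbert[OF t])
  define j where "j a = i (U a)" for a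
  have Uc: "U a \<in> carrier (F (s \<otimes>\<^bsub>G\<^esub> t))" if "a \<in> carrier T" for a
    using U that unfolding unitary_iso_def bij_betw_def by blast
  have jc: "j a \<in> carrier A" if "a \<in> carrier T" for a unfolding j_def using Uc[OF that] st by simp
  have jadd: "j (a \<oplus>\<^bsub>T\<^esub> a') = j a \<oplus> j a'" if "a \<in> carrier T" "a' \<in> carrier T" for a a'
    unfolding j_def using U that Uc i_add[OF st] unfolding unitary_iso_def by simp
  have jsm: "j (c \<odot>\<^bsub>T\<^esub> a) = c \<odot> j a" if "a \<in> carrier T" for a c
    unfolding j_def using U that Uc i_smult[OF st] unfolding unitary_iso_def by simp
  have jn: "\<parallel>j a\<parallel> = hnorm T a" if "a \<in> carrier T" for a
    unfolding j_def i_norm[OF st Uc[OF that]] hnorm_def using U that unfolding unitary_iso_def by simp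
  interpret MS: Metric_space "carrier T" "norm_dist T (hnorm T)"
    by (rule embedded_metric(1)[OF T, of j]) (use jc jadd jn in auto)
  have d: "norm_dist T (hnorm T) a a' = \<parallel>j a \<ominus> j a'\<parallel>" if "a \<in> carrier T" "a' \<in> carrier T" for a a'
    by (rule embedded_metric(2)[OF T, of j]) (use that jc jadd jn in auto)
  have xc: "i x \<in> carrier A" using x s by simp
  \<comment> \<open>The tensor product enters only through \<open>j\<close>, which carries it
    isometrically into \<open>A\<close>. \<open>Y\<close> collects the tensors for which the claim
    holds.\<close>
  define Y where "Y = {a \<in> carrier T. \<exists>z\<in>carrier (F t). (i x)\<star> \<otimes> j a = i z}"
  \<comment> \<open>From here on \<open>G\<close> is the set of elementary tensors and shadows the
    group.\<close>
  define G where "G = {\<tau> x y | x y. x \<in> carrier (F s) \<and> y \<in> carrier (F t)}"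
  have smY: "c \<odot>\<^bsub>T\<^esub> a \<in> Y" if a: "a \<in> Y" for c a
  proof -
    obtain z where z: "a \<in> carrier T" "z \<in> carrier (F t)" "(i x)\<star> \<otimes> j a = i z" using a unfolding Y_def by blast
    have "(i x)\<star> \<otimes> j (c \<odot>\<^bsub>T\<^esub> a) = i (c \<odot>\<^bsub>F t\<^esub> z)"
      using z xc jc[OF z(1)] by (simp add: jsm i_smult[OF t])
    then show ?thesis unfolding Y_def using z by blast
  qed
  have "submodule Y complex_ring T"
  proof (rule T.submoduleI)
    show "Y \<subseteq> carrier T" unfolding Y_def by blast
    have "0 \<odot>\<^bsub>F t\<^esub> \<zero>\<^bsub>F t\<^esub> \<in> carrier (F t)" by simp
    moreover have "j \<zero>\<^bsub>T\<^esub> = \<zero>" using jadd[of "\<zero>\<^bsub>T\<^esub>" "\<zero>\<^bsub>T\<^esub>"] jc[of "\<zero>\<^bsub>T\<^esub>"] by simp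
    moreover have "i \<zero>\<^bsub>F t\<^esub> = \<zero>" using i_add[OF t, of "\<zero>\<^bsub>F t\<^esub>" "\<zero>\<^bsub>F t\<^esub>"] i_carrier[OF t, of "\<zero>\<^bsub>F t\<^esub>"] by simp
    ultimately show "\<zero>\<^bsub>T\<^esub> \<in> Y" unfolding Y_def using xc by (auto intro!: bexI[of _ "\<zero>\<^bsub>F t\<^esub>"])
    show "\<ominus>\<^bsub>T\<^esub> a \<in> Y" if "a \<in> Y" for a
      using smY[OF that, of "-1"] T.hsmult_minus_one[of a] that unfolding Y_def by simp
    show "a \<oplus>\<^bsub>T\<^esub> a' \<in> Y" if a: "a \<in> Y" "a' \<in> Y" for a a'
    proof -
      obtain z z' where z: "a \<in> carrier T" "z \<in> carrier (F t)" "(i x)\<star> \<otimes> j a = i z"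
        "a' \<in> carrier T" "z' \<in> carrier (F t)" "(i x)\<star> \<otimes> j a' = i z'" using a unfolding Y_def by blast
      have "(i x)\<star> \<otimes> j (a \<oplus>\<^bsub>T\<^esub> a') = i (z \<oplus>\<^bsub>F t\<^esub> z')"
        using z xc jc by (simp add: jadd i_add[OF t] r_distr)
      then show ?thesis unfolding Y_def using z by blast
    qed
  qed (use smY in auto)
  moreover have "G \<subseteq> Y"
  proof
    fix a assume "a \<in> G"
    then obtain y' z where a: "a = \<tau> y' z" "y' \<in> carrier (F s)" "z \<in> carrier (F t)" unfolding G_def by blast
    have ac: "a \<in> carrier T" using tp a unfolding hilbert_tensor_product_def by blast
    have zc: "i y' \<in> carrier A" "i z \<in> carrier A" using a s t by auto
    have "(i x)\<star> \<otimes> j a = (i x)\<star> \<otimes> i y' \<otimes> i z"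
      unfolding j_def using a U\<tau> i_mult[OF s t a(2,3)] xc zc by (simp add: m_assoc)
    also have "\<dots> = i (cinner (F s) y' x \<odot>\<^bsub>F t\<^esub> z)"
      using i_inner[OF s a(2) x] zc a(3) by (simp add: i_smult[OF t])
    finally show "a \<in> Y" unfolding Y_def using ac a(3) by blast
  qed
  ultimately have YG: "cspan T G \<subseteq> Y" by (rule T.cspan_minimal)
  obtain a where a: "a \<in> carrier T" "y = U a" using U y unfolding unitary_iso_def bij_betw_def by blast
  have "MS.mtopology closure_of (cspan T G) = carrier T"
    using tp unfolding hilbert_tensor_product_def norm_topology_def G_def by blast
  then have dense: "\<exists>a'\<in>cspan T G. a' \<in> MS.mball a e" if "0 < e" for e
    using a(1) that unfolding MS.metric_closure_of by blast
  show ?thesis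
  proof (rule fibre_image_closed[OF t])
    show "(i x)\<star> \<otimes> i y \<in> carrier A" using xc y st by simp
    fix e :: real assume e: "0 < e"
    have pos: "0 < \<parallel>i x\<parallel> + 1" using cnorm_nonneg[OF xc] by simp
    obtain a' where a': "a' \<in> cspan T G" "a' \<in> MS.mball a (e / (\<parallel>i x\<parallel> + 1))" using dense[of "e / (\<parallel>i x\<parallel> + 1)"] e pos by auto
    have a'c: "a' \<in> carrier T" and near: "\<parallel>j a \<ominus> j a'\<parallel> < e / (\<parallel>i x\<parallel> + 1)" using a' d[OF a(1)] by (auto simp: MS.in_mball)
    obtain z where z: "z \<in> carrier (F t)" "(i x)\<star> \<otimes> j a' = i z" using YG a'(1) unfolding Y_def by blast
    have "(i x)\<star> \<otimes> i y \<ominus> i z = (i x)\<star> \<otimes> (j a \<ominus> j a')"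
      unfolding z(2)[symmetric] a(2) j_def[symmetric] using xc jc a(1) a'c by (simp add: minus_eq r_distr r_minus)
    then have "\<parallel>(i x)\<star> \<otimes> i y \<ominus> i z\<parallel> \<le> \<parallel>i x\<parallel> * \<parallel>j a \<ominus> j a'\<parallel>"
      using cnorm_mult[of "(i x)\<star>" "j a \<ominus> j a'"] xc jc a(1) a'c by simp
    also have "\<dots> \<le> (\<parallel>i x\<parallel> + 1) * \<parallel>j a \<ominus> j a'\<parallel>" using cnorm_nonneg jc a(1) a'c by (intro mult_right_mono) auto
    also have "\<dots> < e" using near pos by (simp add: pos_less_divide_eq mult.commute)
    finally show "\<exists>z\<in>carrier (F t). \<parallel>(i x)\<star> \<otimes> i y \<ominus> i z\<parallel> < e" using z by blast
  qed
qed

text \<open>A vector \<open>u\<close> spanning the one-dimensional fibre satisfies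
  \<open>q \<otimes> q = c \<odot> q\<close> for \<open>q = i u\<close>. As
  \<open>q\<star> \<otimes> q\<close> is a nonzero scalar, one factor \<open>q\<close> can be
  cancelled on the left, so \<open>q\<close> itself is a nonzero scalar.\<close>

lemma i_unit: "\<exists>u\<in>carrier (F \<one>\<^bsub>G\<^esub>). \<one> = i u"
proof -
  have eP: "\<one>\<^bsub>G\<^esub> \<in> P" by simp
  interpret F: hilbert_space "F \<one>\<^bsub>G\<^esub>" by (rule PS.fibre_hilbert[OF eP])
  obtain u where u: "u \<in> carrier (F \<one>\<^bsub>G\<^esub>)" "u \<noteq> \<zero>\<^bsub>F \<one>\<^bsub>G\<^esub>\<^esub>" "cspan (F \<one>\<^bsub>G\<^esub>) {u} = carrier (F \<one>\<^bsub>G\<^esub>)"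
    using PS.unit_fibre unfolding one_dimensional_def by blast
  have "pmult u u \<in> carrier (F \<one>\<^bsub>G\<^esub>)" using pmult_fibre[OF eP eP u(1) u(1)] by simp
  then obtain c where c: "pmult u u = c \<odot>\<^bsub>F \<one>\<^bsub>G\<^esub>\<^esub> u"
    using F.cspan_singleton[OF u(1)] unfolding u(3) by blast
  define q where "q = i u"
  have qc: "q \<in> carrier A" unfolding q_def by (rule i_carrier[OF eP u(1)])
  have qq: "q \<otimes> q = c \<odot> q"
    using i_mult[OF eP eP u(1) u(1)] i_smult[OF eP u(1), of c] c unfolding q_def by simp
  define r where "r = cinner (F \<one>\<^bsub>G\<^esub>) u u"
  have r0: "r \<noteq> 0" unfolding r_def using F.cinner_definite u by blast
  have rq: "q\<star> \<otimes> q = r \<odot> \<one>" unfolding q_def r_def by (rule i_inner[OF eP u(1) u(1)])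
  have "r \<odot> q = q\<star> \<otimes> q \<otimes> q" using rq qc by simp
  also have "\<dots> = q\<star> \<otimes> (q \<otimes> q)" using qc by (simp add: m_assoc)
  also have "\<dots> = c \<odot> (r \<odot> \<one>)" unfolding qq using rq qc by simp
  also have "\<dots> = r \<odot> (c \<odot> \<one>)" by (simp add: mult.commute)
  finally have "r \<odot> q = r \<odot> (c \<odot> \<one>)" .
  then have q: "q = c \<odot> \<one>" using smult_cancel[OF r0 qc, of "c \<odot> \<one>"] by simp
  have "c \<noteq> 0"
  proof
    assume "c = 0"
    then have "r \<odot> \<one> = \<zero>" using rq q by simp
    then show False using r0 cnorm_smult[of \<one> r] one_not_zero cnorm_eq_0[of \<one>] by simp
  qed
  then have "\<one> = inverse c \<odot> q" unfolding q by simp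
  also have "\<dots> = i (inverse c \<odot>\<^bsub>F \<one>\<^bsub>G\<^esub>\<^esub> u)" unfolding q_def using i_smult[OF eP u(1)] by simp
  finally show ?thesis using u(1) by blast
qed

sublocale isometric_fibres A G P "\<lambda>s. i ` carrier (F s)"
proof
  fix s assume s: "s \<in> P"
  interpret F: hilbert_space "F s" by (rule PS.fibre_hilbert[OF s])
  show "i ` carrier (F s) \<subseteq> carrier A" using s by auto
  show "c \<odot> x \<in> i ` carrier (F s)" if "x \<in> i ` carrier (F s)" for c x
    using that i_smult[OF s, symmetric] by auto
  show "x \<oplus> y \<in> i ` carrier (F s)" if "x \<in> i ` carrier (F s)" "y \<in> i ` carrier (F s)" for x y
    using that i_add[OF s, symmetric] by auto
  show "x\<star> \<otimes> x = of_real (\<parallel>x\<parallel>\<^sup>2) \<odot> \<one>" if "x \<in> i ` carrier (F s)" for x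
    using that i_inner[OF s] F.cinner_self i_norm[OF s] by auto
  show "\<exists>c. x\<star> \<otimes> y = c \<odot> \<one>" if "x \<in> i ` carrier (F s)" "y \<in> i ` carrier (F s)" for x y
    using that i_inner[OF s] by auto
  show "\<exists>x\<in>i ` carrier (F s). x\<star> \<otimes> x = \<one>"
  proof -
    obtain x where "x \<in> carrier (F s)" "x \<noteq> \<zero>\<^bsub>F s\<^esub>" using PS.fibre_nontrivial[OF s] F.M.zero_closed by blast
    then obtain c where "cinner (F s) (c \<odot>\<^bsub>F s\<^esub> x) (c \<odot>\<^bsub>F s\<^esub> x) = 1" using F.unit_vector by blast
    then show ?thesis using i_inner[OF s, of "c \<odot>\<^bsub>F s\<^esub> x" "c \<odot>\<^bsub>F s\<^esub> x"] \<open>x \<in> carrier (F s)\<close> by auto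
  qed
  show "\<exists>x\<in>i ` carrier (F s). x\<star> \<otimes> x = \<one> \<and> (\<forall>m\<in>M. m\<star> \<otimes> x = \<zero>)"
    if s1: "s \<noteq> \<one>\<^bsub>G\<^esub>" and M: "finite M" "M \<subseteq> i ` carrier (F s)" for M
  proof -
    obtain N where N: "N \<subseteq> carrier (F s)" "finite N" "M = i ` N" using M by (meson finite_subset_image)
    obtain x where x: "x \<in> carrier (F s)" "cinner (F s) x x = 1" "\<forall>n\<in>N. cinner (F s) x n = 0"
      using F.orthogonal_unit_vector[OF infinite_dim[OF s s1] N(2,1)] by blast
    have "(i m)\<star> \<otimes> i x = \<zero>" if m: "m \<in> N" for m
    proof -
      have "m \<in> carrier (F s)" using m N(1) by blast
      then show ?thesis using i_inner[OF s x(1), of m] x(3) m by simp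
    qed
    then show ?thesis using i_inner[OF s x(1) x(1)] x N(3) by auto
  qed
next
  fix s t x y assume "s \<in> P" "t \<in> P" "x \<in> i ` carrier (F s)" "y \<in> i ` carrier (F t)"
  then show "x \<otimes> y \<in> i ` carrier (F (s \<otimes>\<^bsub>G\<^esub> t))" using i_mult[symmetric] pmult_fibre by auto
next
  fix s t x y assume "s \<in> P" "t \<in> P" "x \<in> i ` carrier (F s)" "y \<in> i ` carrier (F (s \<otimes>\<^bsub>G\<^esub> t))"
  then show "x\<star> \<otimes> y \<in> i ` carrier (F t)" using i_divide by force
next
  show "\<one> \<in> i ` carrier (F \<one>\<^bsub>G\<^esub>)" using i_unit by blast
qed (rule one_not_zero)

lemma monomials_dense:
  assumes "cstar_generated_by A (i ` E)"
  shows "norm_closure (sp P (\<lambda>_ _. True)) = carrier A"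
proof -
  let ?L = "sp P (\<lambda>_ _. True)"
  have mono: "i x \<in> ?L" if "x \<in> E" for x
  proof -
    have px: "p x \<in> P" "x \<in> carrier (F (p x))" using that PS.proj_closed PS.carrier_fibre by auto
    have "i x \<otimes> \<one>\<star> \<in> ?L" by (rule spI[of P "p x" "\<one>\<^bsub>G\<^esub>"]) (use px H_one in auto)
    then show ?thesis using px by simp
  qed
  have L: "?L \<subseteq> carrier A" using sp_carrier[OF subset_refl] by blast
  have "unital_cstar_subalgebra (norm_closure ?L) A"
  proof (rule norm_closure_subalgebra[OF L])
    show "\<one> \<in> ?L" using spI[of P "\<one>\<^bsub>G\<^esub>" "\<one>\<^bsub>G\<^esub>" "\<lambda>_ _. True" \<one> \<one>] H_one by simp
    show "x \<otimes> y \<in> ?L" if "x \<in> ?L" "y \<in> ?L" for x y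
      by (rule sp_mult[OF subset_refl _ _ that]) (use G.P_closed in \<open>auto simp: G.below_def\<close>)
    show "x\<star> \<in> ?L" if "x \<in> ?L" for x
      by (rule sp_adj[OF subset_refl _ that]) auto
  qed (auto intro: sp_plus sp_smult)
  moreover have "i ` E \<subseteq> norm_closure ?L" using mono norm_closure_superset[OF L] by blast
  ultimately show ?thesis using assms unfolding cstar_generated_by_def by blast
qed

end

section \<open>The theorem\<close>

theorem mainTheorem8:
  fixes G :: "('g, 'm) monoid_scheme" and P :: "'g set"
    and E :: "'e set" and p :: "'e \<Rightarrow> 'g" and F :: "'g \<Rightarrow> 'e hilbert"
    and pmult :: "'e \<Rightarrow> 'e \<Rightarrow> 'e"
    and A :: "'a cstar" and i :: "'e \<Rightarrow> 'a"
    and \<iota> :: "real \<Rightarrow> 'b"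
  assumes "totally_ordered_amenable_group G P"
    and "product_system G P E p F pmult"
    and "\<forall>s\<in>P - {\<one>\<^bsub>G\<^esub>}. \<not> finite_dimensional (F s)"
    and "inj \<iota>"
    and "universal_cstar TYPE('b) E p F pmult A i"
  shows "cstar_simple A"
proof -
  have A: "unital_cstar_algebra A" and rep: "ps_representation E p F pmult A i"
    and gen: "cstar_generated_by A (i ` E)"
    using assms(5) unfolding universal_cstar_def by blast+
  have A': "unital_cstar A"
    using A by (auto simp: unital_cstar_def unital_cstar_axioms_def unital_cstar_algebra_def)
  interpret unital_cstar A by (rule A')
  show ?thesis
  \<comment> \<open>\<open>isometric_fibres\<close> excludes the zero algebra, which is simple in
    the sense of \<open>cstar_simple\<close> because its only ideal is the zero ideal.\<close>
  proof (cases "\<one>\<^bsub>A\<^esub> = \<zero>\<^bsub>A\<^esub>")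
    case True
    then have "carrier A = {\<zero>\<^bsub>A\<^esub>}" using one_zeroD by simp
    then show ?thesis
      unfolding cstar_simple_def
      using additive_subgroup.a_subset[OF ideal.axioms(1)] additive_subgroup.zero_closed[OF ideal.axioms(1)] by blast
  next
    case False
    have "represented_product_system A G P E p F pmult i"
      by (intro represented_product_system.intro represented_product_system_axioms.intro A' assms(1,2) rep False)
         (use assms(3) in blast)
    then interpret represented_product_system A G P E p F pmult i .
    show ?thesis
      unfolding cstar_simple_def using closed_ideal_trivial monomials_dense[OF gen] by blast
  qed
qed

end
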